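(* Let $r\ge 1$ and let $4\le n_1\le n_2\le\cdots\le n_r$ be integers. For $1\le i\le r$ let $G_i=C_{n_i}^c$ be the complement of the cycle of length $n_i$, on vertex set $V_i=\{v_{i,j}:1\le j\le n_i\}$, the sets $V_i$ being pairwise disjoint. Let $G$ be the disjoint union of the graphs $G_1,\dots,G_r$, on vertex set $V=V_1\cup\cdots\cup V_r$. Then $\mathrm{reg}(I_G)=2r+1$, and the relative jump sequence of $I_G$ is $$[2r;\underbrace{1,1,\dots,1}_{r-1},n_1-3,n_2-3,\dots,n_r-3].$$
   Context: Let $\Bbbk$ be a field of characteristic zero. For a finite simple graph $G=(V,E)$ on $n$ vertices with at least one edge, let $R=\Bbbk[x_1,\dots,x_n]$ have one variable per vertex, and let the edge ideal be $I_G=(x_ix_j:\{i,j\}\in E)$. Convention: $\beta_{i,j}=\beta_{i,j}(I_G)$ denotes the graded Betti number of the quotient $R/I_G$ in homological degree $i$ and internal degree $j$ (so $\beta_{1,2}$ is the number of edges of $G$), and $\mathrm{reg}(I_G)=\max\{j-i+1:\beta_{i,j}\ne 0\}$. If $\mathrm{reg}(I_G)=k+1$, the jump sequence of $I_G$ is $[k;a_1,\dots,a_{k-1}]$, where $a_s=\min\{i:\beta_{i,i+s+1}\neq 0\}-1$ for $1\le s\le k-1$. The relative jump sequence is $[k;\rho_1,\dots,\rho_{k-1}]$ with $\rho_1=a_1$ and $\rho_j=a_j-a_{j-1}$ for $j\ge 2$. *)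

theory Defs
  imports Main "HOL-Library.Poly_Mapping"
begin

section \<open>Graphs\<close>

text \<open>A graph is a pair of a vertex set and a set of (two-element) edges.\<close>

type_synonym 'v graph = "'v set \<times> 'v set set"

abbreviation verts :: "'v graph \<Rightarrow> 'v set" where "verts \<equiv> fst"
abbreviation edges :: "'v graph \<Rightarrow> 'v set set" where "edges \<equiv> snd"

text \<open>The successor of \<open>j\<close> in the cyclic order of \<open>1, \<dots>, n\<close> is \<open>j mod n + 1\<close>. This is a simple
  cycle only if \<open>n \<ge> 3\<close> and \<open>w\<close> is injective on \<open>{1..n}\<close>.\<close>

definition cycle_graph :: "nat \<Rightarrow> (nat \<Rightarrow> 'v) \<Rightarrow> 'v graph" where
  "cycle_graph n w = (w ` {1..n}, {{w j, w (j mod n + 1)} | j. j \<in> {1..n}})"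

definition complement_graph :: "'v graph \<Rightarrow> 'v graph" where
  "complement_graph G =
     (verts G, {{x, y} | x y. x \<in> verts G \<and> y \<in> verts G \<and> x \<noteq> y} - edges G)"

definition union_graph :: "'i set \<Rightarrow> ('i \<Rightarrow> 'v graph) \<Rightarrow> 'v graph" where
  "union_graph A H = (\<Union>i\<in>A. verts (H i), \<Union>i\<in>A. edges (H i))"


section \<open>Polynomial rings and edge ideals\<close>

text \<open>Polynomials over \<open>'k\<close> in variables indexed by the type \<open>'v\<close> form a type; the ring
  \<open>k[x\<^sub>v : v \<in> V]\<close> is its subset \<open>poly_ring V\<close>.\<close>

type_synonym ('v, 'k) mpoly = "('v \<Rightarrow>\<^sub>0 nat) \<Rightarrow>\<^sub>0 'k"

definition poly_ring :: "'v set \<Rightarrow> ('v, 'k::field) mpoly set" where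
  "poly_ring V = {p. \<forall>m\<in>Poly_Mapping.keys p. Poly_Mapping.keys m \<subseteq> V}"

definition var :: "'v \<Rightarrow> ('v, 'k::field) mpoly" where
  "var x = Poly_Mapping.single (Poly_Mapping.single x 1) 1"

definition monom_degree :: "('v \<Rightarrow>\<^sub>0 nat) \<Rightarrow> nat" where
  "monom_degree m = (\<Sum>x\<in>Poly_Mapping.keys m. Poly_Mapping.lookup m x)"

definition homogeneous :: "nat \<Rightarrow> ('v, 'k::field) mpoly \<Rightarrow> bool" where
  "homogeneous e p \<longleftrightarrow> (\<forall>m\<in>Poly_Mapping.keys p. monom_degree m = e)"

definition ideal_generated :: "'v set \<Rightarrow> ('v, 'k::field) mpoly set \<Rightarrow> ('v, 'k) mpoly set" where
  "ideal_generated V B =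
     {\<Sum>b\<in>C. q b * b | C q. finite C \<and> C \<subseteq> B \<and> (\<forall>b\<in>C. q b \<in> poly_ring V)}"

definition edge_ideal :: "'v graph \<Rightarrow> ('v, 'k::field) mpoly set" where
  "edge_ideal G = ideal_generated (verts G) {var x * var y | x y. {x, y} \<in> edges G}"


section \<open>Graded free modules and minimal graded free resolutions\<close>

text \<open>For \<open>b :: nat \<Rightarrow> nat\<close>, the graded free module \<open>\<Oplus>\<^sub>j R(-j)\<^bsup>b j\<^esup>\<close> over \<open>R = poly_ring V\<close> has
  one basis element of degree \<open>j\<close> for every pair \<open>(j, l)\<close> with \<open>l < b j\<close>. Its elements are
  finitely supported coefficient vectors with respect to this basis.\<close>

type_synonym ('v, 'k) fvec = "(nat \<times> nat) \<Rightarrow>\<^sub>0 ('v, 'k) mpoly"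

definition free_module :: "'v set \<Rightarrow> (nat \<Rightarrow> nat) \<Rightarrow> ('v, 'k::field) fvec set" where
  "free_module V b =
     {f. Poly_Mapping.keys f \<subseteq> {(j, l). l < b j} \<and>
         (\<forall>c. Poly_Mapping.lookup f c \<in> poly_ring V)}"

definition scale_fvec :: "('v, 'k::field) mpoly \<Rightarrow> ('v, 'k) fvec \<Rightarrow> ('v, 'k) fvec" where
  "scale_fvec p f = Poly_Mapping.map ((*) p) f"

definition homogeneous_fvec :: "nat \<Rightarrow> ('v, 'k::field) fvec \<Rightarrow> bool" where
  "homogeneous_fvec e f \<longleftrightarrow>
     (\<forall>(j, l)\<in>Poly_Mapping.keys f.
        \<forall>m\<in>Poly_Mapping.keys (Poly_Mapping.lookup f (j, l)). monom_degree m + j = e)"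

text \<open>The submodule \<open>\<mm> F\<close> of a free module \<open>F\<close>, where \<open>\<mm>\<close> is the ideal generated by the
  variables: all coefficients have constant term zero.\<close>

definition irrelevant_part :: "('v, 'k::field) fvec set \<Rightarrow> ('v, 'k) fvec set" where
  "irrelevant_part F = {f \<in> F. \<forall>c. Poly_Mapping.lookup (Poly_Mapping.lookup f c) 0 = 0}"

text \<open>\<open>poly_ring V\<close>-linear maps of degree zero from \<open>M\<close> to \<open>N\<close>, with scalar multiplications
  \<open>s\<close>, \<open>t\<close> and homogeneity predicates \<open>hM\<close>, \<open>hN\<close>. Nothing is required outside of \<open>M\<close>.\<close>

definition graded_hom ::
  "'v set \<Rightarrow> (('v, 'k::field) mpoly \<Rightarrow> 'a \<Rightarrow> 'a) \<Rightarrow> (nat \<Rightarrow> 'a \<Rightarrow> bool) \<Rightarrow> 'a::ab_group_add set \<Rightarrow>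
   (('v, 'k) mpoly \<Rightarrow> 'b \<Rightarrow> 'b) \<Rightarrow> (nat \<Rightarrow> 'b \<Rightarrow> bool) \<Rightarrow> 'b::ab_group_add set \<Rightarrow>
   ('a \<Rightarrow> 'b) \<Rightarrow> bool" where
  "graded_hom V s hM M t hN N h \<longleftrightarrow>
     h ` M \<subseteq> N \<and>
     (\<forall>f\<in>M. \<forall>g\<in>M. h (f + g) = h f + h g) \<and>
     (\<forall>p\<in>poly_ring V. \<forall>f\<in>M. h (s p f) = t p (h f)) \<and>
     (\<forall>f\<in>M. \<forall>e. hM e f \<longrightarrow> hN e (h f))"

text \<open>\<open>\<dots> \<rightarrow> F\<^sub>2 \<rightarrow> F\<^sub>1 \<rightarrow> F\<^sub>0 \<rightarrow> R/I \<rightarrow> 0\<close> is a minimal graded free resolution, where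
  \<open>F\<^sub>i = \<Oplus>\<^sub>j R(-j)\<^bsup>\<beta> i j\<^esup>\<close> and \<open>d i : F\<^sub>i\<^sub>+\<^sub>1 \<rightarrow> F\<^sub>i\<close>. The augmentation \<open>F\<^sub>0 \<rightarrow> R/I\<close> is given by a
  lift \<open>\<epsilon> : F\<^sub>0 \<rightarrow> R\<close>, which exists because \<open>F\<^sub>0\<close> is free; hence surjectivity and the kernel
  of the augmentation are expressed modulo \<open>I\<close>.\<close>

definition minimal_graded_free_resolution ::
  "'v set \<Rightarrow> ('v, 'k::field) mpoly set \<Rightarrow> (nat \<Rightarrow> nat \<Rightarrow> nat) \<Rightarrow>
   (nat \<Rightarrow> ('v, 'k) fvec \<Rightarrow> ('v, 'k) fvec) \<Rightarrow> (('v, 'k) fvec \<Rightarrow> ('v, 'k) mpoly) \<Rightarrow> bool" where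
  "minimal_graded_free_resolution V I \<beta> d \<epsilon> \<longleftrightarrow>
     (let F = (\<lambda>i. free_module V (\<beta> i)) in
        graded_hom V scale_fvec homogeneous_fvec (F 0) (*) homogeneous (poly_ring V) \<epsilon> \<and>
        (\<forall>i. graded_hom V scale_fvec homogeneous_fvec (F (Suc i))
               scale_fvec homogeneous_fvec (F i) (d i)) \<and>
        (\<forall>p\<in>poly_ring V. \<exists>f\<in>F 0. \<epsilon> f - p \<in> I) \<and>
        d 0 ` F 1 = {f \<in> F 0. \<epsilon> f \<in> I} \<and>
        (\<forall>i. d (Suc i) ` F (Suc (Suc i)) = {f \<in> F (Suc i). d i f = 0}) \<and>
        (\<forall>i. d i ` F (Suc i) \<subseteq> irrelevant_part (F i)))"


section \<open>Betti numbers, regularity and jump sequences\<close>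

text \<open>\<open>betti V I i j\<close> is the graded Betti number \<open>\<beta>\<^sub>i\<^sub>,\<^sub>j\<close> of the quotient \<open>R/I\<close>, for a homogeneous
  ideal \<open>I\<close> of \<open>R = poly_ring V\<close> with \<open>V\<close> finite. It does not depend on the chosen resolution,
  since minimal graded free resolutions are unique up to isomorphism.\<close>

definition betti :: "'v set \<Rightarrow> ('v, 'k::field) mpoly set \<Rightarrow> nat \<Rightarrow> nat \<Rightarrow> nat" where
  "betti V I = (SOME \<beta>. \<exists>d \<epsilon>. minimal_graded_free_resolution V I \<beta> d \<epsilon>)"

text \<open>The regularity of \<open>I\<close> itself, expressed by the Betti numbers of \<open>R/I\<close>.\<close>

definition regularity :: "'v set \<Rightarrow> ('v, 'k::field) mpoly set \<Rightarrow> int" where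
  "regularity V I = Max {int j - int i + 1 | i j. betti V I i j \<noteq> 0}"

text \<open>The entry \<open>a\<^sub>s\<close> of the jump sequence, for \<open>1 \<le> s \<le> reg(I) - 2\<close>.\<close>

definition jump :: "'v set \<Rightarrow> ('v, 'k::field) mpoly set \<Rightarrow> nat \<Rightarrow> int" where
  "jump V I s = int (LEAST i. betti V I i (i + s + 1) \<noteq> 0) - 1"

text \<open>The relative jump sequence \<open>[k; \<rho>\<^sub>1, \<dots>, \<rho>\<^sub>k\<^sub>-\<^sub>1]\<close>, as a pair of \<open>k = reg(I) - 1\<close> and the list of
  the \<open>\<rho>\<^sub>s\<close>.\<close>

definition relative_jump_sequence :: "'v set \<Rightarrow> ('v, 'k::field) mpoly set \<Rightarrow> nat \<times> int list" where
  "relative_jump_sequence V I =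
     (let k = nat (regularity V I - 1) in
        (k, map (\<lambda>s. if s = 1 then jump V I 1 else jump V I s - jump V I (s - 1)) [1..<k]))"

end

theory Submission
  imports Defs "HOL.Vector_Spaces"
begin

text \<open>The graded Betti numbers of \<open>R/I\<close> are read off the Koszul homology of \<open>R/I\<close>: in a minimal
  free resolution, Koszul homology is shifted along each short exact sequence of syzygies until it
  becomes the space of minimal generators. Koszul homology splits into multidegrees, and for the
  squarefree monomial ideal of a graph the multidegree \<open>W \<subseteq> V\<close> contributes the reduced cohomology of
  the independence complex of \<open>G[W]\<close> (Hochster's formula), where the strand \<open>j - i\<close> is the size of
  the faces.

  The independence complex of the complement of a cycle of length \<open>\<ge> 4\<close> is the cycle itself, so
  that of \<open>G\<close> is a join of \<open>r\<close> circles. Removing vertices whose successor on the cycle is absent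
  shows that cohomology with faces of size \<open>e\<close> needs \<open>e \<le> 2f + g\<close>, where \<open>f\<close> of the cycles are
  contained in \<open>W\<close> and \<open>g\<close> of them meet \<open>W\<close> in a proper nonempty subset, which has at least two
  elements. Conversely, joins of circles and pairs of nonadjacent points are spheres. Minimizing
  \<open>|W|\<close> gives the first index \<open>e + \<Sum>\<^sub>i\<^sub>\<le>\<^sub>e\<^sub>-\<^sub>r (n\<^sub>i - 4)\<close> of the strand \<open>e\<close>.\<close>


section \<open>Cochain complexes of simplicial complexes\<close>

text \<open>Regularity and jumps only ask which Betti numbers vanish, so no dimension of cohomology
  is computed and no two resolutions are compared: the Koszul criterion holds for every minimal
  resolution, hence for whichever one \<open>betti\<close> picks. That one exists has to be proved,
  since otherwise the choice would be arbitrary.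

  Cochains appear because passing from a Koszul index set to its complement turns adjoining a
  variable into removing a vertex. Signs stay abstract, because each link carries its own. An exact
  sequence of deletion and link stands in for homotopy theory.

  The piece of a circle inside \<open>W\<close> is empty, the circle, or a disjoint union of arcs. A
  single arc is contractible and makes the whole join contractible; hence a partial piece must have
  at least two arcs, so two vertices, and yields one unit of face size. A full circle yields two
  units for \<open>n i\<close> vertices. Face size \<open>e\<close> thus costs \<open>2 * e\<close>
  vertices plus \<open>n i - 4\<close> for each full circle, at least \<open>e - r\<close> circles
  are full, and the shortest are the cheapest. The homological index is the number of vertices minus
  \<open>e\<close>.\<close>

definition sign_rule :: "'v set set \<Rightarrow> ('v \<Rightarrow> 'v set \<Rightarrow> 'k::field) \<Rightarrow> bool" where
  "sign_rule D s \<longleftrightarrow>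
     (\<forall>t\<in>D. \<forall>x\<in>t. s x t \<noteq> 0 \<and>
        (\<forall>y\<in>t. x \<noteq> y \<longrightarrow> s x t * s y (t - {x}) = - (s y t * s x (t - {y}))))"

definition cobd :: "('v \<Rightarrow> 'v set \<Rightarrow> 'k::field) \<Rightarrow> ('v set \<Rightarrow> 'k) \<Rightarrow> 'v set \<Rightarrow> 'k" where
  "cobd s u t = (\<Sum>x\<in>t. s x t * u (t - {x}))"

text \<open>The index \<open>e\<close> counts the vertices of a face, one more than its dimension.
  The empty face has size 0, so the cohomology is reduced without a special case.\<close>

definition cocycle :: "'v set set \<Rightarrow> ('v \<Rightarrow> 'v set \<Rightarrow> 'k::field) \<Rightarrow> nat \<Rightarrow> ('v set \<Rightarrow> 'k) \<Rightarrow> bool" where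
  "cocycle D s e u \<longleftrightarrow> (\<forall>t\<in>D. card t = Suc e \<longrightarrow> cobd s u t = 0)"

definition coboundary :: "'v set set \<Rightarrow> ('v \<Rightarrow> 'v set \<Rightarrow> 'k::field) \<Rightarrow> nat \<Rightarrow> ('v set \<Rightarrow> 'k) \<Rightarrow> bool" where
  "coboundary D s e u \<longleftrightarrow> (\<exists>w. \<forall>t\<in>D. card t = e \<longrightarrow> u t = cobd s w t)"

definition acyclic_at :: "'v set set \<Rightarrow> ('v \<Rightarrow> 'v set \<Rightarrow> 'k::field) \<Rightarrow> nat \<Rightarrow> bool" where
  "acyclic_at D s e \<longleftrightarrow> (\<forall>u. cocycle D s e u \<longrightarrow> coboundary D s e u)"

definition simplicial :: "'v set set \<Rightarrow> bool" where
  "simplicial D \<longleftrightarrow> (\<forall>t\<in>D. finite t \<and> (\<forall>t'\<subseteq>t. t' \<in> D))"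

definition deletion :: "'v \<Rightarrow> 'v set set \<Rightarrow> 'v set set" where
  "deletion x D = {t \<in> D. x \<notin> t}"

definition link :: "'v \<Rightarrow> 'v set set \<Rightarrow> 'v set set" where
  "link x D = {t. x \<notin> t \<and> insert x t \<in> D}"

lemma sign_rule_nonzero: "sign_rule D s \<Longrightarrow> t \<in> D \<Longrightarrow> x \<in> t \<Longrightarrow> s x t \<noteq> 0"
  unfolding sign_rule_def by blast

lemma sign_rule_anticomm:
  "sign_rule D s \<Longrightarrow> t \<in> D \<Longrightarrow> x \<in> t \<Longrightarrow> y \<in> t \<Longrightarrow> x \<noteq> y \<Longrightarrow>
     s x t * s y (t - {x}) = - (s y t * s x (t - {y}))"
  unfolding sign_rule_def by blast

text \<open>The ordered pairs \<open>(x, y)\<close> and \<open>(y, x)\<close> cancel. Induction on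
  the set matches them directly, without doubling the sum and dividing by 2.\<close>

lemma sum_antisym:
  fixes f :: "'a \<Rightarrow> 'a \<Rightarrow> 'b::ab_group_add"
  assumes "finite A" "\<And>x y. x \<in> A \<Longrightarrow> y \<in> A \<Longrightarrow> x \<noteq> y \<Longrightarrow> f x y + f y x = 0"
  shows "(\<Sum>x\<in>A. \<Sum>y\<in>A - {x}. f x y) = 0"
  using assms
proof (induction A)
  case empty
  then show ?case by simp
next
  case (insert a A)
  have 1: "(\<Sum>y\<in>insert a A - {x}. f x y) = f x a + (\<Sum>y\<in>A - {x}. f x y)" if "x \<in> A" for x
  proof -
    have "insert a A - {x} = insert a (A - {x})" using insert.hyps that by auto
    then show ?thesis using insert.hyps by simp
  qed
  have "(\<Sum>x\<in>insert a A. \<Sum>y\<in>insert a A - {x}. f x y)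
      = (\<Sum>y\<in>A. f a y) + (\<Sum>x\<in>A. f x a + (\<Sum>y\<in>A - {x}. f x y))"
    using insert.hyps 1 by simp
  also have "\<dots> = (\<Sum>y\<in>A. f a y + f y a) + (\<Sum>x\<in>A. \<Sum>y\<in>A - {x}. f x y)"
    by (simp add: sum.distrib add.assoc)
  also have "(\<Sum>x\<in>A. \<Sum>y\<in>A - {x}. f x y) = 0"
    by (rule insert.IH) (rule insert.prems; simp)
  also have "(\<Sum>y\<in>A. f a y + f y a) = (\<Sum>y\<in>A. 0)"
    by (rule sum.cong[OF refl]) (rule insert.prems; use insert.hyps in auto)
  finally show ?case by simp
qed

lemma cobd_cobd:
  assumes "simplicial D" "sign_rule D s" "t \<in> D"
  shows "cobd s (cobd s u) t = 0"
proof -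
  have fin: "finite t" using assms by (auto simp: simplicial_def)
  have "cobd s (cobd s u) t = (\<Sum>x\<in>t. \<Sum>y\<in>t - {x}. s x t * s y (t - {x}) * u (t - {x} - {y}))"
    by (simp add: cobd_def sum_distrib_left mult.assoc)
  also have "\<dots> = 0"
  proof (rule sum_antisym[OF fin])
    fix x y assume xy: "x \<in> t" "y \<in> t" "x \<noteq> y"
    then have "s x t * s y (t - {x}) = - (s y t * s x (t - {y}))"
      by (rule sign_rule_anticomm[OF assms(2,3)])
    moreover have "t - {x} - {y} = t - {y} - {x}" by auto
    ultimately show "s x t * s y (t - {x}) * u (t - {x} - {y}) +
        s y t * s x (t - {y}) * u (t - {y} - {x}) = 0"
      by simp
  qed
  finally show ?thesis .
qed

lemma cobd_add: "cobd s (\<lambda>t. u t + w t) t = cobd s u t + cobd s w t"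
  by (simp add: cobd_def sum.distrib algebra_simps)

lemma cobd_diff: "cobd s (\<lambda>t. u t - w t) t = cobd s u t - cobd s w t"
  by (simp add: cobd_def sum_subtractf algebra_simps)

lemma cobd_cong: "(\<And>x. x \<in> t \<Longrightarrow> u (t - {x}) = w (t - {x})) \<Longrightarrow> cobd s u t = cobd s w t"
  by (simp add: cobd_def)

text \<open>One face of \<open>insert x t\<close> omits \<open>x\<close>, the others contain it; the
  latter form the coboundary in the link of \<open>x\<close>, with signs read at
  \<open>insert x r\<close>.\<close>

lemma cobd_insert:
  assumes "finite t" "x \<notin> t"
  shows "cobd s u (insert x t) = s x (insert x t) * u t + cobd (\<lambda>y r. s y (insert x r)) (\<lambda>r. u (insert x r)) t"
proof -
  have "insert x t - {y} = insert x (t - {y})" if "y \<in> t" for y using that assms by auto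
  then show ?thesis using assms by (simp add: cobd_def)
qed

text \<open>The contracting homotopy: a primitive of \<open>u\<close> at \<open>t\<close> is the
  value of \<open>u\<close> at \<open>insert x t\<close> divided by the sign of \<open>x\<close>,
  and 0 if the apex is already in \<open>t\<close>. On faces with the apex only one term survives;
  on the others the cocycle condition at \<open>insert x t\<close> gives the claim.\<close>

lemma acyclic_cone:
  assumes D: "simplicial D" "sign_rule D s" and cone: "\<And>t. t \<in> D \<Longrightarrow> insert x t \<in> D"
  shows "acyclic_at D s e"
  unfolding acyclic_at_def
proof (intro allI impI)
  fix u assume coc: "cocycle D s e u"
  define w where "w t = (if x \<in> t then 0 else u (insert x t) / s x (insert x t))" for t
  have "u t = cobd s w t" if t: "t \<in> D" "card t = e" for t
  proof (cases "x \<in> t")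
    case True
    have fin: "finite t" using t D by (auto simp: simplicial_def)
    have "cobd s w t = s x t * w (t - {x}) + (\<Sum>y\<in>t - {x}. s y t * w (t - {y}))"
      using True fin by (simp add: cobd_def sum.remove)
    also have "(\<Sum>y\<in>t - {x}. s y t * w (t - {y})) = 0"
      using True by (intro sum.neutral) (auto simp: w_def)
    also have "s x t * w (t - {x}) = u t"
      using True sign_rule_nonzero[OF D(2) t(1) True] by (simp add: w_def insert_absorb)
    finally show ?thesis by simp
  next
    case False
    have fin: "finite t" using t D by (auto simp: simplicial_def)
    let ?t = "insert x t"
    have t': "?t \<in> D" using cone t by auto
    have nz: "s x ?t \<noteq> 0" using sign_rule_nonzero[OF D(2) t'] by simp
    have "card ?t = Suc e" using t fin False by simp
    then have "cobd s u ?t = 0" using coc t' by (auto simp: cocycle_def)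
    then have z: "s x ?t * u t + (\<Sum>y\<in>t. s y ?t * u (insert x (t - {y}))) = 0"
      using cobd_insert[OF fin False, of s u] False
      by (simp add: cobd_def)
    have "cobd s w t = (\<Sum>y\<in>t. - (s y ?t * u (insert x (t - {y}))) / s x ?t)"
      unfolding cobd_def
    proof (rule sum.cong[OF refl])
      fix y assume y: "y \<in> t"
      have yx: "x \<noteq> y" using y False by auto
      have eq: "?t - {y} = insert x (t - {y})" "?t - {x} = t" using y False by auto
      \<comment> \<open>Anticommutation trades the divisor belonging to the face
        \<open>insert x (t - {y})\<close> for the one belonging to \<open>insert x t\<close>, which
        does not depend on \<open>y\<close> and leaves the sum.\<close>
      have "s x ?t * s y (?t - {x}) = - (s y ?t * s x (?t - {y}))"
        using sign_rule_anticomm[OF D(2) t' _ _ yx] y by simp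
      then have a: "s x ?t * s y t = - (s y ?t * s x (insert x (t - {y})))" using eq by simp
      have "insert x (t - {y}) \<in> D"
        using D(1) t' insert_mono[of "t - {y}" t x] by (auto simp: simplicial_def)
      then have "s x (insert x (t - {y})) \<noteq> 0" using sign_rule_nonzero[OF D(2)] by simp
      then show "s y t * w (t - {y}) = - (s y ?t * u (insert x (t - {y}))) / s x ?t"
        using arg_cong[OF a, of "\<lambda>c. c * u (insert x (t - {y}))"] nz False y
        by (simp add: w_def field_simps)
    qed
    also have "\<dots> = - (\<Sum>y\<in>t. s y ?t * u (insert x (t - {y}))) / s x ?t"
      by (simp add: sum_negf sum_divide_distrib)
    also have "(\<Sum>y\<in>t. s y ?t * u (insert x (t - {y}))) = - (s x ?t * u t)"
      using z by (simp add: add_eq_0_iff)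
    finally show ?thesis using nz by simp
  qed
  then show "coboundary D s e u" by (auto simp: coboundary_def)
qed

section \<open>The exact sequence of a vertex: deletion and link\<close>

lemma sign_rule_deletion: "sign_rule D s \<Longrightarrow> sign_rule (deletion x D) s"
  unfolding sign_rule_def deletion_def by blast

lemma sign_rule_link:
  assumes "sign_rule D s"
  shows "sign_rule (link x D) (\<lambda>y t. s y (insert x t))"
  unfolding sign_rule_def
proof (intro ballI conjI impI)
  fix t y assume t: "t \<in> link x D" "y \<in> t"
  then show "s y (insert x t) \<noteq> 0" using sign_rule_nonzero[OF assms] by (simp add: link_def)
  fix z assume z: "z \<in> t" "y \<noteq> z"
  have "insert x t - {y} = insert x (t - {y})" "insert x t - {z} = insert x (t - {z})"
    using t z by (auto simp: link_def)
  moreover have "s y (insert x t) * s z (insert x t - {y}) = - (s z (insert x t) * s y (insert x t - {z}))"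
    by (rule sign_rule_anticomm[OF assms]) (use t z in \<open>auto simp: link_def\<close>)
  ultimately show "s y (insert x t) * s z (insert x (t - {y})) = - (s z (insert x t) * s y (insert x (t - {z})))"
    by simp
qed

text \<open>Exactness in the middle of link, complex, deletion: a cocycle that bounds on the
  deletion can be changed to vanish there, and what remains lives on the faces containing
  \<open>x\<close>, that is, on the link with one vertex less.\<close>

lemma acyclic_del_link:
  assumes D: "simplicial D" "sign_rule D s"
    and del: "acyclic_at (deletion x D) s e"
    and lk: "\<And>e'. e = Suc e' \<Longrightarrow> acyclic_at (link x D) (\<lambda>y t. s y (insert x t)) e'"
  shows "acyclic_at D s e"
  unfolding acyclic_at_def
proof (intro allI impI)
  fix u assume coc: "cocycle D s e u"
  have "cocycle (deletion x D) s e u" using coc by (auto simp: cocycle_def deletion_def)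
  then obtain w where w: "\<And>t. t \<in> D \<Longrightarrow> x \<notin> t \<Longrightarrow> card t = e \<Longrightarrow> u t = cobd s w t"
    using del by (auto simp: acyclic_at_def coboundary_def deletion_def)
  \<comment> \<open>\<open>u'\<close> is cohomologous to \<open>u\<close> and vanishes on all faces
    of size \<open>e\<close> without \<open>x\<close>.\<close>
  define u' where "u' t = u t - cobd s w t" for t
  have u'0: "u' t = 0" if "t \<in> D" "x \<notin> t" "card t = e" for t
    using w[OF that] by (simp add: u'_def)
  have coc': "cobd s u' t = 0" if "t \<in> D" "card t = Suc e" for t
  proof -
    have "cobd s u' t = cobd s u t - cobd s (cobd s w) t"
      unfolding u'_def by (rule cobd_diff)
    then show ?thesis using coc that cobd_cobd[OF D that(1)] by (simp add: cocycle_def)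
  qed
  show "coboundary D s e u"
  proof (cases e)
    \<comment> \<open>The only face of size 0 is the empty one, which already lies in the deletion;
      the link has no term here.\<close>
    case 0
    have "u t = cobd s w t" if "t \<in> D" "card t = e" for t
    proof -
      have "t = {}" using D that 0 by (auto simp: simplicial_def)
      then show ?thesis using w that by auto
    qed
    then show ?thesis by (auto simp: coboundary_def)
  next
    case (Suc e')
    let ?s = "\<lambda>y t. s y (insert x t)" and ?v = "\<lambda>t. u' (insert x t)"
    have "cocycle (link x D) ?s e' ?v"
      unfolding cocycle_def
    proof (intro ballI impI)
      fix t assume t: "t \<in> link x D" "card t = Suc e'"
      have fin: "finite t" "x \<notin> t" "insert x t \<in> D" "t \<in> D"
        using t D by (auto simp: link_def simplicial_def)
      have "cobd s u' (insert x t) = 0" using coc'[of "insert x t"] fin t Suc by simp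
      \<comment> \<open>This is the only term at \<open>insert x t\<close> that does not come from
        the link, so the cocycle condition of the complex becomes that of the link.\<close>
      moreover have "u' t = 0" using u'0 fin t Suc by auto
      ultimately show "cobd ?s ?v t = 0" using cobd_insert[OF fin(1,2), of s u'] by simp
    qed
    then obtain z where z: "\<And>t. t \<in> link x D \<Longrightarrow> card t = e' \<Longrightarrow> ?v t = cobd ?s z t"
      using lk[OF Suc] by (auto simp: acyclic_at_def coboundary_def)
    define z' where "z' t = (if x \<in> t then z (t - {x}) else 0)" for t
    have "u t = cobd s (\<lambda>t. w t + z' t) t" if t: "t \<in> D" "card t = e" for t
    proof -
      have fint: "finite t" using t D by (auto simp: simplicial_def)
      have "u' t = cobd s z' t"
      proof (cases "x \<in> t")
        case True
        define r where "r = t - {x}"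
        have r: "t = insert x r" "x \<notin> r" "finite r" using True fint by (auto simp: r_def)
        have "card r = e'" using t r Suc by auto
        moreover have "r \<in> link x D" using t r by (auto simp: link_def)
        ultimately have "u' t = cobd ?s z r" using z r by auto
        also have "\<dots> = cobd ?s (\<lambda>r. z' (insert x r)) r"
          by (rule cobd_cong) (use r in \<open>auto simp: z'_def\<close>)
        also have "\<dots> = cobd s z' t"
          using r cobd_insert[OF r(3,2), of s z'] by (simp add: z'_def)
        finally show ?thesis .
      next
        case False
        then show ?thesis using u'0 t by (auto simp: cobd_def z'_def)
      qed
      then show ?thesis by (simp add: cobd_add u'_def algebra_simps)
    qed
    then show ?thesis by (auto simp: coboundary_def intro!: exI[of _ "\<lambda>t. w t + z' t"])
  qed
qed

text \<open>The next segment of the same sequence: deletion, link, complex one size up. A cocycle of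
  the link, extended by zero, bounds in the complex; the primitive is a cocycle on the deletion and
  can be corrected to vanish there, after which its values on faces containing \<open>x\<close> are
  a primitive in the link.\<close>

lemma acyclic_link:
  assumes D: "simplicial D" "sign_rule D s"
    and acyc: "acyclic_at D s (Suc e)"
    and del: "acyclic_at (deletion x D) s e"
  shows "acyclic_at (link x D) (\<lambda>y t. s y (insert x t)) e"
  unfolding acyclic_at_def
proof (intro allI impI)
  let ?s = "\<lambda>y t. s y (insert x t)"
  fix u assume coc: "cocycle (link x D) ?s e u"
  define v where "v t = (if x \<in> t then u (t - {x}) else 0)" for t
  have "cocycle D s (Suc e) v"
    unfolding cocycle_def
  proof (intro ballI impI)
    fix t assume t: "t \<in> D" "card t = Suc (Suc e)"
    have fint: "finite t" using t D by (auto simp: simplicial_def)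
    show "cobd s v t = 0"
    proof (cases "x \<in> t")
      case True
      define r where "r = t - {x}"
      have r: "t = insert x r" "x \<notin> r" "finite r" using True fint by (auto simp: r_def)
      have "cobd s v t = cobd ?s (\<lambda>r. v (insert x r)) r"
        using r cobd_insert[OF r(3,2), of s v] by (simp add: v_def)
      also have "\<dots> = cobd ?s u r"
        by (rule cobd_cong) (use r in \<open>auto simp: v_def\<close>)
      also have "\<dots> = 0" using coc r t by (auto simp: cocycle_def link_def)
      finally show ?thesis .
    qed (auto simp: cobd_def v_def)
  qed
  then obtain w where w: "\<And>t. t \<in> D \<Longrightarrow> card t = Suc e \<Longrightarrow> v t = cobd s w t"
    using acyc by (auto simp: acyclic_at_def coboundary_def)
  \<comment> \<open>The coboundary of \<open>w\<close> is \<open>v\<close>, which vanishes on faces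
    without \<open>x\<close>.\<close>
  have "cocycle (deletion x D) s e w"
    unfolding cocycle_def deletion_def using w[symmetric] by (auto simp: v_def)
  then obtain z where z: "\<And>t. t \<in> D \<Longrightarrow> x \<notin> t \<Longrightarrow> card t = e \<Longrightarrow> w t = cobd s z t"
    using del by (auto simp: acyclic_at_def coboundary_def deletion_def)
  define w' where "w' t = w t - cobd s z t" for t
  have "u t = cobd ?s (\<lambda>t. w' (insert x t)) t" if t: "t \<in> link x D" "card t = e" for t
  proof -
    have r: "x \<notin> t" "finite t" "insert x t \<in> D" "t \<in> D"
      using t D by (auto simp: link_def simplicial_def)
    have "u t = v (insert x t)" using r by (simp add: v_def)
    also have "\<dots> = cobd s w (insert x t)" using w[OF r(3)] r t by simp
    also have "\<dots> = cobd s w' (insert x t)"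
      using cobd_cobd[OF D r(3), of z] cobd_diff[of s w "cobd s z" "insert x t"]
      by (simp add: w'_def[abs_def])
    also have "\<dots> = s x (insert x t) * w' t + cobd ?s (\<lambda>t. w' (insert x t)) t"
      using cobd_insert[OF r(2,1)] .
    also have "w' t = 0" using z r t by (simp add: w'_def)
    finally show ?thesis by simp
  qed
  then show "coboundary (link x D) ?s e u" by (auto simp: coboundary_def)
qed

text \<open>The sphere of dimension -1: every coboundary is an empty sum on the empty face, so the
  constant 1 does not bound.\<close>

lemma not_acyclic_empty: "\<not> acyclic_at {{}} s 0"
  by (auto simp: acyclic_at_def cocycle_def coboundary_def cobd_def intro!: exI[of _ "\<lambda>_. 1"])

lemma acyclic_no_face: "(\<And>t. t \<in> D \<Longrightarrow> card t \<noteq> e) \<Longrightarrow> acyclic_at D s e"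
  by (auto simp: acyclic_at_def coboundary_def)


section \<open>Induced subcomplexes of a join of cycles\<close>

text \<open>Each fibre of \<open>part\<close> in \<open>V\<close> is one directed cycle:
  \<open>closed_nxt\<close> states, without mentioning lengths, that a part is a single orbit of
  \<open>nxt\<close>. The last two assumptions exclude cycles of length at most 3; fixed points are
  covered by \<open>nxt_nxt\<close>.\<close>

locale cyclic_parts =
  fixes V :: "'v set" and part :: "'v \<Rightarrow> nat" and nxt :: "'v \<Rightarrow> 'v"
  assumes finite_V: "finite V"
    and nxt_in: "x \<in> V \<Longrightarrow> nxt x \<in> V"
    and part_nxt: "x \<in> V \<Longrightarrow> part (nxt x) = part x"
    and inj_nxt: "inj_on nxt V"
    and closed_nxt: "U \<subseteq> V \<Longrightarrow> (\<And>u. u \<in> U \<Longrightarrow> nxt u \<in> U) \<Longrightarrow> u \<in> U \<Longrightarrow> x \<in> V \<Longrightarrow> part x = part u \<Longrightarrow> x \<in> U"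
    and nxt_nxt: "x \<in> V \<Longrightarrow> nxt (nxt x) \<noteq> x"
    and nxt_nxt_nxt: "x \<in> V \<Longrightarrow> nxt (nxt (nxt x)) \<noteq> x"
begin

definition adj :: "'v \<Rightarrow> 'v \<Rightarrow> bool" where
  "adj x y \<longleftrightarrow> y = nxt x \<or> x = nxt y"

text \<open>The independence complex of the graph induced on \<open>W\<close>: two vertices of one
  part may occur together exactly if they are consecutive on the cycle, and different parts do not
  constrain each other, which makes the complex a join.\<close>

definition faces :: "'v set \<Rightarrow> 'v set set" where
  "faces W = {t. t \<subseteq> W \<and> (\<forall>x\<in>t. \<forall>y\<in>t. x \<noteq> y \<longrightarrow> part x = part y \<longrightarrow> adj x y)}"

text \<open>The last vertices of the arcs into which \<open>W\<close> cuts the circle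
  \<open>i\<close>, so that their number is the number of arcs. A part that is full or absent has
  none.\<close>

definition ends :: "'v set \<Rightarrow> nat \<Rightarrow> 'v set" where
  "ends W i = {x \<in> W. part x = i \<and> nxt x \<notin> W}"

text \<open>A bound for the face size in which the piece of the circle has reduced cohomology:
  nothing gives 0, disjoint arcs behave like points and give 1, the circle gives 2. Sizes add under
  joins, hence the sum in \<open>rank\<close>.\<close>

definition local_rank :: "'v set \<Rightarrow> nat \<Rightarrow> nat" where
  "local_rank W i =
     (if \<forall>x\<in>W. part x \<noteq> i then 0 else if \<forall>x\<in>V. part x = i \<longrightarrow> x \<in> W then 2 else 1)"

definition rank :: "'v set \<Rightarrow> nat" where
  "rank W = (\<Sum>i\<in>part ` V. local_rank W i)"

lemma nxt_neq: "x \<in> V \<Longrightarrow> nxt x \<noteq> x"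
  using nxt_nxt by force

lemma prev_exists:
  assumes "x \<in> V"
  obtains y where "y \<in> V" "nxt y = x"
proof -
  have "nxt ` V = V" by (rule endo_inj_surj[OF finite_V _ inj_nxt]) (use nxt_in in auto)
  then show ?thesis using assms that by (metis imageE)
qed

lemma adj_sym: "adj x y \<longleftrightarrow> adj y x"
  by (auto simp: adj_def)

lemma simplicial_faces: "W \<subseteq> V \<Longrightarrow> simplicial (faces W)"
  unfolding simplicial_def faces_def
  by (auto intro: finite_subset[OF _ finite_V] simp: subset_iff)

lemma deletion_faces: "deletion x (faces W) = faces (W - {x})"
  by (auto simp: deletion_def faces_def)

lemma link_faces:
  assumes "x \<in> W"
  shows "link x (faces W) = faces {y \<in> W. y \<noteq> x \<and> (part y = part x \<longrightarrow> adj x y)}"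
  using assms by (auto simp: link_def faces_def adj_sym)

lemma local_rank_mono:
  "W' \<subseteq> W \<Longrightarrow> W \<subseteq> V \<Longrightarrow> local_rank W' i \<le> local_rank W i"
  unfolding local_rank_def by auto

lemma local_rank_cong:
  assumes "\<And>u. part u = i \<Longrightarrow> u \<in> W \<longleftrightarrow> u \<in> W'"
  shows "local_rank W i = local_rank W' i"
proof -
  have "(\<forall>x\<in>W. part x \<noteq> i) \<longleftrightarrow> (\<forall>x\<in>W'. part x \<noteq> i)"
    "(\<forall>x\<in>V. part x = i \<longrightarrow> x \<in> W) \<longleftrightarrow> (\<forall>x\<in>V. part x = i \<longrightarrow> x \<in> W')"
    using assms by blast+
  then show ?thesis unfolding local_rank_def by presburger
qed

lemma rank_mono: "W' \<subseteq> W \<Longrightarrow> W \<subseteq> V \<Longrightarrow> rank W' \<le> rank W"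
  unfolding rank_def by (intro sum_mono local_rank_mono)

lemma rank_split: "x \<in> V \<Longrightarrow> rank W = local_rank W (part x) + (\<Sum>i\<in>part ` V - {part x}. local_rank W i)"
  unfolding rank_def using finite_V by (simp add: sum.remove)

text \<open>The successor arrows on three mutually adjacent vertices form a transitive triangle,
  where one vertex would have two successors, or a cyclic one, excluded by
  \<open>nxt_nxt_nxt\<close>.\<close>

lemma clique_card:
  assumes "K \<subseteq> V" "\<And>x y. x \<in> K \<Longrightarrow> y \<in> K \<Longrightarrow> x \<noteq> y \<Longrightarrow> adj x y"
  shows "card K \<le> 2"
proof (rule ccontr)
  assume "\<not> card K \<le> 2"
  then obtain T where "T \<subseteq> K" "card T = 3"
    using obtain_subset_with_card_n[of 3 K] by auto
  then obtain a b c where abc: "{a, b, c} \<subseteq> K" "a \<noteq> b" "b \<noteq> c" "a \<noteq> c"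
    by (auto simp: card_3_iff)
  then have "adj a b" "adj b c" "adj a c" "a \<in> V" "b \<in> V" "c \<in> V" using assms by auto
  then show False using abc nxt_nxt nxt_nxt_nxt inj_nxt
    unfolding adj_def inj_on_def by metis
qed

text \<open>Without ends every part is full or absent by \<open>closed_nxt\<close>, and already the
  faces are small enough: at most two vertices from each full circle. This is the case where the
  induction below stops.\<close>

lemma face_card_le_rank:
  assumes W: "W \<subseteq> V" and cl: "\<And>x. x \<in> W \<Longrightarrow> nxt x \<in> W" and t: "t \<in> faces W"
  shows "card t \<le> rank W"
proof -
  have fin: "finite t" "t \<subseteq> V" using t W finite_V by (auto simp: faces_def intro: finite_subset)
  have "card t = (\<Sum>i\<in>part ` V. card {x \<in> t. part x = i})"
    using fin finite_V by (subst card_eq_sum, subst sum.group[symmetric, of _ "part ` V" part]) auto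
  also have "\<dots> \<le> (\<Sum>i\<in>part ` V. local_rank W i)"
  proof (rule sum_mono)
    fix i
    have tW: "t \<subseteq> W" using t by (auto simp: faces_def)
    show "card {x \<in> t. part x = i} \<le> local_rank W i"
    proof (cases "\<exists>x\<in>t. part x = i")
      case False
      then have "{x \<in> t. part x = i} = {}" by blast
      then show ?thesis by (simp only: card.empty le0)
    next
      case True
      then obtain x where x: "x \<in> t" "part x = i" by auto
      have "y \<in> W" if "y \<in> V" "part y = i" for y
        using closed_nxt[of W x y] W cl tW x that by auto
      then have "local_rank W i = 2" using x tW by (auto simp: local_rank_def)
      moreover have "card {x \<in> t. part x = i} \<le> 2"
        using t fin by (intro clique_card) (auto simp: faces_def)
      ultimately show ?thesis by simp
    qed
  qed
  finally show ?thesis by (simp add: rank_def)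
qed

text \<open>Removes the end \<open>x\<close> of an arc. If the arc is longer than \<open>x\<close>,
  the link of \<open>x\<close> is a cone and only the deletion matters, where the arc has become
  shorter. If \<open>x\<close> is an arc by itself, its link has lost the whole part: passing there
  lowers \<open>e\<close> by one and the rank by at least one.\<close>

theorem not_acyclic_faces:
  assumes "W \<subseteq> V" "sign_rule (faces W) s" "\<not> acyclic_at (faces W) s e"
  shows "(\<forall>i. card (ends W i) \<noteq> 1) \<and> e \<le> rank W"
  using assms
proof (induction "card W" arbitrary: W s e rule: less_induct)
  case less
  note W = less.prems(1) and s = less.prems(2) and na = less.prems(3)
  have finW: "finite W" using W finite_V finite_subset by auto
  note simpl = simplicial_faces[OF W]
  show ?case
  proof (cases "\<exists>x\<in>W. nxt x \<notin> W")
    case False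
    then have "ends W i = {}" for i by (auto simp: ends_def)
    moreover obtain t where "t \<in> faces W" "card t = e"
      using acyclic_no_face[of "faces W" e s] na by auto
    ultimately show ?thesis using face_card_le_rank[of W t] W False by auto
  next
    case True
    then obtain x where x: "x \<in> W" "nxt x \<notin> W" by auto
    then have xV: "x \<in> V" using W by auto
    obtain y where y: "y \<in> V" "nxt y = x" using prev_exists[OF xV] .
    have yx: "y \<noteq> x" using nxt_neq[OF xV] y by metis
    have ypart: "part y = part x" using part_nxt y by auto
    have uy: "u = y" if "nxt u = x" "u \<in> W" for u
      using inj_nxt y that W by (auto simp: inj_on_def)
    let ?W = "W - {x}" and ?L = "{u \<in> W. u \<noteq> x \<and> (part u = part x \<longrightarrow> adj x u)}"
    let ?s = "\<lambda>y t. s y (insert x t)"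
    have cW: "card ?W < card W" using x finW by (meson card_Diff1_less)
    have cL: "card ?L < card W" using x finW by (intro psubset_card_mono) auto
    have sW: "sign_rule (faces ?W) s" using sign_rule_deletion[OF s, of x] by (simp add: deletion_faces)
    have sL: "sign_rule (faces ?L) ?s" using sign_rule_link[OF s, of x] x by (simp add: link_faces)
    have L_eq: "u = y" if "u \<in> ?L" "part u = part x" for u
      using that x uy by (auto simp: adj_def)
    have split: "\<not> acyclic_at (faces ?W) s e \<or> (\<exists>e'. e = Suc e' \<and> \<not> acyclic_at (faces ?L) ?s e')"
      using acyclic_del_link[OF simpl s, of x e] na x by (auto simp: deletion_faces link_faces)
    show ?thesis
    proof (cases "y \<in> W")
      case True
      \<comment> \<open>In the part of \<open>x\<close> the link contains only the predecessor
        \<open>y\<close>, and other parts impose no condition, so \<open>y\<close> is an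
        apex.\<close>
      have "acyclic_at (faces ?L) ?s e'" for e'
      proof (rule acyclic_cone[OF simplicial_faces sL])
        show "?L \<subseteq> V" using W by auto
        fix t assume t: "t \<in> faces ?L"
        then have "u = y" if "u \<in> t" "part u = part x" for u using L_eq that by (auto simp: faces_def)
        then show "insert y t \<in> faces ?L"
          using t True yx ypart y by (auto simp: faces_def adj_def)
      qed
      then have IH: "(\<forall>i. card (ends ?W i) \<noteq> 1) \<and> e \<le> rank ?W"
        using less.hyps[OF cW _ sW] split W by auto
      \<comment> \<open>The predecessor \<open>y\<close> takes over the role of \<open>x\<close> as
        an end, so the number of arcs does not change.\<close>
      have "card (ends W i) = card (ends ?W i)" for i
      proof (cases "i = part x")
        case True
        have "u \<in> ends ?W i \<longleftrightarrow> u = y \<or> u \<in> ends W i \<and> u \<noteq> x" for u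
        proof (cases "u = y")
          case True
          then show ?thesis using \<open>i = part x\<close> y(2) \<open>y \<in> W\<close> yx ypart by (simp add: ends_def)
        next
          case False
          then show ?thesis using uy[of u] by (cases "u = x") (auto simp: ends_def)
        qed
        then have "ends ?W i = insert y (ends W i - {x})" by blast
        moreover have "y \<notin> ends W i" "x \<in> ends W i" using y x True by (simp_all add: ends_def)
        moreover have "finite (ends W i)" by (rule finite_subset[OF _ finW]) (simp add: ends_def)
        ultimately show ?thesis using card_Suc_Diff1[of "ends W i" x] by simp
      next
        case False
        have "ends ?W i = ends W i"
          using False x uy ypart by (auto simp: ends_def)
        then show ?thesis by simp
      qed
      then show ?thesis using IH rank_mono[of ?W W] W by (metis Diff_subset order_trans)
    next
      case False
      \<comment> \<open>If \<open>x\<close> were alone in its part, it would be an apex of the whole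
        complex.\<close>
      have "\<exists>z\<in>W. z \<noteq> x \<and> part z = part x"
      proof (rule ccontr)
        assume nz: "\<not> ?thesis"
        have "acyclic_at (faces W) s e"
          by (rule acyclic_cone[OF simpl s, of x]) (use nz x in \<open>auto simp: faces_def\<close>)
        then show False using na by simp
      qed
      then obtain z where z: "z \<in> W" "z \<noteq> x" "part z = part x" by auto
      have "card (ends W (part x)) \<noteq> 1"
      proof
        assume c1: "card (ends W (part x)) = 1"
        moreover have "x \<in> ends W (part x)" using x by (auto simp: ends_def)
        ultimately have ends: "ends W (part x) = {x}" by (auto simp: card_1_singleton_iff)
        \<comment> \<open>If \<open>x\<close> were the only end, the other vertices of its part in
          \<open>W\<close> would be closed under \<open>nxt\<close>: their successors stay in
          \<open>W\<close> and avoid \<open>x\<close>, whose predecessor is missing. By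
          \<open>closed_nxt\<close> they would then include \<open>x\<close>.\<close>
        let ?U = "{u \<in> W. part u = part x \<and> u \<noteq> x}"
        have "x \<in> ?U"
        proof (rule closed_nxt[of _ z])
          fix u assume u: "u \<in> ?U"
          then have "u \<notin> ends W (part x)" using ends by auto
          then have "nxt u \<in> W" using u by (auto simp: ends_def)
          moreover have "nxt u \<noteq> x" using uy u False by auto
          ultimately show "nxt u \<in> ?U" using u part_nxt W by auto
        qed (use W z xV in auto)
        then show False by simp
      qed
      moreover have "card (ends W i) \<noteq> 1" if i: "i \<noteq> part x" for i
        using split
      proof
        assume "\<not> acyclic_at (faces ?W) s e"
        then have "card (ends ?W i) \<noteq> 1" using less.hyps[OF cW _ sW] W by auto
        moreover have "ends ?W i = ends W i"
          using i x uy ypart by (auto simp: ends_def)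
        ultimately show ?thesis by simp
      next
        assume "\<exists>e'. e = Suc e' \<and> \<not> acyclic_at (faces ?L) ?s e'"
        then have "card (ends ?L i) \<noteq> 1" using less.hyps[OF cL _ sL] W by auto
        moreover have "ends ?L i = ends W i"
          using i part_nxt W by (auto simp: ends_def)
        ultimately show ?thesis by simp
      qed
      moreover have "e \<le> rank W"
        using split
      proof
        assume "\<not> acyclic_at (faces ?W) s e"
        then have "e \<le> rank ?W" using less.hyps[OF cW _ sW] W by auto
        then show ?thesis using rank_mono[of ?W W] W by auto
      next
        assume "\<exists>e'. e = Suc e' \<and> \<not> acyclic_at (faces ?L) ?s e'"
        then obtain e' where e': "e = Suc e'" "\<not> acyclic_at (faces ?L) ?s e'" by auto
        then have le: "e' \<le> rank ?L" using less.hyps[OF cL _ sL] W by auto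
        have "local_rank ?L (part x) = 0"
          using L_eq False by (auto simp: local_rank_def)
        moreover have "local_rank W (part x) \<ge> 1" using x by (auto simp: local_rank_def)
        moreover have "(\<Sum>i\<in>part ` V - {part x}. local_rank ?L i) \<le> (\<Sum>i\<in>part ` V - {part x}. local_rank W i)"
          by (intro sum_mono local_rank_mono) (use W in auto)
        ultimately show ?thesis using le e' rank_split[OF xV, of W] rank_split[OF xV, of ?L] by linarith
      qed
      ultimately show ?thesis by metis
    qed
  qed
qed

section \<open>Joins of circles and of pairs of points\<close>

definition spherical :: "'v set \<Rightarrow> nat \<Rightarrow> bool" where
  "spherical W i \<longleftrightarrow> (\<forall>x\<in>W. part x \<noteq> i) \<or> (\<forall>x\<in>V. part x = i \<longrightarrow> x \<in> W) \<or>
     (\<exists>x y. x \<noteq> y \<and> \<not> adj x y \<and> {u \<in> W. part u = i} = {x, y})"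

text \<open>Deleting \<open>x\<close> leaves a single arc of a circle or a single point of a pair.
  Either way the part has exactly one end, so the deletion is acyclic in all sizes by
  \<open>not_acyclic_faces\<close>, and a nontrivial class of the link one size lower survives. The
  link keeps the shape: a circle is replaced by the pair of neighbours of \<open>x\<close>, a pair
  by nothing, and the rank drops by one.\<close>

theorem not_acyclic_spherical:
  assumes "W \<subseteq> V" "\<And>i. spherical W i" "sign_rule (faces W) s"
  shows "\<not> acyclic_at (faces W) s (rank W)"
  using assms
proof (induction "card W" arbitrary: W s rule: less_induct)
  case less
  note W = less.prems(1) and sph = less.prems(2) and s = less.prems(3)
  have finW: "finite W" using W finite_V finite_subset by auto
  show ?case
  proof (cases "W = {}")
    case True
    then have "faces W = {{}}" "rank W = 0" by (auto simp: faces_def rank_def local_rank_def)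
    then show ?thesis using not_acyclic_empty by simp
  next
    case False
    then obtain x where x: "x \<in> W" by auto
    then have xV: "x \<in> V" using W by auto
    obtain y where y: "y \<in> V" "nxt y = x" using prev_exists[OF xV] .
    have yx: "y \<noteq> x" using nxt_neq[OF xV] y by metis
    have ypart: "part y = part x" using part_nxt y by auto
    have uy: "u = y" if "nxt u = x" "u \<in> W" for u
      using inj_nxt y that W by (auto simp: inj_on_def)
    let ?W = "W - {x}" and ?L = "{u \<in> W. u \<noteq> x \<and> (part u = part x \<longrightarrow> adj x u)}"
    let ?s = "\<lambda>y t. s y (insert x t)"
    have cL: "card ?L < card W" using x finW by (intro psubset_card_mono) auto
    have sW: "sign_rule (faces ?W) s" using sign_rule_deletion[OF s, of x] by (simp add: deletion_faces)
    have sL: "sign_rule (faces ?L) ?s" using sign_rule_link[OF s, of x] x by (simp add: link_faces)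
    have sphL: "spherical ?L i" if "i \<noteq> part x" for i
    proof -
      have eq: "{u \<in> ?L. part u = i} = {u \<in> W. part u = i}" using that by auto
      show ?thesis
        using sph[of i] that unfolding spherical_def eq by auto
    qed
    have main: "card (ends ?W (part x)) = 1 \<and> spherical ?L (part x) \<and>
        local_rank W (part x) = Suc (local_rank ?L (part x))"
    proof (cases "\<forall>u\<in>V. part u = part x \<longrightarrow> u \<in> W")
      case True
      have yW: "y \<in> W" using True y ypart by auto
      have nW: "nxt x \<in> W" using True xV part_nxt nxt_in by auto
      have "nxt u \<in> W" if "u \<in> W" "part u = part x" for u
        using True that part_nxt nxt_in W by auto
      then have "u \<in> ends ?W (part x) \<longleftrightarrow> u = y" for u
        using uy[of u] yW y(2) yx ypart by (auto simp: ends_def)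
      then have "ends ?W (part x) = {y}" by blast
      moreover have eq: "{u \<in> ?L. part u = part x} = {y, nxt x}"
      proof -
        have "u = y \<or> u = nxt x" if "u \<in> W" "adj x u" for u
          using that uy[of u] by (auto simp: adj_def)
        then have "{u \<in> ?L. part u = part x} \<subseteq> {y, nxt x}" by blast
        moreover have "adj x y" "adj x (nxt x)" by (simp_all add: adj_def y(2))
        then have "y \<in> {u \<in> ?L. part u = part x}" "nxt x \<in> {u \<in> ?L. part u = part x}"
          using yW nW yx nxt_neq[OF xV] ypart part_nxt[OF xV] by simp_all
        ultimately show ?thesis by (simp only: set_eq_subset insert_subset empty_subsetI simp_thms)
      qed
      moreover have "y \<noteq> nxt x" using y(2) nxt_nxt[OF xV] by metis
      \<comment> \<open>The two neighbours of \<open>x\<close> could be adjacent only on a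
        triangle.\<close>
      moreover have "\<not> adj y (nxt x)"
        using y(2) nxt_nxt_nxt[OF xV] nxt_neq[OF xV] unfolding adj_def by metis
      moreover have "local_rank W (part x) = 2" using True x by (auto simp: local_rank_def)
      moreover have "local_rank ?L (part x) = 1"
      proof -
        have "y \<in> ?L" using eq by auto
        then show ?thesis using ypart xV by (auto simp: local_rank_def)
      qed
      ultimately show ?thesis by (auto simp: spherical_def)
    next
      case False
      then obtain a b where ab: "a \<noteq> b" "\<not> adj a b" "{u \<in> W. part u = part x} = {a, b}"
        using sph[of "part x"] x by (auto simp: spherical_def)
      then obtain z where z: "z \<noteq> x" "\<not> adj x z" "{u \<in> W. part u = part x} = {x, z}"
      proof -
        have "x = a \<or> x = b" using ab x by blast
        then show ?thesis using that[of b] that[of a] ab adj_sym by (auto simp: insert_commute)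
      qed
      have zW: "z \<in> W" "part z = part x" using z(3) by blast+
      have iW: "u = x \<or> u = z" if "u \<in> W" "part u = part x" for u using z(3) that by blast
      have zV: "z \<in> V" using zW W by blast
      have "nxt z \<noteq> x" using z(2) unfolding adj_def by blast
      then have "nxt z \<notin> W" using iW[of "nxt z"] part_nxt[OF zV] zW(2) nxt_neq[OF zV] by metis
      then have "u \<in> ends ?W (part x) \<longleftrightarrow> u = z" for u
        using iW[of u] zW z(1) unfolding ends_def by (simp, metis)
      then have "ends ?W (part x) = {z}" by blast
      moreover have none: "\<forall>u\<in>?L. part u \<noteq> part x" using iW z(2) by (simp, metis)
      moreover have "local_rank W (part x) = 1" using False x by (auto simp: local_rank_def)
      moreover have "local_rank ?L (part x) = 0" unfolding local_rank_def if_P[OF none] ..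
      ultimately show ?thesis by (auto simp: spherical_def)
    qed
    have del: "acyclic_at (deletion x (faces W)) s e" for e
      using not_acyclic_faces[OF _ sW, of e] main W by (auto simp: deletion_faces)
    have "\<not> acyclic_at (faces ?L) ?s (rank ?L)"
      by (rule less.hyps[OF cL _ _ sL]) (use W main sphL in auto, metis)
    then have "\<not> acyclic_at (faces W) s (Suc (rank ?L))"
      using acyclic_link[OF simplicial_faces[OF W] s _ del, of "rank ?L"] x by (auto simp: link_faces)
    moreover have "(\<Sum>i\<in>part ` V - {part x}. local_rank ?L i) = (\<Sum>i\<in>part ` V - {part x}. local_rank W i)"
    proof (rule sum.cong[OF refl], rule local_rank_cong)
      fix i u assume "i \<in> part ` V - {part x}" "part u = i"
      then show "u \<in> ?L \<longleftrightarrow> u \<in> W" by auto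
    qed
    ultimately show ?thesis
      using main rank_split[OF xV, of W] rank_split[OF xV, of ?L] by simp
  qed
qed

end


section \<open>Coefficients and degrees in graded free modules\<close>

abbreviation keys :: "('a \<Rightarrow>\<^sub>0 'b::zero) \<Rightarrow> 'a set" where "keys \<equiv> Poly_Mapping.keys"
abbreviation lookup :: "('a \<Rightarrow>\<^sub>0 'b::zero) \<Rightarrow> 'a \<Rightarrow> 'b" where "lookup \<equiv> Poly_Mapping.lookup"
abbreviation single :: "'a \<Rightarrow> 'b \<Rightarrow> 'a \<Rightarrow>\<^sub>0 'b::zero" where "single \<equiv> Poly_Mapping.single"

abbreviation coef :: "('v, 'k::field) fvec \<Rightarrow> nat \<times> nat \<Rightarrow> ('v \<Rightarrow>\<^sub>0 nat) \<Rightarrow> 'k" where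
  "coef f c m \<equiv> lookup (lookup f c) m"

lemma fvec_eqI: "(\<And>c m. coef f c m = coef g c m) \<Longrightarrow> f = g"
  by (intro poly_mapping_eqI) auto

text \<open>Intended for functions whose joint support in \<open>(c, m)\<close> is finite; both
  nested abstractions are then legitimate.\<close>

definition of_coef :: "(nat \<times> nat \<Rightarrow> ('v \<Rightarrow>\<^sub>0 nat) \<Rightarrow> 'k) \<Rightarrow> ('v, 'k::field) fvec" where
  "of_coef g = Abs_poly_mapping (\<lambda>c. Abs_poly_mapping (g c))"

lemma coef_of_coef:
  assumes "finite {(c, m). g c m \<noteq> 0}"
  shows "coef (of_coef g) c m = g c m"
proof -
  have 1: "finite {m. g c m \<noteq> 0}" for c
  proof (rule finite_subset[OF _ finite_imageI[OF assms, of snd]])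
    show "{m. g c m \<noteq> 0} \<subseteq> snd ` {(c, m). g c m \<noteq> 0}"
    proof
      fix m assume "m \<in> {m. g c m \<noteq> 0}"
      then have "(c, m) \<in> {(c, m). g c m \<noteq> 0}" by simp
      then show "m \<in> snd ` {(c, m). g c m \<noteq> 0}" by (metis image_eqI snd_conv)
    qed
  qed
  have 2: "finite {c. Abs_poly_mapping (g c) \<noteq> 0}"
  proof (rule finite_subset[OF _ finite_imageI[OF assms, of fst]])
    have "Abs_poly_mapping (g c) = 0" if "\<forall>m. g c m = 0" for c
    proof -
      have "g c = (\<lambda>_. 0)" using that by auto
      then show ?thesis by simp
    qed
    then show "{c. Abs_poly_mapping (g c) \<noteq> 0} \<subseteq> fst ` {(c, m). g c m \<noteq> 0}" by force
  qed
  have "lookup (of_coef g) = (\<lambda>c. Abs_poly_mapping (g c))"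
    unfolding of_coef_def using 2 by (rule lookup_Abs_poly_mapping)
  then show ?thesis using 1[of c] by (simp add: lookup_Abs_poly_mapping)
qed

lemma finite_coef: "finite {(c, m). coef f c m \<noteq> 0}"
proof (rule finite_subset)
  show "{(c, m). coef f c m \<noteq> 0} \<subseteq> (SIGMA c:keys f. keys (lookup f c))"
    by (auto simp: in_keys_iff)
qed auto

lemma coef_zero [simp]: "coef 0 c m = 0" by simp
lemma coef_add: "coef (f + g) c m = coef f c m + coef g c m" by (simp add: lookup_add)
lemma coef_diff: "coef (f - g) c m = coef f c m - coef g c m" by (simp add: lookup_minus)
lemma coef_sum: "coef (sum f A) c m = (\<Sum>i\<in>A. coef (f i) c m)" by (simp add: lookup_sum)

lemma lookup_scale_fvec: "lookup (scale_fvec p f) c = p * lookup f c"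
  by (simp add: scale_fvec_def map.rep_eq when_def)

lemma scale_fvec_add: "scale_fvec p (f + g) = scale_fvec p f + scale_fvec p g"
  by (intro poly_mapping_eqI) (simp add: lookup_scale_fvec lookup_add distrib_left)
lemma scale_fvec_add_left: "scale_fvec (p + q) f = scale_fvec p f + scale_fvec q f"
  by (intro poly_mapping_eqI) (simp add: lookup_scale_fvec lookup_add distrib_right)
lemma scale_fvec_scale: "scale_fvec p (scale_fvec q f) = scale_fvec (p * q) f"
  by (intro poly_mapping_eqI) (simp add: lookup_scale_fvec mult.assoc)
lemma scale_fvec_one [simp]: "scale_fvec 1 f = f"
  by (intro poly_mapping_eqI) (simp add: lookup_scale_fvec)
lemma scale_fvec_zero [simp]: "scale_fvec p 0 = 0" "scale_fvec 0 f = 0"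
  by (intro poly_mapping_eqI; simp add: lookup_scale_fvec)+
lemma scale_fvec_sum: "scale_fvec p (sum f A) = (\<Sum>i\<in>A. scale_fvec p (f i))"
  by (intro poly_mapping_eqI) (simp add: lookup_scale_fvec lookup_sum sum_distrib_left)
lemma lookup_single_times:
  fixes t :: "'v \<Rightarrow>\<^sub>0 nat" and p :: "('v \<Rightarrow>\<^sub>0 nat) \<Rightarrow>\<^sub>0 'k::field"
  shows "lookup (single t a * p) (t + m) = a * lookup p m"
  by (simp add: lookup_mult lookup_single when_mult mult_when)

lemma lookup_times_nonzero:
  fixes p q :: "('v \<Rightarrow>\<^sub>0 nat) \<Rightarrow>\<^sub>0 'k::field"
  assumes "lookup (p * q) m \<noteq> 0"
  obtains a b where "m = a + b" "lookup p a \<noteq> 0" "lookup q b \<noteq> 0"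
  using keys_mult[of p q] assms that by (fastforce simp: in_keys_iff)

lemma single_plus_diff: "x \<in> keys m \<Longrightarrow> single x 1 + (m - single x 1) = (m :: 'v \<Rightarrow>\<^sub>0 nat)"
  by (intro poly_mapping_eqI) (auto simp: lookup_add lookup_minus lookup_single when_def in_keys_iff)

lemma coef_var:
  "coef (scale_fvec (single (single x 1) a) f) c m = (if x \<in> keys m then a * coef f c (m - single x 1) else 0)"
proof (cases "x \<in> keys m")
  case True
  then show ?thesis
    using lookup_single_times[of "single x 1" a "lookup f c" "m - single x 1"]
    by (simp only: lookup_scale_fvec single_plus_diff if_True)
next
  case False
  have "lookup (single (single x 1) a * lookup f c) m = 0"
  proof (rule ccontr)
    assume "\<not> ?thesis"
    then obtain b d where "m = b + d" "lookup (single (single x 1) a) b \<noteq> 0"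
      by (rule lookup_times_nonzero)
    then have "lookup m x \<noteq> 0" by (auto simp: lookup_single lookup_add when_def split: if_splits)
    then show False using False by (simp add: in_keys_iff)
  qed
  then show ?thesis using False by (simp add: lookup_scale_fvec)
qed

lemma coef_const: "coef (scale_fvec (single 0 a) f) c m = a * coef f c m"
  using lookup_single_times[of 0 a "lookup f c" m] by (simp add: lookup_scale_fvec)

lemma scale_minus_one: "scale_fvec (single 0 (- 1)) f = - f"
  by (rule fvec_eqI) (simp add: coef_const)

lemma keys_plus_nat: "keys (a + b) = keys a \<union> keys (b :: 'v \<Rightarrow>\<^sub>0 nat)"
  by (auto simp: in_keys_iff lookup_add)

lemma monom_degree_superset:
  "finite A \<Longrightarrow> keys m \<subseteq> A \<Longrightarrow> monom_degree m = (\<Sum>x\<in>A. lookup m x)"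
  unfolding monom_degree_def by (rule sum.mono_neutral_left) (auto simp: in_keys_iff)

lemma monom_degree_add: "monom_degree (a + b) = monom_degree a + monom_degree b"
proof -
  let ?A = "keys a \<union> keys b"
  show ?thesis
    by (simp add: monom_degree_superset[of ?A] keys_plus_nat lookup_add sum.distrib)
qed

lemma monom_degree_single [simp]: "monom_degree (single x n) = n"
  by (simp add: monom_degree_superset[of "{x}"])

lemma monom_degree_zero [simp]: "monom_degree 0 = 0"
  by (simp add: monom_degree_def)

lemma lookup_le_monom_degree: "lookup m x \<le> monom_degree m"
proof (cases "x \<in> keys m")
  case True
  then show ?thesis unfolding monom_degree_def by (intro member_le_sum) auto
qed (simp add: in_keys_iff)

lemma finite_monoms:
  assumes "finite V"
  shows "finite {m :: 'v \<Rightarrow>\<^sub>0 nat. keys m \<subseteq> V \<and> monom_degree m \<le> n}"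
proof (rule finite_imageD)
  have "lookup ` {m :: 'v \<Rightarrow>\<^sub>0 nat. keys m \<subseteq> V \<and> monom_degree m \<le> n}
      \<subseteq> {f. \<forall>x. (x \<in> V \<longrightarrow> f x \<in> {..n}) \<and> (x \<notin> V \<longrightarrow> f x = 0)}"
    using order_trans[OF lookup_le_monom_degree] by (auto simp: in_keys_iff)
  then show "finite (lookup ` {m :: 'v \<Rightarrow>\<^sub>0 nat. keys m \<subseteq> V \<and> monom_degree m \<le> n})"
    using finite_set_of_finite_funs[OF assms finite_atMost] by (rule finite_subset)
qed (auto simp: inj_on_def intro: poly_mapping_eqI)

lemma free_module_iff:
  "f \<in> free_module V b \<longleftrightarrow> (\<forall>c m. coef f c m \<noteq> 0 \<longrightarrow> snd c < b (fst c) \<and> keys m \<subseteq> V)"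
proof
  assume f: "f \<in> free_module V b"
  show "\<forall>c m. coef f c m \<noteq> 0 \<longrightarrow> snd c < b (fst c) \<and> keys m \<subseteq> V"
  proof (intro allI impI)
    fix c m assume nz: "coef f c m \<noteq> 0"
    then have "c \<in> keys f" "m \<in> keys (lookup f c)" by (auto simp: in_keys_iff)
    then show "snd c < b (fst c) \<and> keys m \<subseteq> V"
      using f unfolding free_module_def poly_ring_def by fastforce
  qed
next
  assume R: "\<forall>c m. coef f c m \<noteq> 0 \<longrightarrow> snd c < b (fst c) \<and> keys m \<subseteq> V"
  have "snd c < b (fst c)" if c: "c \<in> keys f" for c
  proof -
    have "lookup f c \<noteq> 0" using c by (simp add: in_keys_iff)
    then obtain m where "coef f c m \<noteq> 0" by (metis lookup_zero poly_mapping_eqI)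
    then show ?thesis using R by auto
  qed
  then show "f \<in> free_module V b" using R by (fastforce simp: free_module_def poly_ring_def in_keys_iff)
qed

lemma free_moduleD:
  "f \<in> free_module V b \<Longrightarrow> coef f c m \<noteq> 0 \<Longrightarrow> snd c < b (fst c) \<and> keys m \<subseteq> V"
  unfolding free_module_iff by blast

lemma irrelevant_part_iff: "f \<in> irrelevant_part F \<longleftrightarrow> f \<in> F \<and> (\<forall>c. coef f c 0 = 0)"
  by (simp add: irrelevant_part_def)

lemma free_module_zero [simp]: "0 \<in> free_module V b"
  by (simp add: free_module_iff)

lemma free_module_add: "f \<in> free_module V b \<Longrightarrow> g \<in> free_module V b \<Longrightarrow> f + g \<in> free_module V b"
  unfolding free_module_iff coef_add by (metis add.right_neutral)

lemma free_module_sum: "(\<And>i. i \<in> A \<Longrightarrow> f i \<in> free_module V b) \<Longrightarrow> sum f A \<in> free_module V b"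
  by (induction A rule: infinite_finite_induct) (auto intro: free_module_add)

lemma free_module_scale:
  assumes "p \<in> poly_ring V" "f \<in> free_module V b"
  shows "scale_fvec p f \<in> free_module V b"
  unfolding free_module_iff
proof (intro allI impI)
  fix c m assume "coef (scale_fvec p f) c m \<noteq> 0"
  then obtain a d where ad: "m = a + d" "lookup p a \<noteq> 0" "coef f c d \<noteq> 0"
    unfolding lookup_scale_fvec by (rule lookup_times_nonzero)
  have "keys a \<subseteq> V" using ad(2) assms(1) by (auto simp: poly_ring_def in_keys_iff)
  then show "snd c < b (fst c) \<and> keys m \<subseteq> V"
    using free_moduleD[OF assms(2) ad(3)] ad(1) by (simp add: keys_plus_nat)
qed

lemma const_in_poly_ring [simp]: "single 0 a \<in> poly_ring V"
  by (auto simp: poly_ring_def)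

lemma monom_in_poly_ring [simp]: "keys t \<subseteq> V \<Longrightarrow> single t a \<in> poly_ring V"
  by (auto simp: poly_ring_def)

lemma free_module_diff: "f \<in> free_module V b \<Longrightarrow> g \<in> free_module V b \<Longrightarrow> f - g \<in> free_module V b"
  using free_module_add[of f V b "- g"] free_module_scale[of "single 0 (- 1)" V g b]
  by (simp add: scale_minus_one)

text \<open>The degree is an integer because Koszul boundaries involve coefficients of degree
  \<open>e - 1\<close>, also for \<open>e = 0\<close>. In negative degrees only 0 is
  homogeneous.\<close>

definition hom_deg :: "int \<Rightarrow> ('v, 'k::field) fvec \<Rightarrow> bool" where
  "hom_deg e f \<longleftrightarrow> (\<forall>c m. coef f c m \<noteq> 0 \<longrightarrow> int (monom_degree m + fst c) = e)"

lemma hom_degD: "hom_deg e f \<Longrightarrow> coef f c m \<noteq> 0 \<Longrightarrow> int (monom_degree m + fst c) = e"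
  unfolding hom_deg_def by blast

lemma homogeneous_fvec_iff: "homogeneous_fvec e f \<longleftrightarrow> hom_deg (int e) f"
proof -
  have "homogeneous_fvec e f \<longleftrightarrow> (\<forall>c\<in>keys f. \<forall>m\<in>keys (lookup f c). monom_degree m + fst c = e)"
    by (fastforce simp: homogeneous_fvec_def)
  also have "\<dots> \<longleftrightarrow> (\<forall>c m. coef f c m \<noteq> 0 \<longrightarrow> monom_degree m + fst c = e)"
    unfolding Ball_def in_keys_iff by (metis lookup_zero)
  also have "\<dots> \<longleftrightarrow> hom_deg (int e) f"
    unfolding hom_deg_def of_nat_eq_iff ..
  finally show ?thesis .
qed

lemma hom_deg_zero [simp]: "hom_deg e 0"
  by (simp add: hom_deg_def)

lemma hom_deg_negative: "e < 0 \<Longrightarrow> hom_deg e f \<Longrightarrow> f = 0"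
  unfolding hom_deg_def by (rule fvec_eqI) force

lemma hom_deg_add: "hom_deg e f \<Longrightarrow> hom_deg e g \<Longrightarrow> hom_deg e (f + g)"
  unfolding hom_deg_def coef_add by (metis add.right_neutral)

lemma hom_deg_diff: "hom_deg e f \<Longrightarrow> hom_deg e g \<Longrightarrow> hom_deg e (f - g)"
  unfolding hom_deg_def coef_diff by (metis diff_zero)

lemma hom_deg_sum: "(\<And>i. i \<in> A \<Longrightarrow> hom_deg e (f i)) \<Longrightarrow> hom_deg e (sum f A)"
  by (induction A rule: infinite_finite_induct) (auto intro: hom_deg_add)

lemma hom_deg_monom_scale:
  assumes "hom_deg e f"
  shows "hom_deg (int (monom_degree t) + e) (scale_fvec (single t a) f)"
  unfolding hom_deg_def
proof (intro allI impI)
  fix c m assume "coef (scale_fvec (single t a) f) c m \<noteq> 0"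
  then obtain d u where du: "m = d + u" "lookup (single t a) d \<noteq> 0" "coef f c u \<noteq> 0"
    unfolding lookup_scale_fvec by (rule lookup_times_nonzero)
  have "d = t" using du(2) by (auto simp: lookup_single when_def split: if_splits)
  then show "int (monom_degree m + fst c) = int (monom_degree t) + e"
    using du hom_degD[OF assms du(3)] by (simp add: monom_degree_add)
qed

definition hcomp :: "int \<Rightarrow> ('v, 'k::field) fvec \<Rightarrow> ('v, 'k) fvec" where
  "hcomp e f = of_coef (\<lambda>c m. if int (monom_degree m + fst c) = e then coef f c m else 0)"

lemma coef_hcomp: "coef (hcomp e f) c m = (if int (monom_degree m + fst c) = e then coef f c m else 0)"
  unfolding hcomp_def
  by (subst coef_of_coef, rule finite_subset[OF _ finite_coef[of f]]) (auto split: if_splits)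

lemma hom_deg_hcomp [simp]: "hom_deg e (hcomp e f)"
  by (simp add: hom_deg_def coef_hcomp)

lemma free_module_hcomp: "f \<in> free_module V b \<Longrightarrow> hcomp e f \<in> free_module V b"
  by (auto simp: free_module_iff coef_hcomp)

lemma hcomp_hom: "hom_deg e f \<Longrightarrow> hcomp e' f = (if e' = e then f else 0)"
  using hom_degD[of e f] by (intro fvec_eqI) (simp only: coef_hcomp coef_zero split: if_splits, metis coef_zero)

lemma hcomp_sum: "hcomp e (sum f A) = (\<Sum>i\<in>A. hcomp e (f i))"
  by (intro fvec_eqI) (simp add: coef_hcomp coef_sum)

lemma hcomp_decomp:
  obtains E where "finite E" "f = (\<Sum>e\<in>E. hcomp e f)" "\<And>e. e \<notin> E \<Longrightarrow> hcomp e f = 0"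
proof
  let ?E = "(\<lambda>(c, m). int (monom_degree m + fst c)) ` {(c, m). coef f c m \<noteq> 0}"
  show fin: "finite ?E" by (intro finite_imageI finite_coef)
  show "f = (\<Sum>e\<in>?E. hcomp e f)"
  proof (rule fvec_eqI)
    fix c m
    have "coef (\<Sum>e\<in>?E. hcomp e f) c m = (\<Sum>e\<in>?E. if int (monom_degree m + fst c) = e then coef f c m else 0)"
      by (simp only: coef_sum coef_hcomp)
    also have "\<dots> = (if int (monom_degree m + fst c) \<in> ?E then coef f c m else 0)"
      by (rule sum.delta'[OF fin])
    also have "\<dots> = coef f c m" by force
    finally show "coef f c m = coef (\<Sum>e\<in>?E. hcomp e f) c m" by simp
  qed
  show "hcomp e f = 0" if "e \<notin> ?E" for e
    using that by (intro fvec_eqI) (force simp: coef_hcomp)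
qed

section \<open>Graded homomorphisms of free modules\<close>

abbreviation fhom :: "'v set \<Rightarrow> (nat \<Rightarrow> nat) \<Rightarrow> (nat \<Rightarrow> nat) \<Rightarrow> (('v, 'k::field) fvec \<Rightarrow> ('v, 'k) fvec) \<Rightarrow> bool" where
  "fhom V b' b d \<equiv> graded_hom V scale_fvec homogeneous_fvec (free_module V b')
     scale_fvec homogeneous_fvec (free_module V b) d"

lemma fhom_in: "fhom V b' b d \<Longrightarrow> f \<in> free_module V b' \<Longrightarrow> d f \<in> free_module V b"
  by (auto simp: graded_hom_def)

lemma fhom_add: "fhom V b' b d \<Longrightarrow> f \<in> free_module V b' \<Longrightarrow> g \<in> free_module V b' \<Longrightarrow> d (f + g) = d f + d g"
  by (auto simp: graded_hom_def)

lemma fhom_scale: "fhom V b' b d \<Longrightarrow> p \<in> poly_ring V \<Longrightarrow> f \<in> free_module V b' \<Longrightarrow> d (scale_fvec p f) = scale_fvec p (d f)"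
  by (auto simp: graded_hom_def)

lemma fhom_zero: "fhom V b' b d \<Longrightarrow> d 0 = 0"
  using fhom_add[of V b' b d 0 0] by simp

lemma fhom_diff:
  assumes d: "fhom V b' b d" and f: "f \<in> free_module V b'" and g: "g \<in> free_module V b'"
  shows "d (f - g) = d f - d g"
proof -
  have "d ((f - g) + g) = d (f - g) + d g"
    using fhom_add[OF d free_module_diff[OF f g] g] .
  then show ?thesis by simp
qed

lemma fhom_sum: "fhom V b' b d \<Longrightarrow> (\<And>i. i \<in> A \<Longrightarrow> f i \<in> free_module V b') \<Longrightarrow> d (sum f A) = (\<Sum>i\<in>A. d (f i))"
  by (induction A rule: infinite_finite_induct) (auto simp: fhom_zero fhom_add free_module_sum)

lemma fhom_hom_deg:
  assumes d: "fhom V b' b d" and f: "f \<in> free_module V b'" "hom_deg e f"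
  shows "hom_deg e (d f)"
proof (cases "e < 0")
  case True
  then show ?thesis using hom_deg_negative f fhom_zero[OF d] by (metis hom_deg_zero)
next
  case False
  then obtain n where n: "e = int n" using nonneg_int_cases by (metis not_less)
  have "homogeneous_fvec n f" using f n by (simp add: homogeneous_fvec_iff)
  then have "homogeneous_fvec n (d f)" using d f by (auto simp: graded_hom_def)
  then show ?thesis using n by (simp add: homogeneous_fvec_iff)
qed

text \<open>This is what allows every preimage of a homogeneous element to be replaced by a
  homogeneous preimage.\<close>

lemma fhom_hcomp:
  assumes d: "fhom V b' b d" and f: "f \<in> free_module V b'"
  shows "hcomp e (d f) = d (hcomp e f)"
proof -
  obtain E where E: "finite E" "f = (\<Sum>e\<in>E. hcomp e f)" "\<And>e. e \<notin> E \<Longrightarrow> hcomp e f = 0"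
    by (rule hcomp_decomp) blast
  have "d f = (\<Sum>e\<in>E. d (hcomp e f))"
    by (subst E(2), rule fhom_sum[OF d]) (rule free_module_hcomp[OF f])
  then have "hcomp e (d f) = (\<Sum>e'\<in>E. hcomp e (d (hcomp e' f)))" by (simp only: hcomp_sum)
  also have "\<dots> = (\<Sum>e'\<in>E. if e = e' then d (hcomp e' f) else 0)"
    by (rule sum.cong[OF refl], rule hcomp_hom)
      (rule fhom_hom_deg[OF d free_module_hcomp[OF f] hom_deg_hcomp])
  also have "\<dots> = (if e \<in> E then d (hcomp e f) else 0)" by (rule sum.delta'[OF E(1)])
  also have "\<dots> = d (hcomp e f)" using E(3)[of e] fhom_zero[OF d] by auto
  finally show ?thesis .
qed


section \<open>Koszul complexes of graded free modules\<close>

text \<open>\<open>sg x T\<close> is the sign of adjoining \<open>x\<close> to the exterior monomial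
  indexed by \<open>T\<close>; adjoining \<open>x\<close> and \<open>y\<close> in the two possible
  orders has to give opposite signs.\<close>

definition koszul_sign :: "'v set \<Rightarrow> ('v \<Rightarrow> 'v set \<Rightarrow> 'k::field) \<Rightarrow> bool" where
  "koszul_sign V sg \<longleftrightarrow> (\<forall>x T. sg x T \<noteq> 0) \<and>
     (\<forall>T x y. T \<subseteq> V \<longrightarrow> x \<in> V - T \<longrightarrow> y \<in> V - T \<longrightarrow> x \<noteq> y \<longrightarrow>
        sg x T * sg y (insert x T) = - (sg y T * sg x (insert y T)))"

text \<open>Enumerate \<open>V\<close> and take the parity of the number of elements of
  \<open>T\<close> before \<open>x\<close>. Adjoining \<open>x\<close> flips the sign of
  \<open>y\<close> exactly if \<open>x\<close> comes before \<open>y\<close>, so exactly one of the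
  two orders is affected.\<close>

lemma koszul_sign_exists:
  fixes V :: "'v set"
  assumes "finite V"
  shows "\<exists>sg :: 'v \<Rightarrow> 'v set \<Rightarrow> 'k::field. koszul_sign V sg"
proof -
  obtain ix :: "'v \<Rightarrow> nat" where ix: "inj_on ix V"
    using finite_imp_inj_to_nat_seg[OF assms] by auto
  define sg :: "'v \<Rightarrow> 'v set \<Rightarrow> 'k" where "sg x T = (- 1) ^ card {z \<in> T. ix z < ix x}" for x T
  have ins: "sg y (insert x T) = (if ix x < ix y then - sg y T else sg y T)"
    if "T \<subseteq> V" "x \<notin> T" for x y T
  proof -
    have fin: "finite {z \<in> T. ix z < ix y}" using that(1) by (intro finite_subset[OF _ assms]) auto
    show ?thesis
    proof (cases "ix x < ix y")
      case True
      then have "{z \<in> insert x T. ix z < ix y} = insert x {z \<in> T. ix z < ix y}" by auto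
      then have "card {z \<in> insert x T. ix z < ix y} = Suc (card {z \<in> T. ix z < ix y})"
        using fin that by (simp only:) (subst card_insert_disjoint, auto)
      then show ?thesis using True by (simp only: sg_def if_True power_Suc mult_minus1)
    next
      case False
      then have "{z \<in> insert x T. ix z < ix y} = {z \<in> T. ix z < ix y}" by auto
      then show ?thesis using False by (simp only: sg_def if_False)
    qed
  qed
  have "koszul_sign V sg"
    unfolding koszul_sign_def
  proof (intro conjI allI impI)
    show "sg x T \<noteq> 0" for x T by (simp add: sg_def)
    fix T x y assume a: "T \<subseteq> V" "x \<in> V - T" "y \<in> V - T" "x \<noteq> y"
    then have "ix x \<noteq> ix y" using ix by (auto simp: inj_on_def)
    then show "sg x T * sg y (insert x T) = - (sg y T * sg x (insert y T))"
      using a ins[of T x y] ins[of T y x] by (auto simp: not_less_iff_gr_or_eq)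
  qed
  then show ?thesis by blast
qed

definition ind :: "'v set \<Rightarrow> ('v \<Rightarrow>\<^sub>0 nat)" where
  "ind S = (\<Sum>x\<in>S. single x 1)"

lemma lookup_ind: "finite S \<Longrightarrow> lookup (ind S) x = (if x \<in> S then 1 else 0)"
  by (simp add: ind_def lookup_sum lookup_single when_def sum.delta)

lemma monom_degree_ind: "finite S \<Longrightarrow> monom_degree (ind S) = card S"
  by (subst monom_degree_superset[of S]) (auto simp: lookup_ind in_keys_iff split: if_splits)

lemma keys_ind: "finite S \<Longrightarrow> keys (ind S) = S"
  by (auto simp: lookup_ind in_keys_iff split: if_splits)

text \<open>The monomial basis of one graded piece. Its finiteness turns families of coefficients
  into polynomials and makes graded pieces finite-dimensional.\<close>

lemma finite_graded_basis:
  fixes b :: "nat \<Rightarrow> nat"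
  assumes "finite V"
  shows "finite {(c, m :: 'v \<Rightarrow>\<^sub>0 nat). snd c < b (fst c) \<and> keys m \<subseteq> V \<and> int (monom_degree m + fst c) = e}"
proof (rule finite_subset)
  let ?n = "nat e"
  show "{(c, m :: 'v \<Rightarrow>\<^sub>0 nat). snd c < b (fst c) \<and> keys m \<subseteq> V \<and> int (monom_degree m + fst c) = e}
      \<subseteq> (SIGMA j:{..?n}. {..<b j}) \<times> {m. keys m \<subseteq> V \<and> monom_degree m \<le> ?n}"
    by auto
  show "finite ((SIGMA j:{..?n}. {..<b j}) \<times> {m. keys m \<subseteq> V \<and> monom_degree m \<le> ?n})"
    by (intro finite_cartesian_product finite_SigmaI finite_monoms[OF assms]) auto
qed

section \<open>The Koszul complex and its homology\<close>

locale koszul =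
  fixes V :: "'v set" and sg :: "'v \<Rightarrow> 'v set \<Rightarrow> 'k::field"
  assumes finite_V: "finite V" and sg: "koszul_sign V sg"
begin

text \<open>The Koszul differential. A family \<open>u\<close> stands for the sum of
  \<open>u S\<close> times the exterior monomial of \<open>S\<close>; the coefficient at
  \<open>T\<close> collects the contributions of all index sets with one element more.\<close>

definition bd :: "('v set \<Rightarrow> ('v, 'k) fvec) \<Rightarrow> 'v set \<Rightarrow> ('v, 'k) fvec" where
  "bd u T = (\<Sum>x\<in>V - T. scale_fvec (single (single x 1) (sg x T)) (u (insert x T)))"

text \<open>\<open>e\<close> is the degree of the coefficients only. The \<open>p\<close> exterior
  generators have degree 1, so the internal degree is \<open>e + p\<close>, and the boundary lowers
  \<open>p\<close> and raises \<open>e\<close>.\<close>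

definition chains :: "(nat \<Rightarrow> nat) \<Rightarrow> nat \<Rightarrow> int \<Rightarrow> ('v set \<Rightarrow> ('v, 'k) fvec) set" where
  "chains b p e = {u. \<forall>S. (S \<subseteq> V \<and> card S = p \<longrightarrow> u S \<in> free_module V b \<and> hom_deg e (u S)) \<and>
      (\<not> (S \<subseteq> V \<and> card S = p) \<longrightarrow> u S = 0)}"

text \<open>Nonvanishing of the Koszul homology of \<open>free_module V b / Z\<close> in homological degree \<open>p\<close> and
  internal degree \<open>e + p\<close>.\<close>

definition koszul_nonzero :: "(nat \<Rightarrow> nat) \<Rightarrow> ('v, 'k) fvec set \<Rightarrow> nat \<Rightarrow> int \<Rightarrow> bool" where
  "koszul_nonzero b Z p e \<longleftrightarrow> (\<exists>u\<in>chains b p e. (\<forall>T. bd u T \<in> Z) \<and>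
      \<not> (\<exists>w\<in>chains b (Suc p) (e - 1). \<forall>S. u S - bd w S \<in> Z))"

lemma chains_unfold: "u \<in> chains b p e \<Longrightarrow>
    (S \<subseteq> V \<and> card S = p \<longrightarrow> u S \<in> free_module V b \<and> hom_deg e (u S)) \<and>
    (\<not> (S \<subseteq> V \<and> card S = p) \<longrightarrow> u S = 0)"
  unfolding chains_def mem_Collect_eq by (rule spec)

lemma chains_out: "u \<in> chains b p e \<Longrightarrow> \<not> (S \<subseteq> V \<and> card S = p) \<Longrightarrow> u S = 0"
  using chains_unfold[of u b p e S] by blast

lemma chains_in: "u \<in> chains b p e \<Longrightarrow> u S \<in> free_module V b"
  using chains_unfold[of u b p e S] by (cases "S \<subseteq> V \<and> card S = p") (simp_all only: simp_thms free_module_zero)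

lemma chains_hom: "u \<in> chains b p e \<Longrightarrow> hom_deg e (u S)"
  using chains_unfold[of u b p e S] by (cases "S \<subseteq> V \<and> card S = p") (simp_all only: simp_thms hom_deg_zero)

lemma chainsI:
  "(\<And>S. S \<subseteq> V \<Longrightarrow> card S = p \<Longrightarrow> u S \<in> free_module V b) \<Longrightarrow>
   (\<And>S. S \<subseteq> V \<Longrightarrow> card S = p \<Longrightarrow> hom_deg e (u S)) \<Longrightarrow>
   (\<And>S. \<not> (S \<subseteq> V \<and> card S = p) \<Longrightarrow> u S = 0) \<Longrightarrow> u \<in> chains b p e"
  unfolding chains_def by blast

lemma chains_diff:
  assumes "u \<in> chains b p e" "w \<in> chains b p e"
  shows "(\<lambda>S. u S - w S) \<in> chains b p e"
  by (rule chainsI) (auto intro: free_module_diff hom_deg_diff chains_in[OF assms(1)] chains_in[OF assms(2)]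
      chains_hom[OF assms(1)] chains_hom[OF assms(2)] simp: chains_out[OF assms(1)] chains_out[OF assms(2)])

lemma bd_chain:
  assumes u: "u \<in> chains b (Suc p) e"
  shows "bd u \<in> chains b p (e + 1)"
proof (rule chainsI)
  fix S
  show "bd u S \<in> free_module V b"
    unfolding bd_def by (intro free_module_sum free_module_scale chains_in[OF u]) auto
  have "hom_deg (int (monom_degree (single x 1)) + e) (scale_fvec (single (single x 1) (sg x S)) (u (insert x S)))" for x
    by (rule hom_deg_monom_scale[OF chains_hom[OF u]])
  then show "hom_deg (e + 1) (bd u S)"
    unfolding bd_def by (intro hom_deg_sum) (simp add: add.commute)
  assume S: "\<not> (S \<subseteq> V \<and> card S = p)"
  have "u (insert x S) = 0" if x: "x \<in> V - S" for x
  proof (rule chains_out[OF u])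
    show "\<not> (insert x S \<subseteq> V \<and> card (insert x S) = Suc p)"
      using S x finite_V by (auto simp: card_insert_disjoint finite_subset)
  qed
  then show "bd u S = 0" unfolding bd_def by simp
qed

lemma bd_out: "u \<in> chains b 0 e \<Longrightarrow> bd u S = 0"
proof -
  assume u: "u \<in> chains b 0 e"
  have "u (insert x S) = 0" for x
    by (rule chains_out[OF u]) (use finite_V finite_subset in \<open>auto simp: card_eq_0_iff\<close>)
  then show ?thesis by (simp add: bd_def)
qed

lemma bd_diff: "bd (\<lambda>S. u S - w S) T = bd u T - bd w T"
proof -
  have "scale_fvec p (f - g) = scale_fvec p f - scale_fvec p g" for p :: "('v, 'k) mpoly" and f g
    using scale_fvec_add[of p "f - g" g] by simp
  then show ?thesis by (simp add: bd_def sum_subtractf)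
qed

lemma bd_bd: "T \<subseteq> V \<Longrightarrow> bd (bd u) T = 0"
proof -
  assume T: "T \<subseteq> V"
  let ?f = "\<lambda>x y. scale_fvec (single (single x 1 + single y 1) (sg x T * sg y (insert x T))) (u (insert y (insert x T)))"
  have "bd (bd u) T = (\<Sum>x\<in>V - T. \<Sum>y\<in>V - T - {x}. ?f x y)"
    unfolding bd_def scale_fvec_sum scale_fvec_scale mult_single
    by (intro sum.cong) auto
  also have "\<dots> = 0"
  proof (rule sum_antisym)
    fix x y assume xy: "x \<in> V - T" "y \<in> V - T" "x \<noteq> y"
    have "sg x T * sg y (insert x T) + sg y T * sg x (insert y T) = 0"
      using sg T xy unfolding koszul_sign_def by (metis add.left_inverse)
    then have "single (single x 1 + single y (1::nat)) (sg x T * sg y (insert x T)) +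
        single (single y 1 + single x 1) (sg y T * sg x (insert y T)) = 0"
      by (simp only: add.commute[of "single y (1::nat)"] single_add[symmetric] single_zero)
    then show "?f x y + ?f y x = 0"
      by (simp only: insert_commute[of y x] scale_fvec_add_left[symmetric] scale_fvec_zero)
  qed (use finite_V in auto)
  finally show ?thesis .
qed

lemma bd_bd': "u \<in> chains b p e \<Longrightarrow> bd (bd u) T = 0"
proof (cases "T \<subseteq> V")
  case False
  then show ?thesis if "u \<in> chains b p e"
    unfolding bd_def using chains_out[OF that] by simp
qed (simp add: bd_bd)

lemma bd_fhom:
  assumes d: "fhom V b' b d" and u: "u \<in> chains b' p e"
  shows "d (bd u T) = bd (\<lambda>S. d (u S)) T"
proof -
  have "d (bd u T) = (\<Sum>x\<in>V - T. d (scale_fvec (single (single x 1) (sg x T)) (u (insert x T))))"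
    unfolding bd_def by (rule fhom_sum[OF d]) (auto intro: free_module_scale chains_in[OF u])
  also have "\<dots> = bd (\<lambda>S. d (u S)) T"
    unfolding bd_def by (rule sum.cong[OF refl], rule fhom_scale[OF d _ chains_in[OF u]]) simp
  finally show ?thesis .
qed

lemma fhom_chain: "fhom V b' b d \<Longrightarrow> u \<in> chains b' p e \<Longrightarrow> (\<lambda>S. d (u S)) \<in> chains b p e"
  by (rule chainsI) (auto intro: fhom_in fhom_hom_deg chains_in chains_hom simp: chains_out fhom_zero)

text \<open>The homogeneous component of an arbitrary preimage is again a preimage, so chains lift
  within their degree.\<close>

lemma chain_lift:
  assumes d: "fhom V b' b d" and u: "u \<in> chains b p e" and im: "\<And>S. u S \<in> d ` free_module V b'"
  obtains w where "w \<in> chains b' p e" "\<And>S. d (w S) = u S"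
proof -
  have "\<exists>f. f \<in> free_module V b' \<and> hom_deg e f \<and> d f = u S" for S
  proof -
    obtain f where f: "f \<in> free_module V b'" "d f = u S" using im[of S] by force
    have "d (hcomp e f) = u S"
      using fhom_hcomp[OF d f(1), of e] f(2) hcomp_hom[OF chains_hom[OF u, of S], of e] by simp
    then show ?thesis using free_module_hcomp[OF f(1)] by (metis hom_deg_hcomp)
  qed
  then obtain w where w: "\<And>S. w S \<in> free_module V b' \<and> hom_deg e (w S) \<and> d (w S) = u S" by metis
  show ?thesis
  proof (rule that)
    let ?w = "\<lambda>S. if S \<subseteq> V \<and> card S = p then w S else 0"
    show "?w \<in> chains b' p e" by (rule chainsI) (auto simp: w)
    show "d (?w S) = u S" for S using w chains_out[OF u, of S] fhom_zero[OF d] by auto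
  qed
qed

section \<open>Koszul homology one multidegree at a time\<close>

lemma coef_bd: "coef (bd u T) c m = (\<Sum>x\<in>V \<inter> keys m - T. sg x T * coef (u (insert x T)) c (m - single x 1))"
proof -
  have "coef (bd u T) c m = (\<Sum>x\<in>V - T. if x \<in> keys m then sg x T * coef (u (insert x T)) c (m - single x 1) else 0)"
    unfolding bd_def coef_sum coef_var ..
  also have "\<dots> = (\<Sum>x\<in>V \<inter> keys m - T. sg x T * coef (u (insert x T)) c (m - single x 1))"
    using finite_V by (intro sum.mono_neutral_cong_right) auto
  finally show ?thesis .
qed

text \<open>The faces below are the complements in \<open>keys a\<close> of the index sets \<open>S\<close> for which \<open>x\<^sup>a / x\<^sup>S\<close>
  survives: this is the simplicial complex whose reduced cohomology is the Koszul homology in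
  multidegree \<open>a\<close> (Hochster's formula).\<close>

definition mfaces :: "(('v \<Rightarrow>\<^sub>0 nat) \<Rightarrow> bool) \<Rightarrow> ('v \<Rightarrow>\<^sub>0 nat) \<Rightarrow> 'v set set" where
  "mfaces N a = {t. t \<subseteq> keys a \<and> N (a - ind (keys a - t))}"

text \<open>Removing \<open>x\<close> from a face \<open>t\<close> adjoins \<open>x\<close> to the
  complement \<open>A - t\<close>; under this correspondence Koszul signs become a sign rule for
  cochains.\<close>

definition msign :: "'v set \<Rightarrow> 'v \<Rightarrow> 'v set \<Rightarrow> 'k" where
  "msign A x t = sg x (A - t)"

lemma sign_rule_msign:
  assumes "A \<subseteq> V" "\<And>t. t \<in> D \<Longrightarrow> t \<subseteq> A"
  shows "sign_rule D (msign A)"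
  unfolding sign_rule_def
proof (intro ballI conjI impI)
  fix t x y assume t: "t \<in> D" "x \<in> t"
  show "msign A x t \<noteq> 0" using sg by (simp add: msign_def koszul_sign_def)
  assume y: "y \<in> t" "x \<noteq> y"
  have eq: "A - (t - {x}) = insert x (A - t)" "A - (t - {y}) = insert y (A - t)"
    using assms(2)[OF t(1)] t y by auto
  have "x \<in> V - (A - t)" "y \<in> V - (A - t)" "A - t \<subseteq> V" using assms t y by auto
  then show "msign A x t * msign A y (t - {x}) = - (msign A y t * msign A x (t - {y}))"
    using sg y unfolding msign_def eq koszul_sign_def by blast
qed

text \<open>A smaller face means dividing by more variables, and the surviving monomials are closed
  under divisors.\<close>

lemma simplicial_mfaces:
  assumes "\<And>m m'. N (m + m') \<Longrightarrow> N m"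
  shows "simplicial (mfaces N a)"
  unfolding simplicial_def
proof (intro ballI conjI allI impI)
  fix t assume t: "t \<in> mfaces N a"
  then show "finite t" by (auto simp: mfaces_def intro: finite_subset)
  fix t' assume t': "t' \<subseteq> t"
  have "a - ind (keys a - t) = (a - ind (keys a - t')) + ind (t - t')"
    using t t'
    by (intro poly_mapping_eqI)
      (auto simp: lookup_add lookup_minus lookup_ind mfaces_def in_keys_iff finite_subset[of t "keys a"])
  then have "N (a - ind (keys a - t'))" using t assms by (auto simp: mfaces_def)
  then show "t' \<in> mfaces N a" using t t' by (auto simp: mfaces_def)
qed

text \<open>The boundary preserves the multidegree \<open>m + ind S\<close> and the basis index
  \<open>c\<close>, so primitives can be chosen for each pair \<open>(c, a)\<close> separately and
  glued. Homogeneity leaves finitely many monomials, so the glued family has polynomial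
  coefficients.\<close>

lemma monomial_boundary_aux:
  assumes u: "u \<in> chains b p e"
    and ex: "\<And>c a. keys a \<subseteq> V \<Longrightarrow> snd c < b (fst c) \<Longrightarrow> int (monom_degree a + fst c) = e + int p \<Longrightarrow>
      \<exists>w. \<forall>S \<subseteq> keys a. card S = p \<longrightarrow> N c (a - ind S) \<longrightarrow>
        coef (u S) c (a - ind S) = (\<Sum>x\<in>keys a - S. sg x S * w (insert x S))"
  shows "\<exists>w\<in>chains b (Suc p) (e - 1). \<forall>S c m. N c m \<longrightarrow> coef (u S - bd w S) c m = 0"
proof -
  define Q where "Q c a w \<longleftrightarrow> (keys a \<subseteq> V \<longrightarrow> snd c < b (fst c) \<longrightarrow>
      int (monom_degree a + fst c) = e + int p \<longrightarrow>
      (\<forall>S \<subseteq> keys a. card S = p \<longrightarrow> N c (a - ind S) \<longrightarrow>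
        coef (u S) c (a - ind S) = (\<Sum>x\<in>keys a - S. sg x S * w (insert x S))))" for c a w
  have "\<exists>w. Q c a w" for c a
    using ex[of a c] unfolding Q_def by blast
  then obtain w where "\<And>c a. Q c a (w c a)" by metis
  then have w: "coef (u S) c (a - ind S) = (\<Sum>x\<in>keys a - S. sg x S * w c a (insert x S))"
    if "keys a \<subseteq> V" "snd c < b (fst c)" "int (monom_degree a + fst c) = e + int p"
      "S \<subseteq> keys a" "card S = p" "N c (a - ind S)" for c a S
    using that unfolding Q_def by blast
  \<comment> \<open>The coefficient at monomial \<open>m\<close> and index set \<open>S\<close>
    belongs to multidegree \<open>m + ind S\<close>, so it is taken from the primitive chosen
    there.\<close>
  define g where "g S c m = (if snd c < b (fst c) \<and> keys m \<subseteq> V \<and> int (monom_degree m + fst c) = e - 1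
      then w c (m + ind S) S else 0)" for S c m
  define \<eta> where "\<eta> S = (if S \<subseteq> V \<and> card S = Suc p then of_coef (g S) else 0)" for S
  have coef_g: "coef (of_coef (g S)) c m = g S c m" for S c m
    by (rule coef_of_coef, rule finite_subset[OF _ finite_graded_basis[OF finite_V, of b "e - 1"]])
      (auto simp: g_def split: if_splits)
  have chain: "\<eta> \<in> chains b (Suc p) (e - 1)"
  proof (rule chainsI)
    fix S
    show "\<eta> S \<in> free_module V b"
      by (auto simp: \<eta>_def free_module_iff coef_g) (auto simp: g_def split: if_splits)
    show "hom_deg (e - 1) (\<eta> S)"
      by (auto simp: \<eta>_def hom_deg_def coef_g) (auto simp: g_def split: if_splits)
    show "\<eta> S = 0" if "\<not> (S \<subseteq> V \<and> card S = Suc p)" using that by (simp only: \<eta>_def if_False)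
  qed
  have "coef (u S - bd \<eta> S) c m = 0" if N: "N c m" for S c m
  proof (cases "S \<subseteq> V \<and> card S = p \<and> snd c < b (fst c) \<and> keys m \<subseteq> V \<and> int (monom_degree m + fst c) = e")
    case False
    have bd: "bd \<eta> \<in> chains b p e" using bd_chain[OF chain] by simp
    have "coef f c m = 0" if "f \<in> free_module V b" "hom_deg e f" "S \<subseteq> V \<and> card S = p" for f
      using free_moduleD[OF that(1), of c m] hom_degD[OF that(2), of c m] False that(3) by blast
    then show ?thesis
      using chains_in[OF u, of S] chains_hom[OF u, of S] chains_in[OF bd, of S] chains_hom[OF bd, of S]
        chains_out[OF u, of S] chains_out[OF bd, of S] by (metis coef_diff coef_zero diff_self)
  next
    case True
    have finS: "finite S" using True finite_V finite_subset by blast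
    let ?a = "m + ind S"
    have keys_a: "keys ?a = keys m \<union> S" using finS by (simp add: keys_plus_nat keys_ind)
    have am: "?a - ind S = m" by simp
    have "coef (u S) c m = (\<Sum>x\<in>keys ?a - S. sg x S * w c ?a (insert x S))"
      using w[of ?a c S] True N keys_a finS by (simp add: monom_degree_add monom_degree_ind)
    also have "keys ?a - S = V \<inter> keys m - S" using True keys_a by auto
    also have "(\<Sum>x\<in>V \<inter> keys m - S. sg x S * w c ?a (insert x S)) = coef (bd \<eta> S) c m"
      unfolding coef_bd
    proof (rule sum.cong[OF refl])
      fix x assume x: "x \<in> V \<inter> keys m - S"
      have m: "single x 1 + (m - single x 1) = m" using x by (intro single_plus_diff) simp
      have deg: "monom_degree m = 1 + monom_degree (m - single x 1)"
        using m monom_degree_add[of "single x 1" "m - single x 1"] by simp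
      have ks: "keys (m - single x 1) \<subseteq> V"
        using True arg_cong[OF m, of keys] by (auto simp: keys_plus_nat)
      have "ind (insert x S) = single x 1 + ind S" using x finS by (simp add: ind_def)
      \<comment> \<open>The variable \<open>x\<close> moves from the monomial to the index set, and
        the multidegree stays \<open>?a\<close>.\<close>
      then have "m - single x 1 + ind (insert x S) = ?a"
        using m by (metis add.assoc add.commute)
      then have "coef (\<eta> (insert x S)) c (m - single x 1) = w c ?a (insert x S)"
        using x True finS deg ks by (simp add: \<eta>_def coef_g) (simp add: g_def)
      then show "sg x S * w c ?a (insert x S) = sg x S * coef (\<eta> (insert x S)) c (m - single x 1)"
        by simp
    qed
    finally show ?thesis by (simp add: coef_diff)
  qed
  then show ?thesis using chain by blast
qed

text \<open>\<open>N\<close> selects the monomials that survive in the quotient. Complements in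
  \<open>keys a\<close> turn the strand of multidegree \<open>a\<close> into the cochains of
  \<open>mfaces\<close>, index sets of size \<open>p\<close> becoming faces of size
  \<open>card (keys a) - p\<close>. The first alternative in \<open>acyc\<close> serves multidegrees
  such as 0, where the complex need not be acyclic but the cycle has no component.\<close>

lemma monomial_boundary:
  assumes u: "u \<in> chains b p e"
    and cyc: "\<And>T c m. N c m \<Longrightarrow> coef (bd u T) c m = 0"
    and acyc: "\<And>c a. keys a \<subseteq> V \<Longrightarrow> snd c < b (fst c) \<Longrightarrow> int (monom_degree a + fst c) = e + int p \<Longrightarrow>
      p \<le> card (keys a) \<Longrightarrow>
      (\<forall>S. S \<subseteq> keys a \<longrightarrow> coef (u S) c (a - ind S) = 0) \<or>
      acyclic_at (mfaces (N c) a) (msign (keys a)) (card (keys a) - p)"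
  shows "\<exists>w\<in>chains b (Suc p) (e - 1). \<forall>S c m. N c m \<longrightarrow> coef (u S - bd w S) c m = 0"
proof (rule monomial_boundary_aux[OF u])
  fix c a assume a: "keys a \<subseteq> V" "snd c < b (fst c)" "int (monom_degree a + fst c) = e + int p"
  let ?A = "keys a" and ?D = "mfaces (N c) a" and ?s = "msign (keys a)"
  define v where "v t = coef (u (?A - t)) c (a - ind (?A - t))" for t
  consider "card ?A < p" | "\<forall>S. S \<subseteq> keys a \<longrightarrow> coef (u S) c (a - ind S) = 0"
    | "p \<le> card ?A" "acyclic_at ?D ?s (card ?A - p)"
    using acyc[OF a] by fastforce
  then show "\<exists>w. \<forall>S \<subseteq> ?A. card S = p \<longrightarrow> N c (a - ind S) \<longrightarrow>
        coef (u S) c (a - ind S) = (\<Sum>x\<in>?A - S. sg x S * w (insert x S))"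
  proof cases
    case 1
    have "\<not> (S \<subseteq> ?A \<and> card S = p)" for S using card_mono[of ?A S] 1 by auto
    then show ?thesis by blast
  next
    case 2
    then show ?thesis by (intro exI[of _ "\<lambda>_. 0"]) simp
  next
    case 3
    have "cocycle ?D ?s (card ?A - p) v"
      unfolding cocycle_def
    proof (intro ballI impI)
      fix t assume t: "t \<in> ?D" "card t = Suc (card ?A - p)"
      let ?T = "?A - t" and ?m = "a - ind (?A - t)"
      have tA: "t \<subseteq> ?A" using t by (auto simp: mfaces_def)
      have lk: "lookup (ind ?T) x = (if x \<in> ?T then 1 else 0)" for x by (rule lookup_ind) auto
      have km: "V \<inter> keys ?m - ?T = t"
        using tA a by (auto simp: in_keys_iff lookup_minus lk)
      have "coef (bd u ?T) c ?m = (\<Sum>x\<in>t. sg x ?T * coef (u (insert x ?T)) c (?m - single x 1))"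
        unfolding coef_bd km ..
      also have "\<dots> = cobd ?s v t"
        unfolding cobd_def
      proof (rule sum.cong[OF refl])
        fix x assume x: "x \<in> t"
        have eq: "?A - (t - {x}) = insert x ?T" using x tA by auto
        have "ind (insert x ?T) = single x 1 + ind ?T" using x by (simp add: ind_def)
        then have "?m - single x 1 = a - ind (insert x ?T)" by (simp add: diff_diff_add add.commute)
        then show "sg x ?T * coef (u (insert x ?T)) c (?m - single x 1) = ?s x t * v (t - {x})"
          by (simp add: msign_def v_def eq)
      qed
      finally show "cobd ?s v t = 0" using cyc[of c ?m ?T] t by (simp add: mfaces_def)
    qed
    then obtain w where w: "\<And>t. t \<in> ?D \<Longrightarrow> card t = card ?A - p \<Longrightarrow> v t = cobd ?s w t"
      using 3 by (auto simp: acyclic_at_def coboundary_def)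
    have "coef (u S) c (a - ind S) = (\<Sum>x\<in>?A - S. sg x S * w (?A - insert x S))"
      if S: "S \<subseteq> ?A" "card S = p" "N c (a - ind S)" for S
    proof -
      let ?t = "?A - S"
      have AS: "?A - ?t = S" using S by auto
      have "?t \<in> ?D" using S AS by (auto simp: mfaces_def)
      moreover have "card ?t = card ?A - p"
        using S by (simp add: card_Diff_subset finite_subset)
      ultimately have "v ?t = cobd ?s w ?t" by (rule w)
      moreover have "?t - {x} = ?A - insert x S" for x by auto
      ultimately show ?thesis by (simp add: v_def AS cobd_def msign_def)
    qed
    then show ?thesis by (intro exI[of _ "\<lambda>S. w (?A - S)"]) simp
  qed
qed

text \<open>If all monomials survive, \<open>mfaces\<close> is a full simplex on
  \<open>keys a\<close>, hence a cone unless \<open>a\<close> is 0. Multidegree 0 occurs only for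
  \<open>p = 0\<close> and holds the constant coefficients, which vanish on
  \<open>irrelevant_part\<close>.\<close>

lemma free_acyclic:
  assumes u: "u \<in> chains b p e" and cyc: "\<And>T. bd u T = 0"
    and p: "p > 0 \<or> u {} \<in> irrelevant_part (free_module V b)"
  shows "\<exists>w\<in>chains b (Suc p) (e - 1). \<forall>S. u S = bd w S"
proof -
  have "\<exists>w\<in>chains b (Suc p) (e - 1). \<forall>S c m. True \<longrightarrow> coef (u S - bd w S) c m = 0"
  proof (rule monomial_boundary[OF u])
    fix c :: "nat \<times> nat" and a :: "'v \<Rightarrow>\<^sub>0 nat"
    assume a: "keys a \<subseteq> V" "p \<le> card (keys a)"
    show "(\<forall>S. S \<subseteq> keys a \<longrightarrow> coef (u S) c (a - ind S) = 0) \<or>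
        acyclic_at (mfaces (\<lambda>_. True) a) (msign (keys a)) (card (keys a) - p)"
    proof (cases "keys a = {}")
      case True
      then have "p = 0" using a by simp
      then have "coef (u {}) c 0 = 0" using p unfolding irrelevant_part_iff by blast
      moreover have "a = 0" using True by (metis keys_eq_empty)
      ultimately show ?thesis using True by (simp add: ind_def)
    next
      case False
      then obtain x where x: "x \<in> keys a" by blast
      have "acyclic_at (mfaces (\<lambda>_. True) a) (msign (keys a)) (card (keys a) - p)"
        by (rule acyclic_cone[OF simplicial_mfaces sign_rule_msign[OF a(1)], of _ _ x])
          (use x in \<open>auto simp: mfaces_def\<close>)
      then show ?thesis ..
    qed
  qed (simp add: cyc)
  then obtain w where w: "w \<in> chains b (Suc p) (e - 1)" "\<And>S c m. coef (u S - bd w S) c m = 0" by blast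
  have "u S = bd w S" for S
    by (rule fvec_eqI) (use w(2)[of S] in \<open>simp add: coef_diff\<close>)
  then show ?thesis using w(1) by blast
qed

text \<open>\<open>d\<close> identifies \<open>free_module V b'\<close> modulo its kernel with the
  image of \<open>d\<close>. In the long exact sequence of the image, the free module and their
  quotient, the free module contributes nothing in positive homological degree, and the map in
  degree 0 vanishes by \<open>Z\<close>. Hence the connecting map is bijective; the internal degree
  \<open>e + p + 1\<close> is the same on both sides.\<close>

lemma koszul_nonzero_step:
  assumes d: "fhom V b' b d" and Z: "d ` free_module V b' \<subseteq> irrelevant_part (free_module V b)"
  shows "koszul_nonzero b (d ` free_module V b') (Suc p) e \<longleftrightarrow>
    koszul_nonzero b' {f \<in> free_module V b'. d f = 0} p (e + 1)"
    (is "?L \<longleftrightarrow> ?R")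
proof
  assume ?R
  then obtain u where u: "u \<in> chains b' p (e + 1)" "\<And>T. d (bd u T) = 0"
    and nb: "\<And>w. w \<in> chains b' (Suc p) e \<Longrightarrow> \<exists>S. u S - bd w S \<notin> {f \<in> free_module V b'. d f = 0}"
    unfolding koszul_nonzero_def by fastforce
  let ?du = "\<lambda>S. d (u S)"
  have du: "?du \<in> chains b p (e + 1)" by (rule fhom_chain[OF d u(1)])
  have "bd ?du T = 0" for T using bd_fhom[OF d u(1), of T] u(2) by simp
  \<comment> \<open>Minimality enters here: for \<open>p = 0\<close> it is what makes the cycle a
    boundary in the free module.\<close>
  moreover have "?du {} \<in> irrelevant_part (free_module V b)" using Z chains_in[OF u(1)] by blast
  ultimately obtain w where w: "w \<in> chains b (Suc p) e" "\<And>S. d (u S) = bd w S"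
    using free_acyclic[OF du] by auto
  have "False" if z: "z \<in> chains b (Suc (Suc p)) (e - 1)" "\<And>S. w S - bd z S \<in> d ` free_module V b'" for z
  proof -
    have bdz: "bd z \<in> chains b (Suc p) e" using bd_chain[OF z(1)] by simp
    have c: "(\<lambda>S. w S - bd z S) \<in> chains b (Suc p) e"
      by (rule chains_diff[OF w(1) bdz])
    obtain y where y: "y \<in> chains b' (Suc p) e" "\<And>S. d (y S) = w S - bd z S"
      by (rule chain_lift[OF d c z(2)]) blast
    have "d (bd y S) = bd (\<lambda>S. w S - bd z S) S" for S
      unfolding bd_fhom[OF d y(1)] y(2) ..
    then have "d (bd y S) = d (u S)" for S
      by (simp only: bd_diff bd_bd'[OF z(1)] w(2) diff_zero)
    then have "u S - bd y S \<in> {f \<in> free_module V b'. d f = 0}" for S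
      using fhom_diff[OF d chains_in[OF u(1)] chains_in[OF bd_chain[OF y(1)]], of S S]
        free_module_diff[OF chains_in[OF u(1)] chains_in[OF bd_chain[OF y(1)]], of S S]
      by simp
    then show False using nb[OF y(1)] by blast
  qed
  moreover have "bd w T \<in> d ` free_module V b'" for T using w(2) chains_in[OF u(1)] by (metis imageI)
  ultimately show ?L using w(1) unfolding koszul_nonzero_def by blast
next
  assume ?L
  then obtain w where w: "w \<in> chains b (Suc p) e" "\<And>T. bd w T \<in> d ` free_module V b'"
    and nb: "\<And>z. z \<in> chains b (Suc (Suc p)) (e - 1) \<Longrightarrow> \<exists>S. w S - bd z S \<notin> d ` free_module V b'"
    unfolding koszul_nonzero_def by blast
  obtain u where u: "u \<in> chains b' p (e + 1)" "\<And>S. d (u S) = bd w S"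
    using chain_lift[OF d bd_chain[OF w(1)] w(2)] by blast
  have "d (bd u T) = 0" for T
    using bd_fhom[OF d u(1), of T] u(2) bd_bd'[OF w(1), of T] by simp
  moreover have "bd u T \<in> free_module V b'" for T
    unfolding bd_def by (intro free_module_sum free_module_scale chains_in[OF u(1)]) auto
  moreover have False if y: "y \<in> chains b' (Suc p) e" "\<And>S. u S - bd y S \<in> {f \<in> free_module V b'. d f = 0}" for y
  proof -
    let ?dy = "\<lambda>S. d (y S)"
    have dy: "?dy \<in> chains b (Suc p) e" by (rule fhom_chain[OF d y(1)])
    have bdy: "bd y S \<in> free_module V b'" for S using chains_in[OF bd_chain[OF y(1)]] .
    have "d (u S) = d (bd y S)" for S
      using y(2)[of S] fhom_diff[OF d chains_in[OF u(1)] bdy, of S S] by simp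
    then have "bd w S = bd ?dy S" for S using u(2)[of S] bd_fhom[OF d y(1), of S] by simp
    then have "bd (\<lambda>S. w S - ?dy S) T = 0" for T by (simp add: bd_diff)
    moreover have c: "(\<lambda>S. w S - ?dy S) \<in> chains b (Suc p) e"
      by (rule chains_diff[OF w(1) dy])
    ultimately obtain z where z: "z \<in> chains b (Suc (Suc p)) (e - 1)" "\<And>S. w S - ?dy S = bd z S"
      using free_acyclic[OF c] by auto
    have "w S - bd z S \<in> d ` free_module V b'" for S
      using z(2)[of S] chains_in[OF y(1), of S] by (metis add_diff_cancel_left' diff_add_cancel imageI)
    then show False using nb[OF z(1)] by blast
  qed
  ultimately show ?R unfolding koszul_nonzero_def using u(1) by fastforce
qed

text \<open>In homological degree 0 the boundaries are the multiples of variables, and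
  \<open>Z\<close> adds nothing to them. What remains are the constant coefficients, one for each
  basis element of degree \<open>e\<close>.\<close>

lemma koszul_nonzero_0:
  assumes Z: "Z \<subseteq> irrelevant_part (free_module V b)" and Z0: "0 \<in> Z"
  shows "koszul_nonzero b Z 0 e \<longleftrightarrow> (\<exists>j. e = int j \<and> b j \<noteq> 0)"
proof
  assume "koszul_nonzero b Z 0 e"
  then obtain u where u: "u \<in> chains b 0 e"
    and nb: "\<And>w. w \<in> chains b (Suc 0) (e - 1) \<Longrightarrow> \<exists>S. u S - bd w S \<notin> Z"
    unfolding koszul_nonzero_def by blast
  have "u {} \<notin> irrelevant_part (free_module V b)"
  proof
    assume "u {} \<in> irrelevant_part (free_module V b)"
    then obtain w where "w \<in> chains b (Suc 0) (e - 1)" "\<And>S. u S = bd w S"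
      using free_acyclic[OF u bd_out[OF u]] by auto
    then show False using nb[of w] Z0 by simp
  qed
  then obtain c where c: "coef (u {}) c 0 \<noteq> 0"
    using chains_in[OF u, of "{}"] unfolding irrelevant_part_iff by blast
  then have "snd c < b (fst c)" using free_moduleD[OF chains_in[OF u] c] by simp
  moreover have "int (fst c) = e" using hom_degD[OF chains_hom[OF u] c] by simp
  ultimately show "\<exists>j. e = int j \<and> b j \<noteq> 0" by (intro exI[of _ "fst c"]) auto
next
  assume "\<exists>j. e = int j \<and> b j \<noteq> 0"
  then obtain j where j: "e = int j" "b j \<noteq> 0" by auto
  define u :: "'v set \<Rightarrow> ('v, 'k) fvec" where "u S = (if S = {} then single (j, 0) 1 else 0)" for S
  have cu: "coef (u {}) c m = (if c = (j, 0) \<and> m = 0 then 1 else 0)" for c m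
    by (simp add: u_def lookup_single when_def lookup_one)
  have u: "u \<in> chains b 0 e"
  proof (rule chainsI)
    fix S assume S: "S \<subseteq> V" "card S = 0"
    then have "S = {}" using finite_V finite_subset by (metis card_0_eq)
    then show "u S \<in> free_module V b" "hom_deg e (u S)"
      unfolding free_module_iff hom_deg_def using j by (auto simp: cu split: if_splits)
  next
    fix S assume "\<not> (S \<subseteq> V \<and> card S = 0)"
    then show "u S = 0" by (auto simp: u_def)
  qed
  have "u {} - bd w {} \<notin> Z" if w: "w \<in> chains b (Suc 0) (e - 1)" for w
  proof
    assume "u {} - bd w {} \<in> Z"
    then have "u {} - bd w {} \<in> irrelevant_part (free_module V b)" using Z by (rule rev_subsetD)
    then have "coef (u {} - bd w {}) (j, 0) 0 = 0" unfolding irrelevant_part_iff by (elim conjE) (rule spec)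
    then show False by (simp only: coef_diff cu coef_bd) simp
  qed
  then have nb: "\<not> (\<forall>S. u S - bd w S \<in> Z)" if "w \<in> chains b (Suc 0) (e - 1)" for w
    using that by metis
  have "bd u T \<in> Z" for T using bd_out[OF u] Z0 by simp
  then show "koszul_nonzero b Z 0 e"
    unfolding koszul_nonzero_def by (intro bexI[OF _ u] conjI allI notI) (blast, erule bexE, erule nb[THEN notE], assumption)
qed

end


section \<open>Betti numbers and Koszul homology\<close>

definition graded_sub :: "'v set \<Rightarrow> (nat \<Rightarrow> nat) \<Rightarrow> ('v, 'k::field) fvec set \<Rightarrow> bool" where
  "graded_sub V b Z \<longleftrightarrow> Z \<subseteq> free_module V b \<and> 0 \<in> Z \<and> (\<forall>f\<in>Z. \<forall>g\<in>Z. f + g \<in> Z) \<and>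
     (\<forall>p\<in>poly_ring V. \<forall>f\<in>Z. scale_fvec p f \<in> Z) \<and> (\<forall>f\<in>Z. \<forall>e. hcomp e f \<in> Z)"

lemma graded_sub_in: "graded_sub V b Z \<Longrightarrow> f \<in> Z \<Longrightarrow> f \<in> free_module V b"
  and graded_sub_zero: "graded_sub V b Z \<Longrightarrow> 0 \<in> Z"
  and graded_sub_add: "graded_sub V b Z \<Longrightarrow> f \<in> Z \<Longrightarrow> g \<in> Z \<Longrightarrow> f + g \<in> Z"
  and graded_sub_scale: "graded_sub V b Z \<Longrightarrow> p \<in> poly_ring V \<Longrightarrow> f \<in> Z \<Longrightarrow> scale_fvec p f \<in> Z"
  and graded_sub_hcomp: "graded_sub V b Z \<Longrightarrow> f \<in> Z \<Longrightarrow> hcomp e f \<in> Z"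
  unfolding graded_sub_def by blast+

lemma graded_sub_diff: "graded_sub V b Z \<Longrightarrow> f \<in> Z \<Longrightarrow> g \<in> Z \<Longrightarrow> f - g \<in> Z"
  using graded_sub_add[of V b Z f "- g"] graded_sub_scale[of V b Z "single 0 (- 1)" g]
  by (simp add: scale_minus_one)

lemma graded_sub_sum: "graded_sub V b Z \<Longrightarrow> (\<And>i. i \<in> A \<Longrightarrow> f i \<in> Z) \<Longrightarrow> sum f A \<in> Z"
  by (induction A rule: infinite_finite_induct) (auto simp: graded_sub_zero graded_sub_add)

context koszul
begin

lemma bd_sub:
  assumes Z: "graded_sub V b Z" and u: "\<And>S. u S \<in> Z"
  shows "bd u T \<in> Z"
  unfolding bd_def by (rule graded_sub_sum[OF Z], rule graded_sub_scale[OF Z _ u]) simp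

lemma chain_lift_mod:
  assumes d: "fhom V b' b d" and Z: "graded_sub V b Z"
    and surj: "\<And>q. q \<in> free_module V b \<Longrightarrow> \<exists>f\<in>free_module V b'. d f - q \<in> Z"
    and u: "u \<in> chains b p e"
  obtains w where "w \<in> chains b' p e" "\<And>S. d (w S) - u S \<in> Z"
proof -
  have "\<exists>f. f \<in> free_module V b' \<and> hom_deg e f \<and> d f - u S \<in> Z" for S
  proof -
    obtain f where f: "f \<in> free_module V b'" "d f - u S \<in> Z" using surj[OF chains_in[OF u, of S]] by blast
    have "hcomp e (d f - u S) = hcomp e (d f) - hcomp e (u S)"
      by (rule fvec_eqI) (simp add: coef_hcomp coef_diff)
    also have "\<dots> = d (hcomp e f) - u S"
      using fhom_hcomp[OF d f(1), of e] hcomp_hom[OF chains_hom[OF u, of S], of e] by simp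
    finally have "d (hcomp e f) - u S \<in> Z" using graded_sub_hcomp[OF Z f(2), of e] by simp
    then show ?thesis using free_module_hcomp[OF f(1)] hom_deg_hcomp by blast
  qed
  then obtain w where w: "\<And>S. w S \<in> free_module V b' \<and> hom_deg e (w S) \<and> d (w S) - u S \<in> Z" by metis
  show ?thesis
  proof (rule that)
    let ?w = "\<lambda>S. if S \<subseteq> V \<and> card S = p then w S else 0"
    show "?w \<in> chains b' p e" by (rule chainsI) (auto simp: w)
    show "d (?w S) - u S \<in> Z" for S
      using w[of S] chains_out[OF u, of S] fhom_zero[OF d] graded_sub_zero[OF Z] by auto
  qed
qed

text \<open>\<open>d\<close> induces an isomorphism from \<open>free_module V b'\<close> modulo the
  preimage of \<open>Z\<close> onto \<open>free_module V b\<close> modulo \<open>Z\<close>. On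
  chains it is inverted by lifting modulo \<open>Z\<close>; the error stays in \<open>Z\<close>
  because \<open>bd\<close> preserves families in \<open>Z\<close>.\<close>

lemma koszul_nonzero_transport:
  assumes d: "fhom V b' b d" and Z: "graded_sub V b Z"
    and surj: "\<And>q. q \<in> free_module V b \<Longrightarrow> \<exists>f\<in>free_module V b'. d f - q \<in> Z"
  shows "koszul_nonzero b' {f \<in> free_module V b'. d f \<in> Z} p e \<longleftrightarrow> koszul_nonzero b Z p e"
    (is "?L \<longleftrightarrow> ?R")
proof
  let ?Z' = "{f \<in> free_module V b'. d f \<in> Z}"
  assume ?L
  then obtain u where u: "u \<in> chains b' p e" "\<And>T. bd u T \<in> ?Z'"
    and nb: "\<And>w. w \<in> chains b' (Suc p) (e - 1) \<Longrightarrow> \<exists>S. u S - bd w S \<notin> ?Z'"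
    unfolding koszul_nonzero_def by blast
  let ?du = "\<lambda>S. d (u S)"
  have du: "?du \<in> chains b p e" by (rule fhom_chain[OF d u(1)])
  have 1: "bd ?du T \<in> Z" for T using bd_fhom[OF d u(1), of T] u(2)[of T] by simp
  have 2: False if w: "w \<in> chains b (Suc p) (e - 1)" "\<And>S. d (u S) - bd w S \<in> Z" for w
  proof -
    obtain y where y: "y \<in> chains b' (Suc p) (e - 1)" "\<And>S. d (y S) - w S \<in> Z"
      by (rule chain_lift_mod[OF d Z surj w(1)]) blast+
    have yF: "bd y S \<in> free_module V b'" for S using chains_in[OF bd_chain[OF y(1)]] .
    have "d (u S - bd y S) \<in> Z" for S
    proof -
      have "d (u S - bd y S) = d (u S) - bd (\<lambda>S. d (y S)) S"
        using fhom_diff[OF d chains_in[OF u(1)] yF, of S S] bd_fhom[OF d y(1), of S] by simp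
      also have "\<dots> = (d (u S) - bd w S) - bd (\<lambda>S. d (y S) - w S) S"
        by (simp add: bd_diff)
      finally show ?thesis using graded_sub_diff[OF Z w(2)[of S] bd_sub[where u = "\<lambda>S. d (y S) - w S" and T = S, OF Z y(2)]] by (simp only:)
    qed
    then have "u S - bd y S \<in> ?Z'" for S using free_module_diff[OF chains_in[OF u(1)] yF, of S S] by simp
    then show False using nb[OF y(1)] by blast
  qed
  show ?R unfolding koszul_nonzero_def
    by (intro bexI[OF _ du] conjI allI 1 notI) (use 2 in blast)
next
  let ?Z' = "{f \<in> free_module V b'. d f \<in> Z}"
  assume ?R
  then obtain u where u: "u \<in> chains b p e" "\<And>T. bd u T \<in> Z"
    and nb: "\<And>w. w \<in> chains b (Suc p) (e - 1) \<Longrightarrow> \<exists>S. u S - bd w S \<notin> Z"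
    unfolding koszul_nonzero_def by blast
  obtain y where y: "y \<in> chains b' p e" "\<And>S. d (y S) - u S \<in> Z"
    by (rule chain_lift_mod[OF d Z surj u(1)]) blast+
  have 1: "bd y T \<in> ?Z'" for T
  proof -
    have "d (bd y T) = bd (\<lambda>S. d (y S) - u S) T + bd u T"
      using bd_fhom[OF d y(1), of T] by (simp add: bd_diff)
    moreover have "bd y T \<in> free_module V b'"
      unfolding bd_def by (intro free_module_sum free_module_scale chains_in[OF y(1)]) auto
    ultimately show ?thesis using graded_sub_add[OF Z bd_sub[where u = "\<lambda>S. d (y S) - u S" and T = T, OF Z y(2)] u(2)[of T]] by simp
  qed
  have 2: False if w: "w \<in> chains b' (Suc p) (e - 1)" "\<And>S. y S - bd w S \<in> ?Z'" for w
  proof -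
    have wF: "bd w S \<in> free_module V b'" for S using chains_in[OF bd_chain[OF w(1)]] .
    have "u S - bd (\<lambda>S. d (w S)) S \<in> Z" for S
    proof -
      have "u S - bd (\<lambda>S. d (w S)) S = d (y S - bd w S) - (d (y S) - u S)"
        using fhom_diff[OF d chains_in[OF y(1)] wF, of S S] bd_fhom[OF d w(1), of S] by simp
      moreover have "d (y S - bd w S) \<in> Z" using w(2)[of S] by simp
      ultimately show ?thesis using graded_sub_diff[OF Z _ y(2)[of S]] by (simp only:)
    qed
    then show False using nb[OF fhom_chain[OF d w(1)]] by blast
  qed
  show ?L unfolding koszul_nonzero_def
    by (intro bexI[OF _ y(1)] conjI allI 1 notI) (use 2 in blast)
qed

end

section \<open>The quotient ring as a quotient of a free module of rank one\<close>

definition unit_rank :: "nat \<Rightarrow> nat" where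
  "unit_rank j = (if j = 0 then 1 else 0)"

lemma less_unit_rank_iff [simp]: "snd c < unit_rank (fst c) \<longleftrightarrow> c = (0, 0)"
  by (cases c) (simp add: unit_rank_def)

definition unit_sub :: "'v set \<Rightarrow> ('v, 'k::field) mpoly set \<Rightarrow> ('v, 'k) fvec set" where
  "unit_sub V I = {f \<in> free_module V unit_rank. lookup f (0, 0) \<in> I}"

lemma single_in_unit: "p \<in> poly_ring V \<Longrightarrow> single (0, 0) p \<in> free_module V unit_rank"
  by (auto simp: free_module_def poly_ring_def lookup_single when_def unit_rank_def)

lemma scale_single: "scale_fvec p (single c q) = single c (p * q)"
  by (rule poly_mapping_eqI) (simp add: lookup_scale_fvec lookup_single when_def)

lemma homogeneous_single: "homogeneous e p \<Longrightarrow> homogeneous_fvec e (single (0, 0) p)"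
  by (auto simp: homogeneous_def homogeneous_fvec_def split: if_splits)

context koszul
begin

text \<open>The augmentation transports the Koszul homology of the quotient ring to that of
  \<open>?F 0\<close> modulo the first syzygies. Each further step trades one homological degree for
  the next syzygy module; after \<open>i\<close> steps degree 0 is reached, which sees the basis
  elements of the \<open>i\<close>-th free module. The right-hand side does not mention the
  resolution.\<close>

theorem betti_iff_koszul_nonzero:
  assumes res: "minimal_graded_free_resolution V I \<beta> d \<epsilon>"
    and gs: "graded_sub V unit_rank (unit_sub V I)"
  shows "\<beta> i j \<noteq> 0 \<longleftrightarrow> koszul_nonzero unit_rank (unit_sub V I) i (int j - int i)"
proof -
  let ?F = "\<lambda>i. free_module V (\<beta> i)" and ?U = "unit_sub V I"
  let ?Z = "\<lambda>i. d i ` ?F (Suc i)"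
  note R0 = res[unfolded minimal_graded_free_resolution_def Let_def]
  note R1 = R0[THEN conjunct2] note R2 = R1[THEN conjunct2] note R3 = R2[THEN conjunct2]
  note R4 = R3[THEN conjunct2] note R5 = R4[THEN conjunct2]
  have eps: "graded_hom V scale_fvec homogeneous_fvec (?F 0) (*) homogeneous (poly_ring V) \<epsilon>"
    using R0 by (rule conjunct1)
  have dh: "fhom V (\<beta> (Suc i)) (\<beta> i) (d i)" for i using R1[THEN conjunct1] by (rule spec)
  have surj: "\<exists>f\<in>?F 0. \<epsilon> f - p \<in> I" if "p \<in> poly_ring V" for p
    using R2[THEN conjunct1] that by (rule bspec)
  have im0: "d 0 ` ?F 1 = {f \<in> ?F 0. \<epsilon> f \<in> I}" using R3 by (rule conjunct1)
  have im: "d (Suc i) ` ?F (Suc (Suc i)) = {f \<in> ?F (Suc i). d i f = 0}" for i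
    using R4[THEN conjunct1] by (rule spec)
  have irr: "d i ` ?F (Suc i) \<subseteq> irrelevant_part (?F i)" for i using R5 by (rule spec)
  define \<phi> where "\<phi> f = single (0 :: nat, 0 :: nat) (\<epsilon> f)" for f
  have eps_in: "\<epsilon> f \<in> poly_ring V" if "f \<in> ?F 0" for f
    using eps that unfolding graded_hom_def by blast
  have \<phi>_in: "\<phi> f \<in> free_module V unit_rank" if "f \<in> ?F 0" for f
    unfolding \<phi>_def by (rule single_in_unit[OF eps_in[OF that]])
  have \<phi>: "fhom V (\<beta> 0) unit_rank \<phi>"
    unfolding graded_hom_def
  proof (intro conjI ballI allI impI)
    show "\<phi> ` ?F 0 \<subseteq> free_module V unit_rank" using \<phi>_in by blast
    fix f :: "('v, 'k) fvec" assume f: "f \<in> ?F 0"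
    show "\<phi> (f + g) = \<phi> f + \<phi> g" if "g \<in> ?F 0" for g
      using eps f that unfolding graded_hom_def \<phi>_def by (simp add: single_add)
    show "homogeneous_fvec e (\<phi> f)" if "homogeneous_fvec e f" for e
      using eps f that unfolding graded_hom_def \<phi>_def by (intro homogeneous_single) blast
    show "\<phi> (scale_fvec p f) = scale_fvec p (\<phi> f)" if "p \<in> poly_ring V" for p
      using eps f that unfolding graded_hom_def \<phi>_def by (simp add: scale_single)
  qed
  have \<phi>_surj: "\<exists>f\<in>?F 0. \<phi> f - q \<in> ?U" if q: "q \<in> free_module V unit_rank" for q
  proof -
    have "lookup q (0, 0) \<in> poly_ring V" using q by (simp add: free_module_def)
    then obtain f where f: "f \<in> ?F 0" "\<epsilon> f - lookup q (0, 0) \<in> I" using surj by blast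
    have "\<phi> f - q \<in> ?U"
      using free_module_diff[OF \<phi>_in[OF f(1)] q] f(2) by (simp add: unit_sub_def \<phi>_def lookup_minus)
    then show ?thesis using f(1) by blast
  qed
  have Z0: "{f \<in> ?F 0. \<phi> f \<in> ?U} = ?Z 0"
    using \<phi>_in im0 by (auto simp: unit_sub_def \<phi>_def)
  have base: "koszul_nonzero (\<beta> 0) (?Z 0) p e \<longleftrightarrow> koszul_nonzero unit_rank ?U p e" for p e
    using koszul_nonzero_transport[OF \<phi> gs \<phi>_surj] unfolding Z0 by blast
  have step: "koszul_nonzero (\<beta> k) (?Z k) (Suc p) e \<longleftrightarrow> koszul_nonzero (\<beta> (Suc k)) (?Z (Suc k)) p (e + 1)" for k p e
    using koszul_nonzero_step[OF dh irr] unfolding im .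
  have iter: "koszul_nonzero (\<beta> k) (?Z k) p e \<longleftrightarrow> koszul_nonzero (\<beta> (k + p)) (?Z (k + p)) 0 (e + int p)" for k p e
  proof (induction p arbitrary: k e)
    case (Suc p)
    show ?case unfolding step Suc.IH by (simp add: algebra_simps)
  qed simp
  have "0 \<in> ?Z i" using fhom_zero[OF dh] free_module_zero by (metis imageI)
  then have "koszul_nonzero (\<beta> i) (?Z i) 0 (int j) \<longleftrightarrow> \<beta> i j \<noteq> 0"
    using koszul_nonzero_0[OF irr] by auto
  then show ?thesis using base[of i "int j - int i"] iter[of 0 i "int j - int i"] by simp
qed

section \<open>Squarefree monomial ideals\<close>

definition monomial_sub :: "('v set \<Rightarrow> bool) \<Rightarrow> ('v, 'k) fvec set" where
  "monomial_sub P = {f \<in> free_module V unit_rank. \<forall>m. coef f (0, 0) m \<noteq> 0 \<longrightarrow> \<not> P (keys m)}"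

lemma monomial_subI:
  "f \<in> free_module V unit_rank \<Longrightarrow> (\<And>m. P (keys m) \<Longrightarrow> coef f (0, 0) m = 0) \<Longrightarrow> f \<in> monomial_sub P"
  unfolding monomial_sub_def by blast

lemma monomial_subD: "f \<in> monomial_sub P \<Longrightarrow> P (keys m) \<Longrightarrow> coef f (0, 0) m = 0"
  unfolding monomial_sub_def by blast

text \<open>Multidegrees that are not squarefree contribute nothing. A squarefree one is the
  indicator of some \<open>W\<close>, its \<open>mfaces\<close> are the subsets of \<open>W\<close>
  satisfying \<open>P\<close>, and its internal degree \<open>e + p\<close> is
  \<open>card W\<close>.\<close>

theorem hochster:
  assumes P: "\<And>A B. P A \<Longrightarrow> B \<subseteq> A \<Longrightarrow> P B"
  shows "koszul_nonzero unit_rank (monomial_sub P) p e \<longleftrightarrow>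
    (\<exists>W e'. W \<subseteq> V \<and> e = int e' \<and> card W = e' + p \<and> \<not> acyclic_at {t. t \<subseteq> W \<and> P t} (msign W) e')"
    (is "?L \<longleftrightarrow> ?R")
proof
  assume ?L
  then obtain u where u: "u \<in> chains unit_rank p e" "\<And>T. bd u T \<in> monomial_sub P"
    and nb: "\<And>w. w \<in> chains unit_rank (Suc p) (e - 1) \<Longrightarrow> \<exists>S. u S - bd w S \<notin> monomial_sub P"
    unfolding koszul_nonzero_def by blast
  show ?R
  proof (rule ccontr)
    assume nR: "\<not> ?R"
    let ?N = "\<lambda>(c :: nat \<times> nat) (m :: 'v \<Rightarrow>\<^sub>0 nat). c = (0, 0) \<and> P (keys m)"
    have "\<exists>w\<in>chains unit_rank (Suc p) (e - 1). \<forall>S c m. ?N c m \<longrightarrow> coef (u S - bd w S) c m = 0"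
    proof (rule monomial_boundary[OF u(1)])
      show "coef (bd u T) c m = 0" if "?N c m" for T c m
        using monomial_subD[OF u(2)] that by blast
      fix c :: "nat \<times> nat" and a :: "'v \<Rightarrow>\<^sub>0 nat"
      assume a: "keys a \<subseteq> V" "snd c < unit_rank (fst c)" "int (monom_degree a + fst c) = e + int p"
        "p \<le> card (keys a)"
      have c: "c = (0, 0)" using a by simp
      have simpl: "simplicial (mfaces (?N c) a)"
        by (rule simplicial_mfaces) (auto simp: keys_plus_nat intro: P)
      have sign: "sign_rule (mfaces (?N c) a) (msign (keys a))"
        by (rule sign_rule_msign[OF a(1)]) (auto simp: mfaces_def)
      have lk: "lookup (ind (keys a - t)) x = (if x \<in> keys a - t then 1 else 0)" for t x
        by (rule lookup_ind) auto
      have "acyclic_at (mfaces (?N c) a) (msign (keys a)) (card (keys a) - p)"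
      \<comment> \<open>An exponent of at least 2 keeps \<open>x\<close> in the support even after
        division by \<open>x\<close>, so \<open>x\<close> is an apex of
        \<open>mfaces\<close>.\<close>
      proof (cases "\<exists>x. lookup a x \<ge> 2")
        case True
        then obtain x where x: "lookup a x \<ge> 2" by blast
        have xa: "x \<in> keys a" using x by (simp add: in_keys_iff)
        have "keys (a - ind (keys a - insert x t)) = keys (a - ind (keys a - t))" for t
          using x by (auto simp: in_keys_iff lookup_minus lookup_ind split: if_splits)
        then show ?thesis
          by (intro acyclic_cone[OF simpl sign, of x]) (use xa in \<open>auto simp: mfaces_def\<close>)
      next
        case False
        have le1: "lookup a x = (if x \<in> keys a then 1 else 0)" for x
        proof -
          have "lookup a x < 2" using False not_le by blast
          then show ?thesis by (simp add: in_keys_iff)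
        qed
        have "a = ind (keys a)" by (rule poly_mapping_eqI) (simp only: lookup_ind[OF finite_keys] le1)
        then have "monom_degree a = card (keys a)" by (metis monom_degree_ind finite_keys)
        then have deg: "e = int (card (keys a) - p)" "card (keys a) = (card (keys a) - p) + p"
          using a c by simp_all
        have ks: "keys (a - ind (keys a - t)) = t" if "t \<subseteq> keys a" for t
        proof (rule set_eqI)
          fix x
          show "x \<in> keys (a - ind (keys a - t)) \<longleftrightarrow> x \<in> t"
            using that le1[of x] by (auto simp: in_keys_iff lookup_minus lk split: if_splits)
        qed
        have "mfaces (?N c) a = {t. t \<subseteq> keys a \<and> P t}"
          unfolding mfaces_def using ks c by auto
        then show ?thesis using nR a(1) deg by metis
      qed
      then show "(\<forall>S. S \<subseteq> keys a \<longrightarrow> coef (u S) c (a - ind S) = 0) \<or>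
          acyclic_at (mfaces (?N c) a) (msign (keys a)) (card (keys a) - p)" ..
    qed
    then obtain w where w: "w \<in> chains unit_rank (Suc p) (e - 1)"
      "\<And>S m. P (keys m) \<Longrightarrow> coef (u S - bd w S) (0, 0) m = 0" by blast
    have "bd w S \<in> free_module V unit_rank" for S using chains_in[OF bd_chain[OF w(1)]] .
    then have "u S - bd w S \<in> monomial_sub P" for S
      by (intro monomial_subI free_module_diff chains_in[OF u(1)] w(2))
    then show False using nb[OF w(1)] by blast
  qed
next
  assume ?R
  then obtain W e' where W: "W \<subseteq> V" "e = int e'" "card W = e' + p"
    "\<not> acyclic_at {t. t \<subseteq> W \<and> P t} (msign W) e'" by blast
  have finW: "finite W" using W finite_V finite_subset by blast
  obtain v where coc: "cocycle {t. t \<subseteq> W \<and> P t} (msign W) e' v"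
    and ncob: "\<not> coboundary {t. t \<subseteq> W \<and> P t} (msign W) e' v"
    using W(4) unfolding acyclic_at_def by blast
  \<comment> \<open>The cochain \<open>v\<close> is placed in multidegree \<open>ind W\<close>: the
    coefficient at \<open>S\<close> is the monomial of \<open>W - S\<close> times
    \<open>v (W - S)\<close>.\<close>
  define u :: "'v set \<Rightarrow> ('v, 'k) fvec" where
    "u S = (if S \<subseteq> W \<and> card S = p then single (0, 0) (single (ind (W - S)) (v (W - S))) else 0)" for S
  have fW: "finite (W - S)" for S using finW by simp
  have cu: "coef (u S) c m = (if S \<subseteq> W \<and> card S = p \<and> c = (0, 0) \<and> m = ind (W - S) then v (W - S) else 0)" for S c m
    by (simp add: u_def lookup_single when_def)
  have u: "u \<in> chains unit_rank p e"
  proof (rule chainsI)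
    fix S
    have cz: "S \<subseteq> W \<and> card S = p \<and> c = (0, 0) \<and> m = ind (W - S)" if "coef (u S) c m \<noteq> 0" for c m
      using that unfolding cu by (meson)
    show "u S \<in> free_module V unit_rank"
      unfolding free_module_iff using cz keys_ind[OF fW, of S] W(1) by (metis Diff_subset less_unit_rank_iff subset_trans)
    have "monom_degree (ind (W - S)) = e'" if "S \<subseteq> W" "card S = p"
      using that W(3) finW by (simp add: monom_degree_ind card_Diff_subset finite_subset)
    then show "hom_deg e (u S)"
      unfolding hom_deg_def using cz W(2) by (metis add.right_neutral fst_conv)
    assume "\<not> (S \<subseteq> V \<and> card S = p)"
    then have "\<not> (S \<subseteq> W \<and> card S = p)" using W(1) by blast
    then show "u S = 0" unfolding u_def by (rule if_not_P)
  qed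
  have sub_eq: "W - (t - {x}) = insert x (W - t)" if "t \<subseteq> W" "x \<in> t" for t x using that by blast
  have ind_eq: "ind t = single x 1 + ind (t - {x})" if "t \<subseteq> W" "x \<in> t" for t x
    using that finite_subset[OF that(1) finW] by (simp add: ind_def sum.remove)
  have bd_u: "bd u T \<in> monomial_sub P" for T
  proof (rule monomial_subI)
    show "bd u T \<in> free_module V unit_rank"
      unfolding bd_def by (intro free_module_sum free_module_scale chains_in[OF u]) auto
    fix m :: "'v \<Rightarrow>\<^sub>0 nat" assume Pm: "P (keys m)"
    show "coef (bd u T) (0, 0) m = 0"
    proof (rule ccontr)
      assume nz: "coef (bd u T) (0, 0) m \<noteq> 0"
      then obtain y where y: "y \<in> V \<inter> keys m - T" "coef (u (insert y T)) (0, 0) (m - single y 1) \<noteq> 0"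
        unfolding coef_bd by (metis (no_types, lifting) mult_zero_right sum.neutral)
      then have yT: "insert y T \<subseteq> W" "card (insert y T) = p" "m - single y 1 = ind (W - insert y T)"
        unfolding cu by meson+
      let ?t = "W - T"
      have t: "?t \<subseteq> W" "y \<in> ?t" "W - ?t = T" using yT y by auto
      have eq: "?t - {y} = W - insert y T" by blast
      have "single y 1 + (m - single y 1) = m" by (rule single_plus_diff) (use y(1) in simp)
      then have m: "m = ind ?t"
        using ind_eq[OF t(1,2)] unfolding eq yT(3)[symmetric] by (rule trans[OF sym sym])
      have km: "keys m = ?t" unfolding m by (rule keys_ind[OF fW])
      have finT: "finite T" using yT(1) by (intro finite_subset[OF _ finW]) simp
      have "card T + 1 = p" using yT(2) y(1) finT by simp
      moreover have "card ?t = card W - card T" using yT(1) finT by (intro card_Diff_subset) auto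
      ultimately have ct: "card ?t = Suc e'" using W(3) by simp
      have "coef (bd u T) (0, 0) m = (\<Sum>x\<in>?t. sg x T * coef (u (insert x T)) (0, 0) (m - single x 1))"
        unfolding coef_bd km using W(1) by (intro sum.cong) auto
      also have "\<dots> = cobd (msign W) v ?t"
        unfolding cobd_def
      proof (rule sum.cong[OF refl])
        fix x assume x: "x \<in> ?t"
        have eq: "insert x T = W - (?t - {x})" using sub_eq[OF t(1) x] t(3) by simp
        have "m - single x 1 = ind (?t - {x})" using ind_eq[OF t(1) x] m by simp
        moreover have "W - insert x T = ?t - {x}" by blast
        moreover have "insert x T \<subseteq> W" using x yT(1) by blast
        moreover have "card (insert x T) = p" using x finT \<open>card T + 1 = p\<close> by simp
        ultimately have "coef (u (insert x T)) (0, 0) (m - single x 1) = v (?t - {x})"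
          unfolding cu by simp
        then show "sg x T * coef (u (insert x T)) (0, 0) (m - single x 1) = msign W x ?t * v (?t - {x})"
          by (simp only: msign_def t(3))
      qed
      also have "\<dots> = 0" using coc ct Pm km t(1) unfolding cocycle_def by simp
      finally show False using nz by contradiction
    qed
  qed
  have nb: False if w: "w \<in> chains unit_rank (Suc p) (e - 1)" "\<And>S. u S - bd w S \<in> monomial_sub P" for w
  proof -
    \<comment> \<open>Only the component of \<open>w\<close> in multidegree \<open>ind W\<close>
      matters: at the index set \<open>W - t\<close> this is the coefficient of
      \<open>ind t\<close>.\<close>
    have "v t = cobd (msign W) (\<lambda>t. coef (w (W - t)) (0, 0) (ind t)) t"
      if t: "t \<subseteq> W" "P t" "card t = e'" for t
    proof -
      let ?S = "W - t"
      have fint: "finite t" using t finW finite_subset by blast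
      have WS: "W - ?S = t" using t by blast
      have "card ?S = p" using t W(3) fint by (simp add: card_Diff_subset)
      then have "coef (u ?S) (0, 0) (ind t) = v t" unfolding cu WS by simp
      moreover have "coef (u ?S - bd w ?S) (0, 0) (ind t) = 0"
        by (rule monomial_subD[OF w(2)]) (simp add: keys_ind[OF fint] t)
      ultimately have "v t = coef (bd w ?S) (0, 0) (ind t)" by (simp add: coef_diff)
      also have "\<dots> = (\<Sum>x\<in>t. sg x ?S * coef (w (insert x ?S)) (0, 0) (ind t - single x 1))"
        unfolding coef_bd keys_ind[OF fint] using t(1) W(1) by (intro sum.cong) auto
      also have "\<dots> = cobd (msign W) (\<lambda>t. coef (w (W - t)) (0, 0) (ind t)) t"
        unfolding cobd_def
      proof (rule sum.cong[OF refl])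
        fix x assume x: "x \<in> t"
        have "ind t - single x 1 = ind (t - {x})" using ind_eq[OF t(1) x] by simp
        then show "sg x ?S * coef (w (insert x ?S)) (0, 0) (ind t - single x 1) =
            msign W x t * coef (w (W - (t - {x}))) (0, 0) (ind (t - {x}))"
          unfolding msign_def sub_eq[OF t(1) x] by simp
      qed
      finally show ?thesis .
    qed
    then show False using ncob unfolding coboundary_def by blast
  qed
  show ?L unfolding koszul_nonzero_def
    by (intro bexI[OF _ u] conjI allI bd_u notI) (use nb in blast)
qed

end


section \<open>Existence of minimal resolutions\<close>

abbreviation kscale :: "'k \<Rightarrow> ('v, 'k::field) fvec \<Rightarrow> ('v, 'k) fvec" where
  "kscale a f \<equiv> scale_fvec (single 0 a) f"

interpretation kvec: vector_space "kscale :: 'k::field \<Rightarrow> ('v, 'k) fvec \<Rightarrow> ('v, 'k) fvec"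
  by unfold_locales (rule fvec_eqI; simp add: coef_const coef_add algebra_simps)+

lemma hom_deg_scale:
  assumes "\<And>m. lookup p m \<noteq> 0 \<Longrightarrow> int (monom_degree m) + e = e'" "hom_deg e f"
  shows "hom_deg e' (scale_fvec p f)"
  unfolding hom_deg_def
proof (intro allI impI)
  fix c m assume "coef (scale_fvec p f) c m \<noteq> 0"
  then obtain d u where du: "m = d + u" "lookup p d \<noteq> 0" "coef f c u \<noteq> 0"
    unfolding lookup_scale_fvec by (rule lookup_times_nonzero)
  then show "int (monom_degree m + fst c) = e'"
    using assms(1)[OF du(2)] hom_degD[OF assms(2) du(3)] by (simp add: monom_degree_add)
qed

lemma hom_deg_kscale: "hom_deg e f \<Longrightarrow> hom_deg e (kscale a f)"
  by (rule hom_deg_scale[of _ e]) (auto simp: lookup_single when_def split: if_splits)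

lemma hom_expansion:
  fixes f :: "('v, 'k::field) fvec"
  assumes V: "finite V" and f: "f \<in> free_module V b" "hom_deg e f"
  defines "B \<equiv> {(c, m :: 'v \<Rightarrow>\<^sub>0 nat). snd c < b (fst c) \<and> keys m \<subseteq> V \<and> int (monom_degree m + fst c) = e}"
  shows "f = (\<Sum>(c, m)\<in>B. single c (single m (coef f c m)))"
proof (rule fvec_eqI)
  fix c m
  have fin: "finite B" unfolding B_def by (rule finite_graded_basis[OF V])
  have "coef (\<Sum>(c, m)\<in>B. single c (single m (coef f c m))) c m =
      (\<Sum>q\<in>B. if q = (c, m) then coef f c m else 0)"
    unfolding coef_sum by (intro sum.cong) (auto simp: lookup_single when_def split: if_splits)
  also have "\<dots> = (if (c, m) \<in> B then coef f c m else 0)"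
    by (rule sum.delta[OF fin])
  also have "\<dots> = coef f c m"
    using free_moduleD[OF f(1), of c m] hom_degD[OF f(2), of c m] by (auto simp: B_def)
  finally show "coef f c m = coef (\<Sum>(c, m)\<in>B. single c (single m (coef f c m))) c m" by simp
qed

text \<open>For a graded submodule \<open>M\<close>, their span over the field is the degree
  \<open>e\<close> part of the product of \<open>M\<close> with the irrelevant ideal.\<close>

definition decomposables :: "'v set \<Rightarrow> ('v, 'k::field) fvec set \<Rightarrow> int \<Rightarrow> ('v, 'k) fvec set" where
  "decomposables V M e = {scale_fvec (single (single x 1) 1) f | x f. x \<in> V \<and> f \<in> M \<and> hom_deg (e - 1) f}"

text \<open>A basis \<open>C\<close> of the decomposable part extends to a basis \<open>D\<close> of
  the whole graded piece. The new elements \<open>D - C\<close> are minimal generators in this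
  degree: they are independent modulo decomposables.\<close>

lemma minimal_generators:
  fixes M :: "('v, 'k::field) fvec set"
  assumes V: "finite V" and M: "graded_sub V b M"
  shows "\<exists>G. finite G \<and> G \<subseteq> {f \<in> M. hom_deg e f} \<and>
    {f \<in> M. hom_deg e f} \<subseteq> kvec.span (G \<union> decomposables V M e) \<and>
    (\<forall>a. (\<Sum>g\<in>G. kscale (a g) g) \<in> kvec.span (decomposables V M e) \<longrightarrow> (\<forall>g\<in>G. a g = 0))"
proof -
  let ?Me = "{f \<in> M. hom_deg e f}" and ?N = "kvec.span (decomposables V M e)"
  have subM: "kvec.subspace ?Me"
    unfolding kvec.subspace_def
    using graded_sub_zero[OF M] graded_sub_add[OF M] graded_sub_scale[OF M const_in_poly_ring]
    by (auto intro: hom_deg_add hom_deg_kscale)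
  have "scale_fvec (single (single x 1) 1) f \<in> ?Me" if "x \<in> V" "f \<in> M" "hom_deg (e - 1) f" for x f
    using graded_sub_scale[OF M _ that(2), of "single (single x 1) 1"] that(1)
      hom_deg_monom_scale[OF that(3), of "single x 1" 1] by simp
  then have "decomposables V M e \<subseteq> ?Me" unfolding decomposables_def by blast
  then have NM: "?N \<subseteq> ?Me" using subM by (rule kvec.span_minimal)
  obtain C where C: "C \<subseteq> ?N" "kvec.independent C" "?N \<subseteq> kvec.span C"
    by (rule kvec.maximal_independent_subset)
  obtain D where D: "C \<subseteq> D" "D \<subseteq> ?Me" "kvec.independent D" "?Me \<subseteq> kvec.span D"
    using kvec.maximal_independent_subset_extend[of C ?Me] C NM by blast
  let ?B = "{(c, m :: 'v \<Rightarrow>\<^sub>0 nat). snd c < b (fst c) \<and> keys m \<subseteq> V \<and> int (monom_degree m + fst c) = e}"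
  let ?T = "(\<lambda>(c, m). single c (single m 1)) ` ?B :: ('v, 'k) fvec set"
  have "f \<in> kvec.span ?T" if f: "f \<in> M" "hom_deg e f" for f
  proof -
    have "f = (\<Sum>(c, m)\<in>?B. single c (single m (coef f c m)))"
      by (rule hom_expansion[OF V graded_sub_in[OF M f(1)] f(2)])
    also have "\<dots> = (\<Sum>q\<in>?B. kscale (coef f (fst q) (snd q)) ((\<lambda>(c, m). single c (single m 1)) q))"
      by (rule sum.cong[OF refl]) (simp add: scale_single mult_single split: prod.splits)
    also have "\<dots> \<in> kvec.span ?T"
      by (intro kvec.span_sum kvec.span_scale kvec.span_base imageI)
    finally show ?thesis .
  qed
  then have "D \<subseteq> kvec.span ?T" using D(2) by blast
  moreover have "finite ?T" by (intro finite_imageI finite_graded_basis[OF V])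
  ultimately have finD: "finite D" using kvec.independent_span_bound D(3) by blast
  have finC: "finite C" using finD D(1) by (rule rev_finite_subset)
  let ?G = "D - C"
  have "?Me \<subseteq> kvec.span (?G \<union> decomposables V M e)"
  proof -
    have "C \<subseteq> kvec.span (?G \<union> decomposables V M e)"
      using C(1) kvec.span_mono[of "decomposables V M e" "?G \<union> decomposables V M e"] by blast
    moreover have "?G \<subseteq> kvec.span (?G \<union> decomposables V M e)"
      using kvec.span_superset[of "?G \<union> decomposables V M e"] by simp
    ultimately have "D \<subseteq> kvec.span (?G \<union> decomposables V M e)" by blast
    then have "kvec.span D \<subseteq> kvec.span (?G \<union> decomposables V M e)"
      by (rule kvec.span_minimal[OF _ kvec.subspace_span])
    with D(4) show ?thesis by (rule subset_trans)
  qed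
  moreover have "\<forall>g\<in>?G. a g = 0" if a: "(\<Sum>g\<in>?G. kscale (a g) g) \<in> ?N" for a
  proof
    fix g assume g: "g \<in> ?G"
    have "(\<Sum>g\<in>?G. kscale (a g) g) \<in> kvec.span C" using a C(3) by blast
    then obtain w where w: "(\<Sum>g\<in>?G. kscale (a g) g) = (\<Sum>c\<in>C. kscale (w c) c)"
      unfolding kvec.span_finite[OF finC] by blast
    \<comment> \<open>A combination of new elements that lies in the span of \<open>C\<close>
      becomes a linear relation on \<open>D\<close> once the coefficients on \<open>C\<close> are
      negated.\<close>
    define u where "u x = (if x \<in> C then - w x else a x)" for x
    have "(\<Sum>x\<in>D. kscale (u x) x) = (\<Sum>x\<in>?G. kscale (u x) x) + (\<Sum>x\<in>C. kscale (u x) x)"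
      by (rule sum.subset_diff[OF D(1) finD])
    also have "(\<Sum>x\<in>?G. kscale (u x) x) = (\<Sum>g\<in>?G. kscale (a g) g)"
      by (rule sum.cong) (auto simp: u_def)
    also have "(\<Sum>x\<in>C. kscale (u x) x) = (\<Sum>x\<in>C. - kscale (w x) x)"
      by (rule sum.cong[OF refl]) (simp add: u_def flip: kvec.scale_minus_left)
    finally have "(\<Sum>x\<in>D. kscale (u x) x) = 0" using w by (simp add: sum_negf)
    then have "u g = 0" using kvec.independentD[OF D(3) finD subset_refl] g by blast
    then show "a g = 0" using g by (simp add: u_def)
  qed
  ultimately show ?thesis using D(2) finD by (intro exI[of _ ?G]) auto
qed

text \<open>One basis vector for each minimal generator. Surjectivity is the graded form of
  Nakayama's lemma; a kernel element with a nonzero constant coefficient would be a relation among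
  generators modulo decomposables.\<close>

lemma minimal_cover:
  fixes M :: "('v, 'k::field) fvec set"
  assumes V: "finite V" and M: "graded_sub V b M"
  shows "\<exists>b' d. fhom V b' b d \<and> d ` free_module V b' = M \<and>
    {f \<in> free_module V b'. d f = 0} \<subseteq> irrelevant_part (free_module V b')"
proof -
  let ?N = "\<lambda>j. kvec.span (decomposables V M (int j))"
  have "\<forall>j. \<exists>G. finite G \<and> G \<subseteq> {f \<in> M. hom_deg (int j) f} \<and>
    {f \<in> M. hom_deg (int j) f} \<subseteq> kvec.span (G \<union> decomposables V M (int j)) \<and>
    (\<forall>a. (\<Sum>g\<in>G. kscale (a g) g) \<in> ?N j \<longrightarrow> (\<forall>g\<in>G. a g = 0))"
    using minimal_generators[OF V M] by blast
  then obtain G where G: "\<forall>j. finite (G j) \<and> G j \<subseteq> {f \<in> M. hom_deg (int j) f} \<and>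
    {f \<in> M. hom_deg (int j) f} \<subseteq> kvec.span (G j \<union> decomposables V M (int j)) \<and>
    (\<forall>a. (\<Sum>g\<in>G j. kscale (a g) g) \<in> ?N j \<longrightarrow> (\<forall>g\<in>G j. a g = 0))"
    by (rule choice[THEN exE])
  have finG: "finite (G j)" and GM: "G j \<subseteq> {f \<in> M. hom_deg (int j) f}"
    and Gspan: "{f \<in> M. hom_deg (int j) f} \<subseteq> kvec.span (G j \<union> decomposables V M (int j))"
    and Gind: "(\<Sum>g\<in>G j. kscale (a g) g) \<in> ?N j \<Longrightarrow> g \<in> G j \<Longrightarrow> a g = 0" for j a g
    using G by blast+
  define b' where "b' j = card (G j)" for j
  have "\<exists>h. bij_betw h {..<b' j} (G j)" for j
    using ex_bij_betw_nat_finite[OF finG, of j] by (simp add: b'_def atLeast0LessThan)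
  then obtain h where h: "\<And>j. bij_betw (h j) {..<b' j} (G j)" by metis
  define g where "g c = h (fst c) (snd c)" for c
  have gG: "g c \<in> G (fst c)" if "snd c < b' (fst c)" for c
    using bij_betwE[OF h] that by (auto simp: g_def)
  have gM: "g c \<in> M" "hom_deg (int (fst c)) (g c)" if "snd c < b' (fst c)" for c
    using gG[OF that] GM by blast+
  define d where "d f = (\<Sum>c\<in>keys f. scale_fvec (lookup f c) (g c))" for f
  have d_sup: "d f = (\<Sum>c\<in>K. scale_fvec (lookup f c) (g c))" if "finite K" "keys f \<subseteq> K" for f K
    unfolding d_def using that by (intro sum.mono_neutral_left) (auto simp: in_keys_iff)
  have keysD: "snd c < b' (fst c)" if "f \<in> free_module V b'" "c \<in> keys f" for f :: "('v, 'k) fvec" and c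
    using that unfolding free_module_def by fastforce
  have dM: "d f \<in> M" if f: "f \<in> free_module V b'" for f
    unfolding d_def
  proof (rule graded_sub_sum[OF M])
    fix c assume "c \<in> keys f"
    then show "scale_fvec (lookup f c) (g c) \<in> M"
      using f gM(1)[OF keysD[OF f]] by (intro graded_sub_scale[OF M]) (auto simp: free_module_def)
  qed
  have d: "fhom V b' b d"
    unfolding graded_hom_def
  proof (intro conjI ballI allI impI)
    show "d ` free_module V b' \<subseteq> free_module V b" using dM graded_sub_in[OF M] by blast
    fix f :: "('v, 'k) fvec" assume f: "f \<in> free_module V b'"
    show "d (f + f') = d f + d f'" for f'
    proof -
      let ?K = "keys f \<union> keys f'"
      have "d (f + f') = (\<Sum>c\<in>?K. scale_fvec (lookup (f + f') c) (g c))"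
        using keys_add[of f f'] by (intro d_sup) auto
      also have "\<dots> = d f + d f'"
        using d_sup[of ?K f] d_sup[of ?K f'] by (simp add: lookup_add scale_fvec_add_left sum.distrib)
      finally show ?thesis .
    qed
    show "d (scale_fvec p f) = scale_fvec p (d f)" for p
    proof -
      have "d (scale_fvec p f) = (\<Sum>c\<in>keys f. scale_fvec (lookup (scale_fvec p f) c) (g c))"
        by (intro d_sup) (auto simp: in_keys_iff lookup_scale_fvec)
      then show ?thesis by (simp add: d_def lookup_scale_fvec scale_fvec_sum scale_fvec_scale)
    qed
    show "homogeneous_fvec e (d f)" if e: "homogeneous_fvec e f" for e
      unfolding homogeneous_fvec_iff d_def
    proof (intro hom_deg_sum)
      fix c assume c: "c \<in> keys f"
      show "hom_deg (int e) (scale_fvec (lookup f c) (g c))"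
      proof (rule hom_deg_scale[OF _ gM(2)[OF keysD[OF f c]]])
        fix m assume "coef f c m \<noteq> 0"
        then show "int (monom_degree m) + int (fst c) = int e"
          using hom_degD[of "int e" f c m] e by (simp add: homogeneous_fvec_iff)
      qed
    qed
  qed
  have d_single: "d (single c p) = scale_fvec p (g c)" for c p
    using d_sup[of "{c}" "single c p"] by (simp add: lookup_single split: if_splits)
  let ?Im = "d ` free_module V b'"
  have Im_scale: "scale_fvec p y \<in> ?Im" if p: "p \<in> poly_ring V" and y: "y \<in> ?Im" for p y
  proof -
    obtain f where f: "y = d f" "f \<in> free_module V b'" using y by (rule imageE)
    have "scale_fvec p y = d (scale_fvec p f)" using fhom_scale[OF d p f(2)] f(1) by simp
    then show ?thesis using free_module_scale[OF p f(2)] by (rule image_eqI)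
  qed
  have subIm: "kvec.subspace ?Im"
    unfolding kvec.subspace_def
  proof (intro conjI ballI allI)
    show "0 \<in> ?Im" using fhom_zero[OF d] free_module_zero by (metis imageI)
    show "x + y \<in> ?Im" if x: "x \<in> ?Im" and y: "y \<in> ?Im" for x y
    proof -
      obtain f where f: "x = d f" "f \<in> free_module V b'" using x by (rule imageE)
      obtain f' where f': "y = d f'" "f' \<in> free_module V b'" using y by (rule imageE)
      have "x + y = d (f + f')" using fhom_add[OF d f(2) f'(2)] f(1) f'(1) by simp
      then show ?thesis using free_module_add[OF f(2) f'(2)] by (rule image_eqI)
    qed
    show "kscale a x \<in> ?Im" if "x \<in> ?Im" for a x
      using Im_scale[OF const_in_poly_ring that] .
  qed
  have G_Im: "G j \<subseteq> ?Im" for j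
  proof
    fix y assume "y \<in> G j"
    then have "y \<in> h j ` {..<b' j}" using h[of j] by (simp add: bij_betw_def)
    then obtain l where l: "l < b' j" "h j l = y" by auto
    have "d (single (j, l) 1) = y" using l by (simp add: d_single g_def)
    moreover have "single (j, l) 1 \<in> free_module V b'"
      using l by (auto simp: free_module_def lookup_single when_def poly_ring_def)
    ultimately show "y \<in> ?Im" by (metis imageI)
  qed
  \<comment> \<open>By induction on the degree, decomposables are multiples of elements already
    known to lie in the image.\<close>
  have hom_Im: "f \<in> ?Im" if "f \<in> M" "hom_deg (int j) f" for f j
    using that
  proof (induction j arbitrary: f)
    case (0 f)
    have "decomposables V M (int 0) \<subseteq> {0}"
    proof
      fix y assume "y \<in> decomposables V M (int 0)"
      then obtain x f where y: "y = scale_fvec (single (single x 1) 1) f" "hom_deg (int 0 - 1) f"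
        unfolding decomposables_def by blast
      have "f = 0" using y(2) by (rule hom_deg_negative[rotated]) simp
      then show "y \<in> {0}" using y(1) by simp
    qed
    also have "\<dots> \<subseteq> ?Im" using kvec.subspace_0[OF subIm] by blast
    finally have "kvec.span (G 0 \<union> decomposables V M (int 0)) \<subseteq> ?Im"
      using G_Im by (intro kvec.span_minimal[OF _ subIm]) blast
    then show ?case using Gspan[of 0] 0 by blast
  next
    case (Suc j f)
    have "decomposables V M (int (Suc j)) \<subseteq> ?Im"
      using Suc.IH Im_scale[OF monom_in_poly_ring] by (auto simp: decomposables_def)
    then have "kvec.span (G (Suc j) \<union> decomposables V M (int (Suc j))) \<subseteq> ?Im"
      using G_Im by (intro kvec.span_minimal[OF _ subIm]) blast
    then show ?case using Gspan[of "Suc j"] Suc.prems by blast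
  qed
  have "f \<in> ?Im" if f: "f \<in> M" for f
  proof -
    obtain E where E: "finite E" "f = (\<Sum>e\<in>E. hcomp e f)" by (rule hcomp_decomp)
    have "hcomp e f \<in> ?Im" for e
    proof (cases "e < 0")
      case True
      then have "hcomp e f = 0" using hom_deg_negative hom_deg_hcomp by blast
      then show ?thesis using kvec.subspace_0[OF subIm] by simp
    next
      case False
      then have "e = int (nat e)" by simp
      then show ?thesis using hom_Im[of "hcomp e f" "nat e"] graded_sub_hcomp[OF M f] hom_deg_hcomp by metis
    qed
    then have "(\<Sum>e\<in>E. hcomp e f) \<in> ?Im" by (intro kvec.subspace_sum[OF subIm])
    then show ?thesis by (subst E(2))
  qed
  then have im: "?Im = M" using dM by blast
  have ker: "f \<in> irrelevant_part (free_module V b')" if f: "f \<in> free_module V b'" "d f = 0" for f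
  proof (rule ccontr)
    assume "f \<notin> irrelevant_part (free_module V b')"
    then obtain c where c: "coef f c 0 \<noteq> 0" using f(1) unfolding irrelevant_part_iff by blast
    obtain j l where jl: "c = (j, l)" by (cases c)
    have l: "l < b' j" using free_moduleD[OF f(1) c] jl by simp
    define y where "y = hcomp (int j) f"
    have y: "y \<in> free_module V b'" "hom_deg (int j) y" "d y = 0"
      using free_module_hcomp[OF f(1)] fhom_hcomp[OF d f(1), of "int j", symmetric] f(2)
        hcomp_hom[of 0 0 "int j"] by (auto simp: y_def)
    \<comment> \<open>The constant coefficients of \<open>f\<close> in degree \<open>j\<close>. The
      rest \<open>z\<close> of \<open>y\<close> has no constant coefficients, so each of its terms
      is a variable times a term of lower degree and \<open>d z\<close> is decomposable. Then so is
      \<open>d y0\<close>, and independence of the generators kills its coefficients.\<close>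
    define y0 where "y0 = (\<Sum>l<b' j. single (j, l) (single 0 (coef f (j, l) 0)) :: ('v, 'k) fvec)"
    have y0_in: "single (j, l) (single 0 a) \<in> free_module V b'" if "l < b' j" for l a
      using that by (auto simp: free_module_def lookup_single when_def poly_ring_def)
    have cy0: "coef y0 c m = (if fst c = j \<and> snd c < b' j \<and> m = 0 then coef f c 0 else 0)" for c m
    proof -
      have "coef y0 c m = (\<Sum>l<b' j. if l = snd c then (if fst c = j \<and> m = 0 then coef f c 0 else 0) else 0)"
        unfolding y0_def coef_sum by (intro sum.cong) (auto simp: lookup_single when_def)
      then show ?thesis by simp
    qed
    have y0F: "y0 \<in> free_module V b'" unfolding y0_def by (intro free_module_sum y0_in) simp
    have y0h: "hom_deg (int j) y0" unfolding hom_deg_def cy0 by simp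
    define z where "z = y - y0"
    have z: "z \<in> free_module V b'" "hom_deg (int j) z"
      unfolding z_def using y y0F y0h by (auto intro: free_module_diff hom_deg_diff)
    have z0: "coef z c 0 = 0" for c
      using free_moduleD[OF f(1), of c 0] by (auto simp: z_def coef_diff cy0 y_def coef_hcomp)
    let ?B = "{(c, m :: 'v \<Rightarrow>\<^sub>0 nat). snd c < b' (fst c) \<and> keys m \<subseteq> V \<and> int (monom_degree m + fst c) = int j}"
    have zexp: "z = (\<Sum>q\<in>?B. single (fst q) (single (snd q) (coef z (fst q) (snd q))))"
      using hom_expansion[OF V z] by (simp add: case_prod_beta)
    have "d z = (\<Sum>q\<in>?B. d (single (fst q) (single (snd q) (coef z (fst q) (snd q)))))"
      by (subst zexp, rule fhom_sum[OF d]) (auto simp: free_module_def lookup_single when_def poly_ring_def)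
    also have "\<dots> \<in> ?N j"
    proof (rule kvec.span_sum)
      fix q assume q: "q \<in> ?B"
      obtain c m where cm: "q = (c, m)" by (cases q)
      show "d (single (fst q) (single (snd q) (coef z (fst q) (snd q)))) \<in> ?N j"
      proof (cases "m = 0")
        case True
        then show ?thesis using z0[of c] fhom_zero[OF d] kvec.span_zero by (simp add: cm)
      next
        case False
        then have "keys m \<noteq> {}" by (metis keys_eq_empty)
        then obtain x where x: "x \<in> keys m" by blast
        have m: "single x 1 + (m - single x 1) = m" using x by (rule single_plus_diff)
        have kV: "keys m \<subseteq> V" "snd c < b' (fst c)" "int (monom_degree m + fst c) = int j" using q cm by auto
        have k': "keys (m - single x 1) \<subseteq> V" using kV(1) arg_cong[OF m, of keys] by (auto simp: keys_plus_nat)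
        let ?f = "scale_fvec (single (m - single x 1) (coef z c m)) (g c)"
        have "d (single c (single m (coef z c m))) = scale_fvec (single (single x 1) 1) ?f"
          unfolding d_single scale_fvec_scale mult_single m by simp
        moreover have "?f \<in> M" by (intro graded_sub_scale[OF M] gM(1) kV(2) monom_in_poly_ring k')
        moreover have "hom_deg (int j - 1) ?f"
        proof -
          have "monom_degree m = 1 + monom_degree (m - single x 1)"
            using arg_cong[OF m, of monom_degree] by (simp only: monom_degree_add monom_degree_single)
          then have "int (monom_degree (m - single x 1)) + int (fst c) = int j - 1" using kV(3) by simp
          then show ?thesis using hom_deg_monom_scale[OF gM(2)[OF kV(2)], of "m - single x 1" "coef z c m"] by simp
        qed
        ultimately have "d (single c (single m (coef z c m))) \<in> decomposables V M (int j)"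
          unfolding decomposables_def using x kV(1) by blast
        then show ?thesis unfolding cm fst_conv snd_conv by (rule kvec.span_base)
      qed
    qed
    finally have dz: "d z \<in> ?N j" .
    have "d z = - d y0" using fhom_diff[OF d y(1) y0F] y(3) by (simp add: z_def)
    then have "d y0 \<in> ?N j" using kvec.span_neg[OF dz] by simp
    moreover have "d y0 = (\<Sum>l<b' j. kscale (coef f (j, l) 0) (h j l))"
      unfolding y0_def by (subst fhom_sum[OF d y0_in]) (auto simp: d_single g_def)
    moreover have "\<dots> = (\<Sum>u\<in>G j. kscale (coef f (j, inv_into {..<b' j} (h j) u) 0) u)"
      by (subst sum.reindex_bij_betw[OF h, symmetric], rule sum.cong)
        (use h[of j] in \<open>auto simp: bij_betw_def inv_into_f_f\<close>)
    ultimately have "(\<Sum>u\<in>G j. kscale (coef f (j, inv_into {..<b' j} (h j) u) 0) u) \<in> ?N j" by simp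
    then have "coef f (j, inv_into {..<b' j} (h j) (h j l)) 0 = 0"
      by (rule Gind) (use h[of j] l in \<open>auto simp: bij_betw_def\<close>)
    moreover have "inv_into {..<b' j} (h j) (h j l) = l"
      using h[of j] l by (auto simp: bij_betw_def inv_into_f_f)
    ultimately show False using c jl by simp
  qed
  show ?thesis using d im ker by blast
qed

lemma graded_sub_kernel:
  assumes d: "fhom V b' b d"
  shows "graded_sub V b' {f \<in> free_module V b'. d f = 0}"
  unfolding graded_sub_def
proof (intro conjI ballI allI)
  let ?K = "{f \<in> free_module V b'. d f = 0}"
  show "?K \<subseteq> free_module V b'" by blast
  show "0 \<in> ?K" using fhom_zero[OF d] by simp
  fix f assume f: "f \<in> ?K"
  show "f + g \<in> ?K" if "g \<in> ?K" for g
    using f that fhom_add[OF d, of f g] free_module_add[of f V b' g] by simp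
  show "scale_fvec p f \<in> ?K" if "p \<in> poly_ring V" for p
    using f that fhom_scale[OF d that, of f] free_module_scale[OF that, of f b'] by simp
  show "hcomp e f \<in> ?K" for e
    using f fhom_hcomp[OF d, of f e, symmetric] free_module_hcomp[of f V b' e] hcomp_hom[of 0 0 e] by simp
qed

text \<open>Dependent choice over pairs of a free module and the submodule that the next
  differential must have as image. The start is the ring with the ideal \<open>I\<close>, so the
  augmentation just reads off the coordinate.\<close>

theorem minimal_resolution_exists:
  fixes I :: "('v, 'k::field) mpoly set"
  assumes V: "finite V" and gs: "graded_sub V unit_rank (unit_sub V I)"
    and irr: "unit_sub V I \<subseteq> irrelevant_part (free_module V unit_rank)"
  shows "\<exists>\<beta> d \<epsilon>. minimal_graded_free_resolution V I \<beta> d \<epsilon>"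
proof -
  define P where "P x \<longleftrightarrow> graded_sub V (fst x) (snd x) \<and> snd x \<subseteq> irrelevant_part (free_module V (fst x))"
    for x :: "(nat \<Rightarrow> nat) \<times> ('v, 'k) fvec set"
  define Q where "Q x y d \<longleftrightarrow> fhom V (fst y) (fst x) d \<and> d ` free_module V (fst y) = snd x \<and>
      snd y = {f \<in> free_module V (fst y). d f = 0}"
    for x y :: "(nat \<Rightarrow> nat) \<times> ('v, 'k) fvec set" and d
  let ?x0 = "(unit_rank, unit_sub V I)"
  have "\<exists>f. \<forall>n. (P (f n) \<and> (n = 0 \<longrightarrow> f n = ?x0)) \<and> (\<exists>d. Q (f n) (f (Suc n)) d)"
  proof (rule dependent_nat_choice)
    show "\<exists>x. P x \<and> ((0::nat) = 0 \<longrightarrow> x = ?x0)" using gs irr by (auto simp: P_def)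
    fix x and n :: nat assume x: "P x \<and> (n = 0 \<longrightarrow> x = ?x0)"
    obtain b' d where bd: "fhom V b' (fst x) d" "d ` free_module V b' = snd x"
      "{f \<in> free_module V b'. d f = 0} \<subseteq> irrelevant_part (free_module V b')"
      using minimal_cover[OF V, of "fst x" "snd x"] x unfolding P_def by blast
    then have "P (b', {f \<in> free_module V b'. d f = 0})"
      unfolding P_def using graded_sub_kernel[OF bd(1)] by simp
    moreover have "Q x (b', {f \<in> free_module V b'. d f = 0}) d"
      unfolding Q_def using bd by simp
    ultimately show "\<exists>y. (P y \<and> (Suc n = 0 \<longrightarrow> y = ?x0)) \<and> (\<exists>d. Q x y d)" by blast
  qed
  then obtain X where X: "\<And>n. P (X n)" "X 0 = ?x0" "\<And>n. \<exists>d. Q (X n) (X (Suc n)) d" by auto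
  obtain d where d: "\<And>n. Q (X n) (X (Suc n)) (d n)" using choice[of "\<lambda>n d. Q (X n) (X (Suc n)) d"] X(3) by blast
  define \<beta> where "\<beta> n = fst (X n)" for n
  define \<epsilon> where "\<epsilon> f = lookup f (0, 0)" for f :: "('v, 'k) fvec"
  have b0: "\<beta> 0 = unit_rank" using X(2) by (simp add: \<beta>_def)
  have "minimal_graded_free_resolution V I \<beta> d \<epsilon>"
    unfolding minimal_graded_free_resolution_def Let_def
  proof (intro conjI allI ballI)
    show "graded_hom V scale_fvec homogeneous_fvec (free_module V (\<beta> 0)) (*) homogeneous (poly_ring V) \<epsilon>"
      unfolding graded_hom_def
    proof (intro conjI ballI allI impI)
      show "\<epsilon> ` free_module V (\<beta> 0) \<subseteq> poly_ring V" by (auto simp: free_module_def \<epsilon>_def)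
      fix f :: "('v, 'k) fvec"
      show "\<epsilon> (f + g) = \<epsilon> f + \<epsilon> g" for g by (simp add: \<epsilon>_def lookup_add)
      show "\<epsilon> (scale_fvec p f) = p * \<epsilon> f" for p by (simp add: \<epsilon>_def lookup_scale_fvec)
      show "homogeneous e (\<epsilon> f)" if "homogeneous_fvec e f" for e
        unfolding homogeneous_def \<epsilon>_def
      proof
        fix m assume "m \<in> keys (lookup f (0, 0))"
        then have "coef f (0, 0) m \<noteq> 0" by (simp add: in_keys_iff)
        then show "monom_degree m = e"
          using hom_degD[of "int e" f "(0, 0)" m] that by (simp add: homogeneous_fvec_iff)
      qed
    qed
    show "fhom V (\<beta> (Suc i)) (\<beta> i) (d i)" for i using d[of i] by (simp add: Q_def \<beta>_def)
    show "\<exists>f\<in>free_module V (\<beta> 0). \<epsilon> f - p \<in> I" if "p \<in> poly_ring V" for p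
    proof
      show "single (0, 0) p \<in> free_module V (\<beta> 0)" unfolding b0 by (rule single_in_unit[OF that])
      show "\<epsilon> (single (0, 0) p) - p \<in> I"
        using graded_sub_zero[OF gs] by (simp add: \<epsilon>_def unit_sub_def)
    qed
    have im: "d n ` free_module V (\<beta> (Suc n)) = snd (X n)" for n using d[of n] by (simp add: Q_def \<beta>_def)
    show "d 0 ` free_module V (\<beta> 1) = {f \<in> free_module V (\<beta> 0). \<epsilon> f \<in> I}"
      using im[of 0] X(2) b0 by (simp add: unit_sub_def \<epsilon>_def)
    show "d (Suc i) ` free_module V (\<beta> (Suc (Suc i))) = {f \<in> free_module V (\<beta> (Suc i)). d i f = 0}" for i
      unfolding im using d[of i] by (simp add: Q_def \<beta>_def)
    show "d i ` free_module V (\<beta> (Suc i)) \<subseteq> irrelevant_part (free_module V (\<beta> i))" for i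
      unfolding im using X(1)[of i] by (simp add: P_def \<beta>_def)
  qed
  then show ?thesis by blast
qed


section \<open>Edge ideals and unions of complements of cycles\<close>

lemma keys_var_times: "keys (var x * var y :: ('v, 'k::field) mpoly) = {single x 1 + single y 1}"
  by (simp add: var_def mult_single)

text \<open>A polynomial lies in a monomial ideal iff each of its monomials does. Since the
  endpoints of an edge are distinct, divisibility by the generator means that both lie in the
  support.\<close>

lemma edge_ideal_eq:
  fixes G :: "'v graph"
  assumes V: "\<And>x y. {x, y} \<in> edges G \<Longrightarrow> x \<in> verts G \<and> y \<in> verts G \<and> x \<noteq> y"
  shows "(edge_ideal G :: ('v, 'k::field) mpoly set) =
    {p \<in> poly_ring (verts G). \<forall>m\<in>keys p. \<exists>x\<in>keys m. \<exists>y\<in>keys m. {x, y} \<in> edges G}"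
    (is "_ = ?R")
proof (intro equalityI subsetI)
  fix p :: "('v, 'k) mpoly" assume "p \<in> edge_ideal G"
  then obtain C and q :: "('v, 'k) mpoly \<Rightarrow> ('v, 'k) mpoly" where p: "p = (\<Sum>b\<in>C. q b * b)"
    and C: "C \<subseteq> {var x * var y | x y. {x, y} \<in> edges G}" and q: "\<forall>b\<in>C. q b \<in> poly_ring (verts G)"
    unfolding edge_ideal_def ideal_generated_def by blast
  have *: "keys m \<subseteq> verts G \<and> (\<exists>x\<in>keys m. \<exists>y\<in>keys m. {x, y} \<in> edges G)" if m: "m \<in> keys p" for m
  proof -
    obtain b where b: "b \<in> C" "lookup (q b * b) m \<noteq> 0"
      using m unfolding p in_keys_iff lookup_sum by (meson sum.not_neutral_contains_not_neutral)
    then obtain a d where ad: "m = a + d" "lookup (q b) a \<noteq> 0" "lookup b d \<noteq> 0"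
      by (auto elim: lookup_times_nonzero)
    obtain x y where xy: "b = var x * var y" "{x, y} \<in> edges G" using C b(1) by blast
    have "d \<in> keys (var x * var y :: ('v, 'k) mpoly)" using ad(3) unfolding xy(1) in_keys_iff .
    then have d: "d = single x 1 + single y 1" unfolding keys_var_times by simp
    have "keys a \<subseteq> verts G" using q b(1) ad(2) by (auto simp: poly_ring_def in_keys_iff)
    moreover have "keys m = keys a \<union> {x, y}" unfolding ad(1) d keys_plus_nat by auto
    ultimately show ?thesis using V[OF xy(2)] xy(2) by auto
  qed
  then show "p \<in> ?R" unfolding poly_ring_def by blast
next
  fix p :: "('v, 'k) mpoly" assume p: "p \<in> ?R"
  then have "\<forall>m\<in>keys p. \<exists>xy. fst xy \<in> keys m \<and> snd xy \<in> keys m \<and> {fst xy, snd xy} \<in> edges G"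
  proof (intro ballI)
    fix m assume "m \<in> keys p"
    then obtain x y where "x \<in> keys m" "y \<in> keys m" "{x, y} \<in> edges G" using p by blast
    then show "\<exists>xy. fst xy \<in> keys m \<and> snd xy \<in> keys m \<and> {fst xy, snd xy} \<in> edges G"
      by (intro exI[of _ "(x, y)"]) simp
  qed
  then obtain xy where "\<forall>m\<in>keys p. fst (xy m) \<in> keys m \<and> snd (xy m) \<in> keys m \<and> {fst (xy m), snd (xy m)} \<in> edges G"
    by (rule bchoice[THEN exE])
  then have xy: "fst (xy m) \<in> keys m" "snd (xy m) \<in> keys m" "{fst (xy m), snd (xy m)} \<in> edges G"
    if "m \<in> keys p" for m using that by blast+
  define t where "t m = single (fst (xy m)) 1 + single (snd (xy m)) (1 :: nat)" for m
  define g where "g m = (var (fst (xy m)) * var (snd (xy m)) :: ('v, 'k) mpoly)" for m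
  \<comment> \<open>Several monomials of \<open>p\<close> may use the same generator
    \<open>b\<close>; \<open>q b\<close> gathers their cofactors.\<close>
  define q where "q b = (\<Sum>m\<in>{m \<in> keys p. g m = b}. single (m - t m) (lookup p m))" for b
  have mt: "(m - t m) + t m = m" if "m \<in> keys p" for m
    using xy[OF that] V[OF xy(3)[OF that]]
    by (intro poly_mapping_eqI) (auto simp: lookup_add lookup_minus t_def lookup_single when_def in_keys_iff)
  have "p = (\<Sum>m\<in>keys p. single m (lookup p m))"
    by (rule poly_mapping_eqI) (simp add: lookup_sum lookup_single when_def in_keys_iff sum.delta)
  also have "\<dots> = (\<Sum>m\<in>keys p. single (m - t m) (lookup p m) * g m)"
    by (rule sum.cong[OF refl]) (simp add: g_def var_def mult_single mt flip: t_def[simplified])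
  also have "\<dots> = (\<Sum>b\<in>g ` keys p. \<Sum>m\<in>{m \<in> keys p. g m = b}. single (m - t m) (lookup p m) * g m)"
    by (rule sum.group[symmetric]) auto
  also have "\<dots> = (\<Sum>b\<in>g ` keys p. q b * b)"
    unfolding q_def sum_distrib_right by (intro sum.cong) auto
  finally have "p = (\<Sum>b\<in>g ` keys p. q b * b)" .
  moreover have "g ` keys p \<subseteq> {var x * var y | x y. {x, y} \<in> edges G}"
    using xy(3) unfolding g_def by blast
  moreover have "q b \<in> poly_ring (verts G)" for b
    unfolding poly_ring_def mem_Collect_eq
  proof
    fix m assume "m \<in> keys (q b)"
    then obtain m' where m': "m' \<in> keys p" "lookup (single (m' - t m') (lookup p m')) m \<noteq> 0"
      unfolding q_def in_keys_iff lookup_sum by (smt (verit) mem_Collect_eq sum.neutral)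
    then have "m = m' - t m'" by (auto simp: lookup_single when_def split: if_splits)
    then have "keys m \<subseteq> keys m'" by (auto simp: in_keys_iff lookup_minus)
    then show "keys m \<subseteq> verts G" using p m'(1) by (auto simp: poly_ring_def)
  qed
  ultimately show "p \<in> edge_ideal G"
    unfolding edge_ideal_def ideal_generated_def by (intro CollectI exI[of _ "g ` keys p"] exI[of _ q]) auto
qed

context koszul
begin

lemma graded_sub_monomial_sub:
  assumes P: "\<And>A B. P A \<Longrightarrow> B \<subseteq> A \<Longrightarrow> P B"
  shows "graded_sub V unit_rank (monomial_sub P)"
  unfolding graded_sub_def
proof (intro conjI ballI allI)
  show "monomial_sub P \<subseteq> free_module V unit_rank" by (auto simp: monomial_sub_def)
  show "0 \<in> monomial_sub P" by (rule monomial_subI) auto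
  fix f assume f: "f \<in> monomial_sub P"
  then have fF: "f \<in> free_module V unit_rank" by (simp add: monomial_sub_def)
  show "f + g \<in> monomial_sub P" if g: "g \<in> monomial_sub P" for g
    using fF g by (intro monomial_subI free_module_add)
      (simp_all add: monomial_sub_def coef_add monomial_subD[OF f] monomial_subD[OF g])
  show "hcomp e f \<in> monomial_sub P" for e
    by (intro monomial_subI free_module_hcomp fF) (simp add: coef_hcomp monomial_subD[OF f])
  show "scale_fvec p f \<in> monomial_sub P" if p: "p \<in> poly_ring V" for p
  proof (intro monomial_subI free_module_scale p fF, rule ccontr)
    fix m assume m: "P (keys m)" "coef (scale_fvec p f) (0, 0) m \<noteq> 0"
    then obtain a d where ad: "m = a + d" "coef f (0, 0) d \<noteq> 0"
      unfolding lookup_scale_fvec by (auto elim: lookup_times_nonzero)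
    have "P (keys d)" using P[OF m(1)] unfolding ad(1) keys_plus_nat by blast
    then show False using monomial_subD[OF f] ad(2) by blast
  qed
qed

lemma monomial_sub_irrelevant:
  assumes "P {}"
  shows "monomial_sub P \<subseteq> irrelevant_part (free_module V unit_rank)"
proof
  fix f assume f: "f \<in> monomial_sub P"
  then have fF: "f \<in> free_module V unit_rank" by (simp add: monomial_sub_def)
  have "coef f c 0 = 0" for c
  proof (cases "c = (0, 0)")
    case True
    then show ?thesis using monomial_subD[OF f, of 0] assms by simp
  next
    case False
    then show ?thesis using free_moduleD[OF fF, of c 0] by auto
  qed
  then show "f \<in> irrelevant_part (free_module V unit_rank)" using fF unfolding irrelevant_part_iff by blast
qed

text \<open>Existence of a minimal resolution makes the chosen table \<open>betti V I\<close> that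
  of an actual resolution, to which the Koszul criterion applies. The face size \<open>e\<close> is
  the strand \<open>j - i\<close>.\<close>

theorem betti_hochster:
  fixes I :: "('v, 'k) mpoly set"
  assumes P: "\<And>A B. P A \<Longrightarrow> B \<subseteq> A \<Longrightarrow> P B" and P0: "P {}"
    and I: "I = {p \<in> poly_ring V. \<forall>m\<in>keys p. \<not> P (keys m)}"
  shows "betti V I i j \<noteq> 0 \<longleftrightarrow>
    (\<exists>W e. W \<subseteq> V \<and> j = i + e \<and> card W = j \<and> \<not> acyclic_at {t. t \<subseteq> W \<and> P t} (msign W) e)"
proof -
  have eq: "unit_sub V I = monomial_sub P"
    unfolding unit_sub_def monomial_sub_def I by (auto simp: free_module_def in_keys_iff)
  have gs: "graded_sub V unit_rank (unit_sub V I)"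
    unfolding eq by (rule graded_sub_monomial_sub[where P = P, OF P])
  have "\<exists>\<beta> d \<epsilon>. minimal_graded_free_resolution V I \<beta> d \<epsilon>"
    by (rule minimal_resolution_exists[OF finite_V gs]) (simp add: eq monomial_sub_irrelevant[where P = P, OF P0])
  then have "\<exists>d \<epsilon>. minimal_graded_free_resolution V I (betti V I) d \<epsilon>"
    unfolding betti_def by (rule someI_ex)
  then obtain d \<epsilon> where "minimal_graded_free_resolution V I (betti V I) d \<epsilon>" by blast
  then have "betti V I i j \<noteq> 0 \<longleftrightarrow> koszul_nonzero unit_rank (unit_sub V I) i (int j - int i)"
    by (rule betti_iff_koszul_nonzero[OF _ gs])
  also have "\<dots> \<longleftrightarrow> (\<exists>W e'. W \<subseteq> V \<and> int j - int i = int e' \<and> card W = e' + i \<and>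
      \<not> acyclic_at {t. t \<subseteq> W \<and> P t} (msign W) e')"
    unfolding eq by (rule hochster[where P = P, OF P])
  also have "\<dots> \<longleftrightarrow> (\<exists>W e. W \<subseteq> V \<and> j = i + e \<and> card W = j \<and> \<not> acyclic_at {t. t \<subseteq> W \<and> P t} (msign W) e)"
  proof -
    have "int j - int i = int e \<and> card W = e + i \<longleftrightarrow> j = i + e \<and> card W = j" for W :: "'v set" and e
      by linarith
    then show ?thesis by (metis (no_types, lifting))
  qed
  finally show ?thesis .
qed

end

text \<open>An exchange argument: the indices up to \<open>t\<close> missing from \<open>A\<close>
  are no more numerous than the members of \<open>A\<close> beyond \<open>t\<close>.\<close>

lemma sum_initial_le:
  fixes h :: "nat \<Rightarrow> nat"
  assumes A: "A \<subseteq> {1..r}" and t: "t \<le> card A"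
    and mono: "\<And>i j. i \<in> {1..r} \<Longrightarrow> j \<in> {1..r} \<Longrightarrow> i \<le> j \<Longrightarrow> h i \<le> h j"
  shows "(\<Sum>i=1..t. h i) \<le> (\<Sum>i\<in>A. h i)"
proof (cases "t = 0")
  case False
  have finA: "finite A" using A by (rule finite_subset) simp
  have "card A \<le> r" using card_mono[OF _ A] by simp
  then have tr: "t \<in> {1..r}" using t False by auto
  have "card ({1..t} - A) + card ({1..t} \<inter> A) = t"
    using card_Int_Diff[of "{1..t}" A] by simp
  moreover have "card (A - {1..t}) + card ({1..t} \<inter> A) = card A"
    using card_Int_Diff[OF finA, of "{1..t}"] by (simp add: Int_commute)
  ultimately have le: "card ({1..t} - A) \<le> card (A - {1..t})" using t by linarith
  \<comment> \<open>The value \<open>h t\<close> separates the two sides: it bounds \<open>h\<close>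
    from above up to \<open>t\<close> and from below beyond \<open>t\<close>.\<close>
  have "(\<Sum>i\<in>{1..t} - A. h i) \<le> card ({1..t} - A) * h t"
    using tr mono by (intro order_trans[OF sum_bounded_above[of _ h "h t"]]) auto
  also have "\<dots> \<le> card (A - {1..t}) * h t" using le by simp
  also have "\<dots> \<le> (\<Sum>i\<in>A - {1..t}. h i)"
    using tr mono A by (intro order_trans[OF _ sum_bounded_below[of _ "h t" h]]) auto
  finally have "(\<Sum>i\<in>{1..t} - A. h i) \<le> (\<Sum>i\<in>A - {1..t}. h i)" .
  moreover have "(\<Sum>i=1..t. h i) = (\<Sum>i\<in>{1..t} \<inter> A. h i) + (\<Sum>i\<in>{1..t} - A. h i)"
    by (rule sum.Int_Diff) simp
  moreover have "(\<Sum>i\<in>A. h i) = (\<Sum>i\<in>{1..t} \<inter> A. h i) + (\<Sum>i\<in>A - {1..t}. h i)"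
    using sum.Int_Diff[OF finA, of h "{1..t}"] by (simp add: Int_commute)
  ultimately show ?thesis by linarith
qed simp

section \<open>The disjoint union of complements of cycles\<close>

locale cycle_family =
  fixes r :: nat and n :: "nat \<Rightarrow> nat" and v :: "nat \<Rightarrow> nat \<Rightarrow> 'v"
  assumes r_pos: "r \<ge> 1"
    and n_ge_4: "\<And>i. i \<in> {1..r} \<Longrightarrow> 4 \<le> n i"
    and n_mono: "\<And>i j. i \<in> {1..r} \<Longrightarrow> j \<in> {1..r} \<Longrightarrow> i \<le> j \<Longrightarrow> n i \<le> n j"
    and inj_v: "inj_on (\<lambda>(i, j). v i j) (SIGMA i:{1..r}. {1..n i})"
begin

definition V :: "'v set" where
  "V = (\<lambda>(i, j). v i j) ` (SIGMA i:{1..r}. {1..n i})"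

definition pos :: "'v \<Rightarrow> nat \<times> nat" where
  "pos = inv_into (SIGMA i:{1..r}. {1..n i}) (\<lambda>(i, j). v i j)"

definition part :: "'v \<Rightarrow> nat" where "part x = fst (pos x)"

definition nxt :: "'v \<Rightarrow> 'v" where
  "nxt x = (case pos x of (i, j) \<Rightarrow> v i (j mod n i + 1))"

lemma pos_v: "i \<in> {1..r} \<Longrightarrow> j \<in> {1..n i} \<Longrightarrow> pos (v i j) = (i, j)"
  unfolding pos_def using inv_into_f_f[OF inj_v, of "(i, j)"] by simp

lemma part_v: "i \<in> {1..r} \<Longrightarrow> j \<in> {1..n i} \<Longrightarrow> part (v i j) = i"
  by (simp add: part_def pos_v)

lemma nxt_v: "i \<in> {1..r} \<Longrightarrow> j \<in> {1..n i} \<Longrightarrow> nxt (v i j) = v i (j mod n i + 1)"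
  by (simp add: nxt_def pos_v)

lemma v_in_V: "i \<in> {1..r} \<Longrightarrow> j \<in> {1..n i} \<Longrightarrow> v i j \<in> V"
  unfolding V_def by force

lemma V_cases:
  assumes "x \<in> V"
  obtains i j where "i \<in> {1..r}" "j \<in> {1..n i}" "x = v i j"
  using assms unfolding V_def by force

lemma v_eq_iff: "i \<in> {1..r} \<Longrightarrow> j \<in> {1..n i} \<Longrightarrow> i' \<in> {1..r} \<Longrightarrow> j' \<in> {1..n i'} \<Longrightarrow>
    v i j = v i' j' \<longleftrightarrow> i = i' \<and> j = j'"
  using pos_v[of i j] pos_v[of i' j'] by (metis prod.inject)

lemma mod_in: "i \<in> {1..r} \<Longrightarrow> j mod n i + 1 \<in> {1..n i}"
proof -
  assume "i \<in> {1..r}"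
  then have "0 < n i" using n_ge_4[of i] by linarith
  then show ?thesis by (simp add: Suc_leI)
qed

text \<open>With positions shifted to start at 0, the successor is addition of 1 modulo the
  length.\<close>

lemma funpow_nxt:
  assumes i: "i \<in> {1..r}" and j: "j \<in> {1..n i}"
  shows "(nxt ^^ t) (v i j) = v i ((j - 1 + t) mod n i + 1)"
proof (induction t)
  case 0
  have "j - 1 < n i" using j by auto
  then show ?case using j by simp
next
  case (Suc t)
  have "((j - 1 + t) mod n i + 1) mod n i = (j - 1 + Suc t) mod n i"
    by (simp add: mod_Suc_eq)
  then show ?case using Suc nxt_v[OF i mod_in[OF i]] by simp
qed

text \<open>Fewer than four steps cannot complete a turn on a cycle of length at least 4; this
  excludes the short cycles in \<open>cyclic_parts\<close>.\<close>

lemma funpow_nxt_neq: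
  assumes x: "x \<in> V" and t: "0 < t" "t < 4"
  shows "(nxt ^^ t) x \<noteq> x"
proof -
  obtain i j where ij: "i \<in> {1..r}" "j \<in> {1..n i}" "x = v i j" by (rule V_cases[OF x])
  have "t < n i" using n_ge_4[OF ij(1)] t by linarith
  then have "(j - 1 + t) mod n i \<noteq> j - 1"
    using ij(2) t(1) by (auto simp: mod_if le_mod_geq)
  then have "(j - 1 + t) mod n i + 1 \<noteq> j" using ij(2) by auto
  then show ?thesis unfolding ij(3) funpow_nxt[OF ij(1,2)]
    using v_eq_iff[OF ij(1) mod_in[OF ij(1)] ij(1,2)] by blast
qed

sublocale cyclic_parts V part nxt
proof
  show "finite V" by (simp add: V_def)
  fix x assume x: "x \<in> V"
  then obtain i j where ij: "i \<in> {1..r}" "j \<in> {1..n i}" "x = v i j" by (rule V_cases)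
  show "nxt x \<in> V" using ij nxt_v mod_in v_in_V by simp
  show "part (nxt x) = part x" using ij nxt_v[OF ij(1,2)] part_v mod_in by simp
  show "nxt (nxt x) \<noteq> x" using funpow_nxt_neq[OF x, of 2] by (simp add: numeral_2_eq_2)
  show "nxt (nxt (nxt x)) \<noteq> x" using funpow_nxt_neq[OF x, of 3] by (simp add: numeral_3_eq_3)
next
  show "inj_on nxt V"
  proof (rule inj_onI)
    fix x y assume "x \<in> V" "y \<in> V" and eq: "nxt x = nxt y"
    obtain i j where ij: "i \<in> {1..r}" "j \<in> {1..n i}" "x = v i j" by (rule V_cases[OF \<open>x \<in> V\<close>])
    obtain i' j' where ij': "i' \<in> {1..r}" "j' \<in> {1..n i'}" "y = v i' j'" by (rule V_cases[OF \<open>y \<in> V\<close>])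
    have "i = i' \<and> j mod n i = j' mod n i'"
      using eq v_eq_iff[OF ij(1) mod_in[OF ij(1), of j] ij'(1) mod_in[OF ij'(1), of j']]
      unfolding ij(3) ij'(3) nxt_v[OF ij(1,2)] nxt_v[OF ij'(1,2)] by (metis add_right_cancel)
    moreover have "j = j'" if "j mod n i = j' mod n i" "j' \<in> {1..n i}"
      using that ij(2) by (cases "j = n i"; cases "j' = n i") auto
    ultimately show "x = y" using ij' ij by auto
  qed
next
  fix U u x assume U: "U \<subseteq> V" "\<And>u. u \<in> U \<Longrightarrow> nxt u \<in> U" "u \<in> U" and x: "x \<in> V" "part x = part u"
  obtain i j where ij: "i \<in> {1..r}" "j \<in> {1..n i}" "u = v i j" using U V_cases by blast
  obtain i' k where k': "i' \<in> {1..r}" "k \<in> {1..n i'}" "x = v i' k" by (rule V_cases[OF x(1)])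
  have "i' = i" using x(2) ij k' part_v by simp
  then have k: "k \<in> {1..n i}" "x = v i k" using k' by auto
  have pow: "(nxt ^^ t) u \<in> U" for t by (induction t) (auto simp: U)
  \<comment> \<open>The number of steps from \<open>j\<close> to \<open>k\<close> is increased by a
    full turn \<open>n i\<close>, so that it is a natural number also for
    \<open>k < j\<close>.\<close>
  have "(j - 1 + (n i - j + k)) mod n i + 1 = k"
  proof -
    have "j - 1 + (n i - j + k) = n i + (k - 1)" using ij(2) k(1) by auto
    moreover have "k - 1 < n i" using k(1) by auto
    ultimately have "(j - 1 + (n i - j + k)) mod n i = k - 1" by (simp only: mod_add_self1 mod_less)
    then show ?thesis using k(1) by simp
  qed
  then have "(nxt ^^ (n i - j + k)) u = x" unfolding ij(3) funpow_nxt[OF ij(1,2)] k(2) by simp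
  then show "x \<in> U" using pow by blast
qed

definition G :: "'v graph" where
  "G = union_graph {1..r} (\<lambda>i. complement_graph (cycle_graph (n i) (v i)))"

lemma verts_G: "verts G = V"
  unfolding G_def union_graph_def complement_graph_def cycle_graph_def V_def by force

text \<open>An unordered pair determines its members up to order, so the removed cycle edges are
  exactly the pairs in the symmetric relation \<open>adj\<close>. Consequently a set of vertices
  contains an edge iff it is not a face.\<close>

lemma edge_iff:
  "{x, y} \<in> edges G \<longleftrightarrow> x \<in> V \<and> y \<in> V \<and> part x = part y \<and> x \<noteq> y \<and> \<not> adj x y"
proof -
  let ?C = "\<lambda>i. {{v i j, v i (j mod n i + 1)} | j. j \<in> {1..n i}}"
  let ?K = "\<lambda>i. {{x, y} | x y. x \<in> v i ` {1..n i} \<and> y \<in> v i ` {1..n i} \<and> x \<noteq> y}"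
  have edges: "edges G = (\<Union>i\<in>{1..r}. ?K i - ?C i)"
    unfolding G_def union_graph_def complement_graph_def cycle_graph_def by simp
  have C_iff: "{x, y} \<in> ?C i \<longleftrightarrow> adj x y" if i: "i \<in> {1..r}" "x \<in> v i ` {1..n i}" "y \<in> v i ` {1..n i}" for i x y
  proof
    assume "{x, y} \<in> ?C i"
    then obtain j where j: "j \<in> {1..n i}" "{x, y} = {v i j, nxt (v i j)}" using nxt_v[OF i(1)] by force
    then show "adj x y" unfolding adj_def doubleton_eq_iff by blast
  next
    assume "adj x y"
    moreover have "{z, nxt z} \<in> ?C i" if "z \<in> v i ` {1..n i}" for z
      using that nxt_v[OF i(1)] by force
    ultimately show "{x, y} \<in> ?C i" using i(2,3) unfolding adj_def by (metis (no_types, lifting) insert_commute)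
  qed
  have K_iff: "{x, y} \<in> ?K i \<longleftrightarrow> x \<in> v i ` {1..n i} \<and> y \<in> v i ` {1..n i} \<and> x \<noteq> y" for i x y
    by (auto simp: doubleton_eq_iff)
  have part_iff: "x \<in> v i ` {1..n i} \<longleftrightarrow> x \<in> V \<and> part x = i" if "i \<in> {1..r}" for i x
    using that v_in_V part_v by (auto elim: V_cases)
  have part_in: "part x \<in> {1..r}" if "x \<in> V" for x using that part_v by (auto elim: V_cases)
  have "{x, y} \<in> edges G \<longleftrightarrow> (\<exists>i\<in>{1..r}. {x, y} \<in> ?K i \<and> {x, y} \<notin> ?C i)"
    unfolding edges by blast
  also have "\<dots> \<longleftrightarrow> (\<exists>i\<in>{1..r}. x \<in> v i ` {1..n i} \<and> y \<in> v i ` {1..n i} \<and> x \<noteq> y \<and> \<not> adj x y)"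
    unfolding K_iff using C_iff by blast
  also have "\<dots> \<longleftrightarrow> x \<in> V \<and> y \<in> V \<and> part x = part y \<and> x \<noteq> y \<and> \<not> adj x y"
    using part_iff part_in by metis
  finally show ?thesis .
qed

section \<open>Counting vertices part by part\<close>

lemma part_in: "x \<in> V \<Longrightarrow> part x \<in> {1..r}"
  using part_v by (auto elim: V_cases)

lemma one_in: "i \<in> {1..r} \<Longrightarrow> 1 \<in> {1..n i}"
  using n_ge_4[of i] by simp

lemma part_image: "part ` V = {1..r}"
proof (intro equalityI subsetI)
  fix i assume "i \<in> {1..r}"
  then show "i \<in> part ` V" using part_v[OF _ one_in] v_in_V[OF _ one_in] by (metis imageI)
qed (use part_in in blast)

lemma card_by_parts:
  assumes "W \<subseteq> V"
  shows "card W = (\<Sum>i\<in>{1..r}. card {x \<in> W. part x = i})"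
proof -
  have "finite W" using assms finite_V by (rule finite_subset)
  then show ?thesis
    using assms part_in by (subst card_eq_sum, subst sum.group[symmetric, of _ "{1..r}" part]) auto
qed

lemma card_part:
  assumes i: "i \<in> {1..r}"
  shows "card {x \<in> V. part x = i} = n i"
proof -
  have "{x \<in> V. part x = i} = v i ` {1..n i}"
    using i v_in_V part_v by (auto elim: V_cases)
  moreover have "inj_on (v i) {1..n i}" using v_eq_iff[OF i _ i] by (auto intro: inj_onI)
  ultimately show ?thesis by (simp add: card_image)
qed

lemma rank_eq: "rank W = (\<Sum>i\<in>{1..r}. local_rank W i)"
  unfolding rank_def part_image ..

lemma rank_le: "rank W \<le> 2 * r"
proof -
  have "local_rank W i \<le> 2" for i by (simp add: local_rank_def)
  then show ?thesis
    unfolding rank_eq using sum_bounded_above[of "{1..r}" "local_rank W" 2] by (simp add: mult.commute)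
qed

text \<open>Part by part, \<open>W\<close> has at least twice the local rank many vertices, and a
  full part has \<open>n i - 4\<close> more. Since a part contributes to the rank at most 1, or 2 if
  full, at least \<open>e - r\<close> parts are full; the shortest cycles minimize the
  excess.\<close>

lemma card_lower_bound:
  assumes W: "W \<subseteq> V" and ends: "\<And>i. card (ends W i) \<noteq> 1" and e: "e \<le> rank W"
  shows "2 * e + (\<Sum>i=1..e - r. n i - 4) \<le> card W"
proof -
  have finW: "finite W" using W finite_V by (rule finite_subset)
  let ?full = "\<lambda>i. \<forall>x\<in>V. part x = i \<longrightarrow> x \<in> W"
  let ?A = "{i \<in> {1..r}. ?full i}"
  have part_bound: "2 * local_rank W i + (if i \<in> ?A then n i - 4 else 0) \<le> card {x \<in> W. part x = i}"
    if i: "i \<in> {1..r}" for i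
  proof -
    have vi: "v i 1 \<in> V" "part (v i 1) = i" using v_in_V[OF i one_in[OF i]] part_v[OF i one_in[OF i]] by auto
    consider (empty) "\<forall>x\<in>W. part x \<noteq> i" | (full) "?full i" | (partial) "\<not> (\<forall>x\<in>W. part x \<noteq> i)" "\<not> ?full i"
      by blast
    then show ?thesis
    proof cases
      case empty
      then have "local_rank W i = 0" by (simp add: local_rank_def)
      moreover have "i \<notin> ?A" using empty vi by blast
      ultimately show ?thesis by (simp only: if_False mult_0_right add_0_right le0)
    next
      case full
      have "{x \<in> W. part x = i} = {x \<in> V. part x = i}" using full W by blast
      then have "card {x \<in> W. part x = i} = n i" using card_part[OF i] by simp
      moreover have "local_rank W i \<le> 2" by (simp add: local_rank_def)
      moreover have "(if i \<in> ?A then n i - 4 else 0) \<le> n i - 4" by simp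
      ultimately show ?thesis using n_ge_4[OF i] by linarith
    next
      case partial
      then obtain u where u: "u \<in> W" "part u = i" by blast
      have sub: "ends W i \<subseteq> {x \<in> W. part x = i}" by (auto simp: ends_def)
      \<comment> \<open>A nonempty part without ends is closed under \<open>nxt\<close>, hence full.
        As exactly one end is excluded, a partial part has at least two.\<close>
      have "ends W i \<noteq> {}"
      proof
        assume none: "ends W i = {}"
        have "x \<in> {x \<in> W. part x = i}" if "x \<in> V" "part x = i" for x
        proof (rule closed_nxt[of _ u])
          fix w assume "w \<in> {x \<in> W. part x = i}"
          then have w: "w \<in> W" "part w = i" by auto
          have "nxt w \<in> W" using none w unfolding ends_def by blast
          then show "nxt w \<in> {x \<in> W. part x = i}" using part_nxt[of w] w W by auto
        qed (use W u that in auto)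
        then show False using partial(2) by blast
      qed
      moreover have "finite (ends W i)" by (rule finite_subset[OF sub]) (use finW in simp)
      ultimately have "card (ends W i) \<noteq> 0" by simp
      then have "2 \<le> card (ends W i)" using ends[of i] by linarith
      also have "\<dots> \<le> card {x \<in> W. part x = i}" using finW by (intro card_mono[OF _ sub]) simp
      finally have "2 \<le> card {x \<in> W. part x = i}" .
      moreover have "local_rank W i = 1" unfolding local_rank_def if_not_P[OF partial(1)] if_not_P[OF partial(2)] ..
      moreover have "i \<notin> ?A" using partial(2) by blast
      ultimately show ?thesis by (simp only: if_False mult_1_right add_0_right)
    qed
  qed
  have "2 * rank W + (\<Sum>i\<in>?A. n i - 4) = (\<Sum>i\<in>{1..r}. 2 * local_rank W i + (if i \<in> ?A then n i - 4 else 0))"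
  proof -
    have "(\<Sum>i\<in>{1..r}. if i \<in> ?A then n i - 4 else 0) = (\<Sum>i\<in>?A. n i - 4)"
      by (rule sum.mono_neutral_cong_right) auto
    then show ?thesis unfolding rank_eq sum.distrib sum_distrib_left by simp
  qed
  also have "\<dots> \<le> card W" unfolding card_by_parts[OF W] by (rule sum_mono[OF part_bound])
  finally have 1: "2 * rank W + (\<Sum>i\<in>?A. n i - 4) \<le> card W" .
  have "rank W \<le> (\<Sum>i\<in>{1..r}. 1 + (if i \<in> ?A then 1 else 0))"
    unfolding rank_eq by (rule sum_mono) (simp add: local_rank_def)
  also have "\<dots> = r + card ?A"
  proof -
    have "(\<Sum>i\<in>{1..r}. if i \<in> ?A then 1 else 0) = (\<Sum>i\<in>?A. 1 :: nat)"
      by (rule sum.mono_neutral_cong_right) auto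
    then show ?thesis unfolding sum.distrib by simp
  qed
  finally have "e - r \<le> card ?A" using e by linarith
  then have "(\<Sum>i=1..e - r. n i - 4) \<le> (\<Sum>i\<in>?A. n i - 4)"
  proof (intro sum_initial_le[of _ r])
    show "n i - 4 \<le> n j - 4" if "i \<in> {1..r}" "j \<in> {1..r}" "i \<le> j" for i j
      using n_mono[OF that] by (rule diff_le_mono)
  qed auto
  then show ?thesis using 1 e by linarith
qed

text \<open>Length at least 4 keeps the positions 1 and 3 apart on both sides of the cycle.\<close>

lemma not_adj_1_3:
  assumes i: "i \<in> {1..r}"
  shows "v i 1 \<noteq> v i 3 \<and> \<not> adj (v i 1) (v i 3)"
proof -
  have n4: "4 \<le> n i" using n_ge_4[OF i] .
  then have j: "1 \<in> {1..n i}" "2 \<in> {1..n i}" "3 \<in> {1..n i}" "4 \<in> {1..n i}" by auto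
  have "nxt (v i 1) = v i 2" "nxt (v i 3) = v i 4"
    using nxt_v[OF i j(1)] nxt_v[OF i j(3)] n4 by (simp_all add: numeral_2_eq_2)
  then show ?thesis
    using v_eq_iff[OF i j(1) i j(3)] v_eq_iff[OF i j(3) i j(2)] v_eq_iff[OF i j(1) i j(4)]
    by (simp add: adj_def)
qed

text \<open>Attains the bound: the shortest circles are taken in full, the next ones contribute a
  pair of nonadjacent vertices, and the remaining ones are left out.\<close>

lemma extremal_set:
  assumes e: "e \<le> 2 * r"
  shows "\<exists>W\<subseteq>V. card W = 2 * e + (\<Sum>i=1..e - r. n i - 4) \<and> (\<forall>i. spherical W i) \<and> rank W = e"
proof -
  \<comment> \<open>\<open>t\<close> parts are full and \<open>s\<close> parts are nonempty. The
    subtraction is truncated: up to \<open>e = r\<close> pairs suffice, beyond that all parts are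
    nonempty and each further unit of rank fills one circle.\<close>
  define t where "t = e - r"
  define s where "s = min e r"
  have ts: "t \<le> s" "s \<le> r" "t + s = e" using e by (auto simp: t_def s_def)
  define W where "W = {x \<in> V. part x \<le> t \<or> part x \<le> s \<and> (x = v (part x) 1 \<or> x = v (part x) 3)}"
  have WV: "W \<subseteq> V" by (auto simp: W_def)
  have full: "{x \<in> W. part x = i} = {x \<in> V. part x = i}" if "i \<le> t" for i
    using that by (auto simp: W_def)
  have pair: "{x \<in> W. part x = i} = {v i 1, v i 3}" if i: "i \<in> {1..r}" "\<not> i \<le> t" "i \<le> s" for i
  proof -
    have "1 \<in> {1..n i}" "3 \<in> {1..n i}" using n_ge_4[OF i(1)] by auto
    then have "v i 1 \<in> V" "v i 3 \<in> V" "part (v i 1) = i" "part (v i 3) = i"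
      using v_in_V[OF i(1)] part_v[OF i(1)] by blast+
    then show ?thesis using i by (auto simp: W_def)
  qed
  have none: "{x \<in> W. part x = i} = {}" if "\<not> i \<le> s" for i
    using that ts by (auto simp: W_def)
  have "spherical W i" for i
  proof (cases "i \<in> {1..r}")
    case False
    then show ?thesis unfolding spherical_def using WV part_in by blast
  next
    case True
    consider "i \<le> t" | "\<not> i \<le> t" "i \<le> s" | "\<not> i \<le> s" by blast
    then show ?thesis
    proof cases
      case 1
      then show ?thesis unfolding spherical_def using full[OF 1] by blast
    next
      case 2
      then show ?thesis unfolding spherical_def using pair[OF True 2] not_adj_1_3[OF True] by blast
    next
      case 3
      then show ?thesis unfolding spherical_def using none[OF 3] by blast
    qed
  qed
  moreover have local: "local_rank W i = (if i \<le> t then 1 else 0) + (if i \<le> s then 1 else 0) \<and>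
      card {x \<in> W. part x = i} = 2 * local_rank W i + (if i \<le> t then n i - 4 else 0)" if i: "i \<in> {1..r}" for i
  proof -
    consider "i \<le> t" | "\<not> i \<le> t" "i \<le> s" | "\<not> i \<le> s" by blast
    then show ?thesis
    proof cases
      case 1
      have "v i 1 \<in> {x \<in> V. part x = i}" using v_in_V[OF i one_in[OF i]] part_v[OF i one_in[OF i]] by blast
      then have ne: "\<not> (\<forall>x\<in>W. part x \<noteq> i)" using full[OF 1] by blast
      have "\<forall>x\<in>V. part x = i \<longrightarrow> x \<in> W" using full[OF 1] by blast
      then have "local_rank W i = 2" unfolding local_rank_def if_not_P[OF ne] by (rule if_P)
      then show ?thesis using 1 ts n_ge_4[OF i] card_part[OF i] unfolding full[OF 1] by simp
    next
      case 2
      have "v i 1 \<in> {x \<in> W. part x = i}" unfolding pair[OF i 2] by simp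
      then have ne: "\<not> (\<forall>x\<in>W. part x \<noteq> i)" by blast
      have j: "1 \<in> {1..n i}" "2 \<in> {1..n i}" "3 \<in> {1..n i}" using n_ge_4[OF i] by auto
      have "v i 2 \<notin> {v i 1, v i 3}"
        using v_eq_iff[OF i j(2) i j(1)] v_eq_iff[OF i j(2) i j(3)] by simp
      then have nf: "\<not> (\<forall>x\<in>V. part x = i \<longrightarrow> x \<in> W)"
        unfolding pair[OF i 2, symmetric] using v_in_V[OF i j(2)] part_v[OF i j(2)] by blast
      have "local_rank W i = 1" unfolding local_rank_def if_not_P[OF ne] if_not_P[OF nf] ..
      then show ?thesis using 2 not_adj_1_3[OF i] unfolding pair[OF i 2] by simp
    next
      case 3
      have "\<forall>x\<in>W. part x \<noteq> i" using none[OF 3] by blast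
      then have "local_rank W i = 0" unfolding local_rank_def by (rule if_P)
      then show ?thesis using 3 ts unfolding none[OF 3] by simp
    qed
  qed
  have restrict: "(\<Sum>i\<in>{1..r}. if i \<le> q then f i else 0) = (\<Sum>i=1..q. f i)" if "q \<le> r" for q and f :: "nat \<Rightarrow> nat"
    using that by (intro sum.mono_neutral_cong_right) auto
  have rank: "rank W = e"
  proof -
    have "rank W = (\<Sum>i\<in>{1..r}. (if i \<le> t then 1 else 0) + (if i \<le> s then 1 else 0))"
      unfolding rank_eq using local by (intro sum.cong) blast+
    also have "\<dots> = e" unfolding sum.distrib using restrict[of t "\<lambda>_. 1"] restrict[of s "\<lambda>_. 1"] ts by simp
    finally show ?thesis .
  qed
  moreover have "card W = 2 * e + (\<Sum>i=1..t. n i - 4)"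
  proof -
    have "card W = (\<Sum>i\<in>{1..r}. 2 * local_rank W i + (if i \<le> t then n i - 4 else 0))"
      unfolding card_by_parts[OF WV] using local by (intro sum.cong) blast+
    also have "\<dots> = 2 * rank W + (\<Sum>i=1..t. n i - 4)"
      unfolding sum.distrib rank_eq sum_distrib_left[symmetric] using restrict[of t "\<lambda>i. n i - 4"] ts by simp
    finally show ?thesis unfolding rank .
  qed
  ultimately show ?thesis using WV unfolding t_def by blast
qed

text \<open>The least cardinality of a contributing \<open>W\<close> minus \<open>e\<close>, because
  the homological index is \<open>card W - e\<close>. For \<open>e \<le> r\<close> the sum is
  empty.\<close>

definition min_index :: "nat \<Rightarrow> nat" where
  "min_index e = e + (\<Sum>i=1..e - r. n i - 4)"

lemma betti_strands:
  fixes I :: "('v, 'k::field) mpoly set"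
  assumes I: "I = edge_ideal G"
  shows betti_bound: "betti V I i j \<noteq> 0 \<Longrightarrow> \<exists>e. j = i + e \<and> e \<le> 2 * r \<and> min_index e \<le> i"
    and betti_extremal: "e \<le> 2 * r \<Longrightarrow> betti V I (min_index e) (min_index e + e) \<noteq> 0"
proof -
  obtain sg :: "'v \<Rightarrow> 'v set \<Rightarrow> 'k" where "koszul_sign V sg"
    using koszul_sign_exists[OF finite_V] by blast
  then interpret koszul V sg using finite_V by unfold_locales
  \<comment> \<open>The property of being a face without reference to \<open>W\<close>, closed under
    subsets; the ideal is spanned by the monomials whose support violates it.\<close>
  define P where "P A \<longleftrightarrow> (\<forall>x\<in>A. \<forall>y\<in>A. x \<noteq> y \<longrightarrow> part x = part y \<longrightarrow> adj x y)" for A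
  have faces: "faces W = {t. t \<subseteq> W \<and> P t}" for W unfolding faces_def P_def ..
  have I_eq: "I = {p \<in> poly_ring V. \<forall>m\<in>keys p. \<not> P (keys m)}"
  proof -
    have "I = {p \<in> poly_ring V. \<forall>m\<in>keys p. \<exists>x\<in>keys m. \<exists>y\<in>keys m. {x, y} \<in> edges G}"
      unfolding I using edge_ideal_eq[of G] edge_iff unfolding verts_G by blast
    also have "\<dots> = {p \<in> poly_ring V. \<forall>m\<in>keys p. \<not> P (keys m)}"
    proof (intro Collect_cong conj_cong refl ball_cong)
      fix p :: "('v, 'k) mpoly" and m assume "p \<in> poly_ring V" "m \<in> keys p"
      then have "keys m \<subseteq> V" by (auto simp: poly_ring_def)
      then show "(\<exists>x\<in>keys m. \<exists>y\<in>keys m. {x, y} \<in> edges G) \<longleftrightarrow> \<not> P (keys m)"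
        unfolding edge_iff P_def by blast
    qed
    finally show ?thesis .
  qed
  have betti: "betti V I i j \<noteq> 0 \<longleftrightarrow>
      (\<exists>W e. W \<subseteq> V \<and> j = i + e \<and> card W = j \<and> \<not> acyclic_at (faces W) (msign W) e)" for i j
    unfolding faces by (rule betti_hochster[OF _ _ I_eq]) (auto simp: P_def)
  have sign: "sign_rule (faces W) (msign W)" if "W \<subseteq> V" for W
    by (rule sign_rule_msign[OF that]) (auto simp: faces_def)
  {
    assume "betti V I i j \<noteq> 0"
    then obtain W e where W: "W \<subseteq> V" "j = i + e" "card W = j" "\<not> acyclic_at (faces W) (msign W) e"
      unfolding betti by blast
    have "(\<forall>i. card (ends W i) \<noteq> 1) \<and> e \<le> rank W" by (rule not_acyclic_faces[OF W(1) sign[OF W(1)] W(4)])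
    then have "2 * e + (\<Sum>i=1..e - r. n i - 4) \<le> card W" "e \<le> 2 * r"
      using card_lower_bound[OF W(1)] rank_le[of W] by auto
    then show "\<exists>e. j = i + e \<and> e \<le> 2 * r \<and> min_index e \<le> i"
      using W(2,3) by (intro exI[of _ e]) (simp add: min_index_def)
  }
  assume "e \<le> 2 * r"
  then obtain W where W: "W \<subseteq> V" "card W = 2 * e + (\<Sum>i=1..e - r. n i - 4)" "\<And>i. spherical W i" "rank W = e"
    using extremal_set by blast
  have "\<not> acyclic_at (faces W) (msign W) e"
    using not_acyclic_spherical[OF W(1,3) sign[OF W(1)]] W(4) by simp
  then show "betti V I (min_index e) (min_index e + e) \<noteq> 0"
    unfolding betti using W(1,2) by (intro exI[of _ W] exI[of _ e]) (simp add: min_index_def)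
qed

section \<open>Regularity and jumps\<close>

lemma regularity_eq:
  fixes I :: "('v, 'k::field) mpoly set"
  assumes I: "I = edge_ideal G"
  shows "regularity V I = 2 * int r + 1"
  unfolding regularity_def
proof (rule Max_eqI)
  let ?S = "{int j - int i + 1 | i j. betti V I i j \<noteq> 0}"
  have range: "1 \<le> y \<and> y \<le> 2 * int r + 1" if "y \<in> ?S" for y
    using that betti_bound[OF I] by fastforce
  then have "?S \<subseteq> {1..2 * int r + 1}" by (intro subsetI) (simp only: atLeastAtMost_iff)
  then show "finite ?S" by (rule finite_subset) simp
  show "y \<le> 2 * int r + 1" if "y \<in> ?S" for y using range[OF that] by simp
  show "2 * int r + 1 \<in> ?S"
    using betti_extremal[OF I, of "2 * r"]
    by (intro CollectI exI[of _ "min_index (2 * r)"] exI[of _ "min_index (2 * r) + 2 * r"]) simp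
qed

text \<open>The entry with index \<open>s\<close> belongs to the strand
  \<open>j - i = s + 1\<close>, which explains the shift.\<close>

lemma jump_eq:
  fixes I :: "('v, 'k::field) mpoly set"
  assumes I: "I = edge_ideal G" and s: "s + 1 \<le> 2 * r"
  shows "jump V I s = int (min_index (s + 1)) - 1"
proof -
  have "(LEAST i. betti V I i (i + s + 1) \<noteq> 0) = min_index (s + 1)"
  proof (rule Least_equality)
    show "betti V I (min_index (s + 1)) (min_index (s + 1) + s + 1) \<noteq> 0"
      using betti_extremal[OF I s] by (simp add: add.assoc)
    show "min_index (s + 1) \<le> i" if "betti V I i (i + s + 1) \<noteq> 0" for i
      using betti_bound[OF I that] by auto
  qed
  then show ?thesis by (simp add: jump_def)
qed

text \<open>Below \<open>r\<close> the truncated \<open>s + 1 - r\<close> is 0 and the step is 1.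
  From \<open>s = r\<close> on each step also adds one summand
  \<open>n (s + 1 - r) - 4\<close>.\<close>

lemma min_index_diff:
  assumes s: "s + 1 \<le> 2 * r"
  shows "int (min_index (s + 1)) - int (min_index s) = (if s < r then 1 else int (n (s + 1 - r)) - 3)"
proof (cases "s < r")
  case False
  then have "s + 1 - r = Suc (s - r)" by simp
  moreover have "4 \<le> n (Suc (s - r))" using n_ge_4[of "Suc (s - r)"] s False by simp
  ultimately show ?thesis using False by (simp add: min_index_def)
qed (simp add: min_index_def)

lemma relative_jump_sequence_eq:
  fixes I :: "('v, 'k::field) mpoly set"
  assumes I: "I = edge_ideal G"
  shows "relative_jump_sequence V I =
    (2 * r, replicate (r - 1) 1 @ map (\<lambda>i. int (n i) - 3) [1..<r + 1])"
proof -
  have k: "nat (regularity V I - 1) = 2 * r" using regularity_eq[OF I] by simp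
  have "map (\<lambda>s. if s = 1 then jump V I 1 else jump V I s - jump V I (s - 1)) [1..<2 * r] =
      replicate (r - 1) 1 @ map (\<lambda>i. int (n i) - 3) [1..<r + 1]" (is "?l = ?r")
  proof (rule nth_equalityI)
    show "length ?l = length ?r" using r_pos by simp
    fix q assume "q < length ?l"
    then have q: "q + 1 < 2 * r" by simp
    define s where "s = q + 1"
    have "?l ! q = int (min_index (s + 1)) - int (min_index s)"
    proof (cases "s = 1")
      case True
      \<comment> \<open>This makes the first entry, which is not a difference of jumps, follow the
        same formula: \<open>min_index 1\<close> equals the 1 subtracted in
        \<open>jump\<close>.\<close>
      have "min_index 1 = 1" using r_pos by (simp add: min_index_def)
      then show ?thesis using q True jump_eq[OF I, of 1] by (simp add: s_def)
    next
      case False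
      then show ?thesis using q jump_eq[OF I, of s] jump_eq[OF I, of "s - 1"] by (simp add: s_def)
    qed
    also have "\<dots> = (if s < r then 1 else int (n (s + 1 - r)) - 3)"
      by (rule min_index_diff) (use q s_def in simp)
    also have "\<dots> = ?r ! q"
    proof (cases "s < r")
      case False
      have "q - (r - 1) < r" "1 + (q - (r - 1)) = s + 1 - r" using q False by (auto simp: s_def)
      then have "map (\<lambda>i. int (n i) - 3) [1..<r + 1] ! (q - (r - 1)) = int (n (s + 1 - r)) - 3"
        by (simp del: upt_Suc)
      moreover have "\<not> q < r - 1" using False by (simp add: s_def)
      ultimately show ?thesis using False by (simp add: nth_append del: upt_Suc)
    next
      case True
      then have "q < r - 1" by (simp add: s_def)
      then show ?thesis using True by (simp add: nth_append)
    qed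
    finally show "?l ! q = ?r ! q" .
  qed
  then show ?thesis unfolding relative_jump_sequence_def k Let_def by simp
qed

end

theorem proposition5p5:
  fixes r :: nat
    and n :: "nat \<Rightarrow> nat"
    and v :: "nat \<Rightarrow> nat \<Rightarrow> 'v"
    and G :: "'v graph"
    and I :: "('v, 'k::field_char_0) mpoly set"
  assumes "r \<ge> 1"
    and "\<And>i. i \<in> {1..r} \<Longrightarrow> 4 \<le> n i"
    and "\<And>i j. i \<in> {1..r} \<Longrightarrow> j \<in> {1..r} \<Longrightarrow> i \<le> j \<Longrightarrow> n i \<le> n j"
    and "inj_on (\<lambda>(i, j). v i j) (SIGMA i:{1..r}. {1..n i})"
    and "G = union_graph {1..r} (\<lambda>i. complement_graph (cycle_graph (n i) (v i)))"
    and "I = edge_ideal G"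
  shows "regularity (verts G) I = 2 * int r + 1 \<and>
         relative_jump_sequence (verts G) I =
           (2 * r, replicate (r - 1) 1 @ map (\<lambda>i. int (n i) - 3) [1..<r + 1])"
proof -
  interpret F: cycle_family r n v using assms(1-4) by unfold_locales
  have G: "G = F.G" unfolding F.G_def by (rule assms(5))
  show ?thesis
    using F.regularity_eq F.relative_jump_sequence_eq assms(6) unfolding G F.verts_G by blast
qed

end
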